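(* Over $\mathsf{ACA}_0^\omega$, for each $i\in\{0,1\}$ we have $\mathsf{cocode}_i\leftrightarrow \mathsf{cocode}_i^{\mathbb{R}}\leftrightarrow \mathsf{cocode}_i^{C}$.
   Context: Work in higher-order arithmetic: $\mathsf{RCA}_0^\omega$ is Kohlenbach's base theory and $\mathsf{ACA}_0^\omega$ is $\mathsf{RCA}_0^\omega$ plus $(\exists^2)$: there is $\varphi^2\le_2 1$ with $(\exists n)(f(n)=0)\leftrightarrow \varphi(f)=0$ for all $f\in\mathbb{N}^{\mathbb{N}}$. Reals are fast-converging Cauchy sequences; functions on reals respect real equality. A subset $A$ of $\mathsf{X}\in\{[0,1],\mathbb{R},C=2^{\mathbb{N}}\}$ is given by a characteristic function $A:\mathsf{X}\to\{0,1\}$, with $x\in A$ meaning $A(x)=1$. $A$ is countable if there is $Y:\mathsf{X}\to\mathbb{N}$ injective on $A$, i.e. $(\forall x,y\in A)(Y(x)=Y(y)\to x=y)$; $A$ is strongly countable if moreover $Y$ is surjective onto $\mathbb{N}$ from $A$, i.e. $(\forall n\in\mathbb{N})(\exists x\in A)(Y(x)=n)$ ($Y$ is a bijection on $A$). $A$ is enumerable if there is a sequence $(x_n)_{n\in\mathbb{N}}$ in $\mathsf{X}$ such that for all $x\in\mathsf{X}$: $x\in A\leftrightarrow(\exists n)(x=x_n)$. $\mathsf{cocode}_0^{\mathsf{X}}$: every countable subset of $\mathsf{X}$ is enumerable. $\mathsf{cocode}_1^{\mathsf{X}}$: every strongly countable subset of $\mathsf{X}$ is enumerable. $\mathsf{cocode}_i$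 denotes $\mathsf{cocode}_i^{[0,1]}$. *)

theory Defs
  imports Main
begin

section \<open>Finite types, terms and formulas\<close>

text \<open>
  The language of Kohlenbach's \<open>RCA\<^sub>0\<^sup>\<omega>\<close>: many-sorted classical predicate logic over all finite types,
  whose only primitive predicate is equality at type \<open>0\<close>.  Bound variables are de Bruijn indices;
  free variables are typed parameters \<open>Par x \<tau>\<close>.  Thus the bound-variable-closed formulas
  (\<open>wff [] \<phi>\<close>) play the role of formulas with free variables.
\<close>

datatype ty = N | Fn ty ty  (infixr \<open>\<rightarrow>\<^sub>t\<close> 60)

datatype cnst =
    Zero
  | Succ
  | Kc ty ty
  | Sc ty ty ty
  | Rec

primrec cty :: "cnst \<Rightarrow> ty" where
  "cty Zero = N"
| "cty Succ = N \<rightarrow>\<^sub>t N"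
| "cty (Kc \<rho> \<tau>) = \<rho> \<rightarrow>\<^sub>t \<tau> \<rightarrow>\<^sub>t \<rho>"
| "cty (Sc \<delta> \<rho> \<tau>) = (\<delta> \<rightarrow>\<^sub>t \<rho> \<rightarrow>\<^sub>t \<tau>) \<rightarrow>\<^sub>t (\<delta> \<rightarrow>\<^sub>t \<rho>) \<rightarrow>\<^sub>t \<delta> \<rightarrow>\<^sub>t \<tau>"
| "cty Rec = (N \<rightarrow>\<^sub>t N \<rightarrow>\<^sub>t N) \<rightarrow>\<^sub>t N \<rightarrow>\<^sub>t N \<rightarrow>\<^sub>t N"

datatype tm = Bnd nat | Par nat ty | Cn cnst | App tm tm

datatype fm = Eq tm tm | Fls | Imp fm fm | Forall ty fm

definition Neg :: "fm \<Rightarrow> fm" where "Neg \<phi> = Imp \<phi> Fls"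
definition Conj :: "fm \<Rightarrow> fm \<Rightarrow> fm" where "Conj \<phi> \<psi> = Neg (Imp \<phi> (Neg \<psi>))"
definition Disj :: "fm \<Rightarrow> fm \<Rightarrow> fm" where "Disj \<phi> \<psi> = Imp (Neg \<phi>) \<psi>"
definition Iff :: "fm \<Rightarrow> fm \<Rightarrow> fm" where "Iff \<phi> \<psi> = Conj (Imp \<phi> \<psi>) (Imp \<psi> \<phi>)"
definition Exists :: "ty \<Rightarrow> fm \<Rightarrow> fm" where "Exists \<tau> \<phi> = Neg (Forall \<tau> (Neg \<phi>))"

primrec has_type :: "ty list \<Rightarrow> tm \<Rightarrow> ty \<Rightarrow> bool" where
  "has_type \<Gamma> (Bnd i) \<tau> \<longleftrightarrow> i < length \<Gamma> \<and> \<Gamma> ! i = \<tau>"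
| "has_type \<Gamma> (Par x \<sigma>) \<tau> \<longleftrightarrow> \<sigma> = \<tau>"
| "has_type \<Gamma> (Cn c) \<tau> \<longleftrightarrow> cty c = \<tau>"
| "has_type \<Gamma> (App s t) \<tau> \<longleftrightarrow> (\<exists>\<sigma>. has_type \<Gamma> s (\<sigma> \<rightarrow>\<^sub>t \<tau>) \<and> has_type \<Gamma> t \<sigma>)"

primrec wff :: "ty list \<Rightarrow> fm \<Rightarrow> bool" where
  "wff \<Gamma> (Eq s t) \<longleftrightarrow> has_type \<Gamma> s N \<and> has_type \<Gamma> t N"
| "wff \<Gamma> Fls \<longleftrightarrow> True"
| "wff \<Gamma> (Imp \<phi> \<psi>) \<longleftrightarrow> wff \<Gamma> \<phi> \<and> wff \<Gamma> \<psi>"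
| "wff \<Gamma> (Forall \<tau> \<phi>) \<longleftrightarrow> wff (\<tau> # \<Gamma>) \<phi>"

primrec qf :: "fm \<Rightarrow> bool" where
  "qf (Eq s t) \<longleftrightarrow> True"
| "qf Fls \<longleftrightarrow> True"
| "qf (Imp \<phi> \<psi>) \<longleftrightarrow> qf \<phi> \<and> qf \<psi>"
| "qf (Forall \<tau> \<phi>) \<longleftrightarrow> False"

primrec tm_params :: "tm \<Rightarrow> (nat \<times> ty) set" where
  "tm_params (Bnd i) = {}"
| "tm_params (Par x \<tau>) = {(x, \<tau>)}"
| "tm_params (Cn c) = {}"
| "tm_params (App s t) = tm_params s \<union> tm_params t"

primrec params :: "fm \<Rightarrow> (nat \<times> ty) set" where
  "params (Eq s t) = tm_params s \<union> tm_params t"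
| "params Fls = {}"
| "params (Imp \<phi> \<psi>) = params \<phi> \<union> params \<psi>"
| "params (Forall \<tau> \<phi>) = params \<phi>"

text \<open>Simultaneous capture-avoiding substitution for the de Bruijn indices.\<close>

primrec tm_subst :: "(nat \<Rightarrow> tm) \<Rightarrow> tm \<Rightarrow> tm" where
  "tm_subst \<sigma> (Bnd i) = \<sigma> i"
| "tm_subst \<sigma> (Par x \<tau>) = Par x \<tau>"
| "tm_subst \<sigma> (Cn c) = Cn c"
| "tm_subst \<sigma> (App s t) = App (tm_subst \<sigma> s) (tm_subst \<sigma> t)"

definition up :: "(nat \<Rightarrow> tm) \<Rightarrow> nat \<Rightarrow> tm" where
  "up \<sigma> i = (case i of 0 \<Rightarrow> Bnd 0 | Suc j \<Rightarrow> tm_subst (\<lambda>k. Bnd (Suc k)) (\<sigma> j))"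

primrec subst :: "(nat \<Rightarrow> tm) \<Rightarrow> fm \<Rightarrow> fm" where
  "subst \<sigma> (Eq s t) = Eq (tm_subst \<sigma> s) (tm_subst \<sigma> t)"
| "subst \<sigma> Fls = Fls"
| "subst \<sigma> (Imp \<phi> \<psi>) = Imp (subst \<sigma> \<phi>) (subst \<sigma> \<psi>)"
| "subst \<sigma> (Forall \<tau> \<phi>) = Forall \<tau> (subst (up \<sigma>) \<phi>)"

definition inst :: "tm \<Rightarrow> fm \<Rightarrow> fm" where
  "inst t = subst (\<lambda>i. case i of 0 \<Rightarrow> t | Suc j \<Rightarrow> Bnd j)"


section \<open>Derivability\<close>

text \<open>
  Natural deduction for classical many-sorted logic with equality at type \<open>0\<close>.
  The theories below consist of parameter-free formulas, so the eigenvariable condition of \<open>AllI\<close>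
  only concerns the formulas added by \<open>ImpI\<close> and \<open>Contr\<close>.
\<close>

inductive deriv :: "fm set \<Rightarrow> fm \<Rightarrow> bool"  (infix \<open>\<turnstile>\<close> 45) where
  Assm: "\<phi> \<in> T \<Longrightarrow> wff [] \<phi> \<Longrightarrow> T \<turnstile> \<phi>"
| ImpI: "wff [] \<phi> \<Longrightarrow> insert \<phi> T \<turnstile> \<psi> \<Longrightarrow> T \<turnstile> Imp \<phi> \<psi>"
| ImpE: "T \<turnstile> Imp \<phi> \<psi> \<Longrightarrow> T \<turnstile> \<phi> \<Longrightarrow> T \<turnstile> \<psi>"
| Contr: "wff [] \<phi> \<Longrightarrow> insert (Neg \<phi>) T \<turnstile> Fls \<Longrightarrow> T \<turnstile> \<phi>"
| AllI: "(x, \<tau>) \<notin> params \<phi> \<Longrightarrow> (\<forall>\<psi>\<in>T. (x, \<tau>) \<notin> params \<psi>) \<Longrightarrow> T \<turnstile> inst (Par x \<tau>) \<phi>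
    \<Longrightarrow> T \<turnstile> Forall \<tau> \<phi>"
| AllE: "T \<turnstile> Forall \<tau> \<phi> \<Longrightarrow> has_type [] t \<tau> \<Longrightarrow> T \<turnstile> inst t \<phi>"
| EqRefl: "has_type [] t N \<Longrightarrow> T \<turnstile> Eq t t"
| EqSubst: "wff [N] \<phi> \<Longrightarrow> T \<turnstile> Eq s t \<Longrightarrow> T \<turnstile> inst s \<phi> \<Longrightarrow> T \<turnstile> inst t \<phi>"


section \<open>Notation for writing formulas with named bound variables\<close>

text \<open>
  A term or formula is represented as a function of the number \<open>d\<close> of enclosing quantifiers.
  A variable bound at depth \<open>d\<close> is the index \<open>d' - Suc d\<close> when used at depth \<open>d'\<close>, so object-level
  binders can be written with Isabelle's \<open>\<lambda>\<close> and all defined predicates are free of variable capture.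
  The sentence denoted by \<open>\<phi>\<close> is \<open>\<phi> 0\<close>.
\<close>

type_synonym tmb = "nat \<Rightarrow> tm"
type_synonym fmb = "nat \<Rightarrow> fm"

definition cn :: "cnst \<Rightarrow> tmb" where "cn c = (\<lambda>d. Cn c)"
definition ap :: "tmb \<Rightarrow> tmb \<Rightarrow> tmb"  (infixl \<open>\<cdot>\<close> 90) where
  "s \<cdot> t = (\<lambda>d. App (s d) (t d))"

definition eqb :: "tmb \<Rightarrow> tmb \<Rightarrow> fmb"  (infix \<open>\<doteq>\<close> 50) where
  "(s \<doteq> t) = (\<lambda>d. Eq (s d) (t d))"
definition negb :: "fmb \<Rightarrow> fmb"  (\<open>\<^bold>\<not> _\<close> [40] 40) where
  "(\<^bold>\<not> \<phi>) = (\<lambda>d. Neg (\<phi> d))"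
definition conjb :: "fmb \<Rightarrow> fmb \<Rightarrow> fmb"  (infixr \<open>\<^bold>\<and>\<close> 35) where
  "(\<phi> \<^bold>\<and> \<psi>) = (\<lambda>d. Conj (\<phi> d) (\<psi> d))"
definition disjb :: "fmb \<Rightarrow> fmb \<Rightarrow> fmb"  (infixr \<open>\<^bold>\<or>\<close> 30) where
  "(\<phi> \<^bold>\<or> \<psi>) = (\<lambda>d. Disj (\<phi> d) (\<psi> d))"
definition impb :: "fmb \<Rightarrow> fmb \<Rightarrow> fmb"  (infixr \<open>\<^bold>\<longrightarrow>\<close> 25) where
  "(\<phi> \<^bold>\<longrightarrow> \<psi>) = (\<lambda>d. Imp (\<phi> d) (\<psi> d))"
definition iffb :: "fmb \<Rightarrow> fmb \<Rightarrow> fmb"  (infixr \<open>\<^bold>\<longleftrightarrow>\<close> 25) where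
  "(\<phi> \<^bold>\<longleftrightarrow> \<psi>) = (\<lambda>d. Iff (\<phi> d) (\<psi> d))"
definition allb :: "ty \<Rightarrow> (tmb \<Rightarrow> fmb) \<Rightarrow> fmb" where
  "allb \<tau> F = (\<lambda>d. Forall \<tau> (F (\<lambda>d'. Bnd (d' - Suc d)) (Suc d)))"
definition exb :: "ty \<Rightarrow> (tmb \<Rightarrow> fmb) \<Rightarrow> fmb" where
  "exb \<tau> F = (\<lambda>d. Exists \<tau> (F (\<lambda>d'. Bnd (d' - Suc d)) (Suc d)))"

abbreviation "T1 \<equiv> N \<rightarrow>\<^sub>t N"
abbreviation "T2 \<equiv> T1 \<rightarrow>\<^sub>t N"

abbreviation all0 (binder \<open>\<^bold>\<forall>\<^sub>0\<close> 10) where "all0 F \<equiv> allb N F"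
abbreviation ex0 (binder \<open>\<^bold>\<exists>\<^sub>0\<close> 10) where "ex0 F \<equiv> exb N F"
abbreviation all1 (binder \<open>\<^bold>\<forall>\<^sub>1\<close> 10) where "all1 F \<equiv> allb T1 F"
abbreviation ex1 (binder \<open>\<^bold>\<exists>\<^sub>1\<close> 10) where "ex1 F \<equiv> exb T1 F"
abbreviation all2 (binder \<open>\<^bold>\<forall>\<^sub>2\<close> 10) where "all2 F \<equiv> allb T2 F"
abbreviation ex2 (binder \<open>\<^bold>\<exists>\<^sub>2\<close> 10) where "ex2 F \<equiv> exb T2 F"

primrec num :: "nat \<Rightarrow> tmb" where
  "num 0 = cn Zero"
| "num (Suc n) = cn Succ \<cdot> num n"

text \<open>Equality at higher types is extensional.\<close>

primrec heq :: "ty \<Rightarrow> tmb \<Rightarrow> tmb \<Rightarrow> fmb" where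
  "heq N s t = (s \<doteq> t)"
| "heq (\<rho> \<rightarrow>\<^sub>t \<tau>) s t = allb \<rho> (\<lambda>z. heq \<tau> (s \<cdot> z) (t \<cdot> z))"

text \<open>
  Arithmetic from the recursor, whose equations are \<open>Rec f m 0 = m\<close> and
  \<open>Rec f m (n + 1) = f n (Rec f m n)\<close>.  The combinator \<open>Kc T1 N\<close> turns a unary step function into
  one that ignores \<open>n\<close>, and \<open>Kc N N\<close> as a step function returns \<open>n\<close>.
\<close>

definition addf :: "tmb \<Rightarrow> tmb" where
  "addf s = cn Rec \<cdot> (cn (Kc T1 N) \<cdot> cn Succ) \<cdot> s"
definition mulf :: "tmb \<Rightarrow> tmb" where
  "mulf s = cn Rec \<cdot> (cn (Kc T1 N) \<cdot> addf s) \<cdot> num 0"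
definition predf :: tmb where
  "predf = cn Rec \<cdot> cn (Kc N N) \<cdot> num 0"
definition pow2 :: "tmb \<Rightarrow> tmb" where
  "pow2 t = cn Rec \<cdot> (cn (Kc T1 N) \<cdot> mulf (num 2)) \<cdot> num 1 \<cdot> t"
definition add :: "tmb \<Rightarrow> tmb \<Rightarrow> tmb"  (infixl \<open>\<^bold>+\<close> 65) where
  "s \<^bold>+ t = addf s \<cdot> t"
definition mul :: "tmb \<Rightarrow> tmb \<Rightarrow> tmb"  (infixl \<open>\<^bold>*\<close> 70) where
  "s \<^bold>* t = mulf s \<cdot> t"
definition monus :: "tmb \<Rightarrow> tmb \<Rightarrow> tmb" where
  "monus s t = cn Rec \<cdot> (cn (Kc T1 N) \<cdot> predf) \<cdot> s \<cdot> t"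
definition leb :: "tmb \<Rightarrow> tmb \<Rightarrow> fmb"  (infix \<open>\<^bold>\<le>\<close> 50) where
  "(s \<^bold>\<le> t) = (monus s t \<doteq> num 0)"
definition lessb :: "tmb \<Rightarrow> tmb \<Rightarrow> fmb"  (infix \<open>\<^bold><\<close> 50) where
  "(s \<^bold>< t) = (cn Succ \<cdot> s \<^bold>\<le> t)"


section \<open>The theories \<open>RCA\<^sub>0\<^sup>\<omega>\<close> and \<open>ACA\<^sub>0\<^sup>\<omega>\<close>\<close>

primrec univ_closure :: "ty list \<Rightarrow> fm \<Rightarrow> fm" where
  "univ_closure [] \<phi> = \<phi>"
| "univ_closure (\<tau> # \<Gamma>) \<phi> = univ_closure \<Gamma> (Forall \<tau> \<phi>)"

text \<open>
  \<open>RCA\<^sub>0\<^sup>\<omega>\<close> has type-\<open>0\<close> primitive recursion, full extensionality, quantifier-free induction and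
  \<open>QF-AC\<^sup>1\<^sup>,\<^sup>0\<close>.  In the two schemas, \<open>A\<close> may have further variables, of the types \<open>\<Gamma>\<close>.
  In \<open>QF_ind\<close>, index 0 of \<open>A\<close> is the induction variable.  In \<open>QF_AC\<close>, index 0 of \<open>A\<close> is \<open>n\<close> and
  index 1 is \<open>f\<close>; in the conclusion index 0 is \<open>f\<close> and index 1 is the choice functional.
\<close>

inductive_set RCA0w :: "fm set" where
  Succ_not_Zero: "(\<^bold>\<forall>\<^sub>0x. \<^bold>\<not> cn Succ \<cdot> x \<doteq> cn Zero) 0 \<in> RCA0w"
| Succ_inject: "(\<^bold>\<forall>\<^sub>0x. \<^bold>\<forall>\<^sub>0y. cn Succ \<cdot> x \<doteq> cn Succ \<cdot> y \<^bold>\<longrightarrow> x \<doteq> y) 0 \<in> RCA0w"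
| K: "(allb \<rho> (\<lambda>x. allb \<tau> (\<lambda>y. heq \<rho> (cn (Kc \<rho> \<tau>) \<cdot> x \<cdot> y) x))) 0 \<in> RCA0w"
| S: "(allb (\<delta> \<rightarrow>\<^sub>t \<rho> \<rightarrow>\<^sub>t \<tau>) (\<lambda>x. allb (\<delta> \<rightarrow>\<^sub>t \<rho>) (\<lambda>y. allb \<delta> (\<lambda>z.
        heq \<tau> (cn (Sc \<delta> \<rho> \<tau>) \<cdot> x \<cdot> y \<cdot> z) (x \<cdot> z \<cdot> (y \<cdot> z)))))) 0 \<in> RCA0w"
| Rec_Zero: "(allb (N \<rightarrow>\<^sub>t N \<rightarrow>\<^sub>t N) (\<lambda>f. \<^bold>\<forall>\<^sub>0m. cn Rec \<cdot> f \<cdot> m \<cdot> cn Zero \<doteq> m)) 0 \<in> RCA0w"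
| Rec_Succ: "(allb (N \<rightarrow>\<^sub>t N \<rightarrow>\<^sub>t N) (\<lambda>f. \<^bold>\<forall>\<^sub>0m. \<^bold>\<forall>\<^sub>0n.
        cn Rec \<cdot> f \<cdot> m \<cdot> (cn Succ \<cdot> n) \<doteq> f \<cdot> n \<cdot> (cn Rec \<cdot> f \<cdot> m \<cdot> n))) 0 \<in> RCA0w"
| Extensionality: "(allb (\<rho> \<rightarrow>\<^sub>t \<tau>) (\<lambda>z. allb \<rho> (\<lambda>x. allb \<rho> (\<lambda>y.
        heq \<rho> x y \<^bold>\<longrightarrow> heq \<tau> (z \<cdot> x) (z \<cdot> y))))) 0 \<in> RCA0w"
| QF_ind: "qf A \<Longrightarrow> params A = {} \<Longrightarrow> wff (N # \<Gamma>) A \<Longrightarrow>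
      univ_closure \<Gamma>
        (Imp (Conj (inst (Cn Zero) A)
                   (Forall N (Imp A (subst (\<lambda>i. if i = 0 then App (Cn Succ) (Bnd 0) else Bnd i) A))))
             (Forall N A)) \<in> RCA0w"
| QF_AC: "qf A \<Longrightarrow> params A = {} \<Longrightarrow> wff (N # T1 # \<Gamma>) A \<Longrightarrow>
      univ_closure \<Gamma>
        (Imp (Forall T1 (Exists N A))
             (Exists T2 (Forall T1
               (subst (\<lambda>i. if i = 0 then App (Bnd 1) (Bnd 0) else if i = 1 then Bnd 0 else Bnd i) A))))
        \<in> RCA0w"

definition exists2 :: fmb where
  "exists2 = (\<^bold>\<exists>\<^sub>2\<phi>. (\<^bold>\<forall>\<^sub>1f. \<phi> \<cdot> f \<^bold>\<le> num 1) \<^bold>\<and>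
                    (\<^bold>\<forall>\<^sub>1f. (\<^bold>\<exists>\<^sub>0n. f \<cdot> n \<doteq> num 0) \<^bold>\<longleftrightarrow> \<phi> \<cdot> f \<doteq> num 0))"

definition ACA0w :: "fm set" where
  "ACA0w = insert (exists2 0) RCA0w"


section \<open>Rational and real numbers\<close>

text \<open>
  Kohlenbach's coding of the rationals: with the Cantor pairing \<open>j(a,b) = ((a + b)\<^sup>2 + 3a + b) / 2\<close>,
  the number \<open>j(2p, d)\<close> codes \<open>p / (d + 1)\<close> and \<open>j(2k + 1, d)\<close> codes \<open>- (k + 1) / (d + 1)\<close>.  As
  \<open>j\<close> is a bijection, every natural number codes a rational.
  \<open>ratb q p m d\<close> says that \<open>q\<close> codes \<open>(p - m) / (d + 1)\<close> and that \<open>p\<close> or \<open>m\<close> is zero.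
\<close>

definition pairb :: "tmb \<Rightarrow> tmb \<Rightarrow> tmb \<Rightarrow> fmb" where
  "pairb q a b = (num 2 \<^bold>* q \<doteq> (a \<^bold>+ b) \<^bold>* (a \<^bold>+ b) \<^bold>+ (num 3 \<^bold>* a \<^bold>+ b))"

definition ratb :: "tmb \<Rightarrow> tmb \<Rightarrow> tmb \<Rightarrow> tmb \<Rightarrow> fmb" where
  "ratb q p m d = (m \<doteq> num 0 \<^bold>\<and> pairb q (num 2 \<^bold>* p) d \<^bold>\<or>
     p \<doteq> num 0 \<^bold>\<and> (\<^bold>\<exists>\<^sub>0k. m \<doteq> cn Succ \<cdot> k \<^bold>\<and> pairb q (cn Succ \<cdot> (num 2 \<^bold>* k)) d))"

text \<open>
  For rational codes \<open>q\<close>, \<open>r\<close>, the following two formulas say \<open>q < r + 2\<^sup>-\<^sup>n\<close> and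
  \<open>q \<le> r + 2\<^sup>-\<^sup>n\<^sup>+\<^sup>1\<close>, multiplied by \<open>2\<^sup>n\<close> and by both denominators.
\<close>

definition rat_less_err :: "tmb \<Rightarrow> tmb \<Rightarrow> tmb \<Rightarrow> fmb" where
  "rat_less_err q r n = (\<^bold>\<exists>\<^sub>0p. \<^bold>\<exists>\<^sub>0m. \<^bold>\<exists>\<^sub>0d. \<^bold>\<exists>\<^sub>0p'. \<^bold>\<exists>\<^sub>0m'. \<^bold>\<exists>\<^sub>0d'.
     ratb q p m d \<^bold>\<and> ratb r p' m' d' \<^bold>\<and>
     pow2 n \<^bold>* (p \<^bold>* (cn Succ \<cdot> d') \<^bold>+ m' \<^bold>* (cn Succ \<cdot> d)) \<^bold><
       pow2 n \<^bold>* (p' \<^bold>* (cn Succ \<cdot> d) \<^bold>+ m \<^bold>* (cn Succ \<cdot> d')) \<^bold>+ (cn Succ \<cdot> d) \<^bold>* (cn Succ \<cdot> d'))"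

definition rat_le_err :: "tmb \<Rightarrow> tmb \<Rightarrow> tmb \<Rightarrow> fmb" where
  "rat_le_err q r n = (\<^bold>\<exists>\<^sub>0p. \<^bold>\<exists>\<^sub>0m. \<^bold>\<exists>\<^sub>0d. \<^bold>\<exists>\<^sub>0p'. \<^bold>\<exists>\<^sub>0m'. \<^bold>\<exists>\<^sub>0d'.
     ratb q p m d \<^bold>\<and> ratb r p' m' d' \<^bold>\<and>
     pow2 n \<^bold>* (p \<^bold>* (cn Succ \<cdot> d') \<^bold>+ m' \<^bold>* (cn Succ \<cdot> d)) \<^bold>\<le>
       pow2 n \<^bold>* (p' \<^bold>* (cn Succ \<cdot> d) \<^bold>+ m \<^bold>* (cn Succ \<cdot> d'))
         \<^bold>+ num 2 \<^bold>* ((cn Succ \<cdot> d) \<^bold>* (cn Succ \<cdot> d')))"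

text \<open>
  A real is a sequence of rationals with \<open>\<bar>q\<^sub>n - q\<^sub>n\<^sub>+\<^sub>i\<bar> < 2\<^sup>-\<^sup>n\<close> for all \<open>n\<close>, \<open>i\<close>.  Reals \<open>x\<close>, \<open>y\<close> are equal
  if \<open>\<bar>x\<^sub>n - y\<^sub>n\<bar> \<le> 2\<^sup>-\<^sup>n\<^sup>+\<^sup>1\<close> for all \<open>n\<close>, and \<open>x \<le> y\<close> means \<open>x\<^sub>n \<le> y\<^sub>n + 2\<^sup>-\<^sup>n\<^sup>+\<^sup>1\<close> for all \<open>n\<close>.
\<close>

definition is_real :: "tmb \<Rightarrow> fmb" where
  "is_real x = (\<^bold>\<forall>\<^sub>0n. \<^bold>\<forall>\<^sub>0i. rat_less_err (x \<cdot> n) (x \<cdot> (n \<^bold>+ i)) n \<^bold>\<and>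
                             rat_less_err (x \<cdot> (n \<^bold>+ i)) (x \<cdot> n) n)"

definition real_eq :: "tmb \<Rightarrow> tmb \<Rightarrow> fmb" where
  "real_eq x y = (\<^bold>\<forall>\<^sub>0n. rat_le_err (x \<cdot> n) (y \<cdot> n) n \<^bold>\<and> rat_le_err (y \<cdot> n) (x \<cdot> n) n)"

definition real_le :: "tmb \<Rightarrow> tmb \<Rightarrow> fmb" where
  "real_le x y = (\<^bold>\<forall>\<^sub>0n. rat_le_err (x \<cdot> n) (y \<cdot> n) n)"

text \<open>The constant sequences with values the codes \<open>j(0,0) = 0\<close> and \<open>j(2,0) = 5\<close> of \<open>0\<close> and \<open>1\<close>.\<close>

definition real_zero :: tmb where "real_zero = cn (Kc N N) \<cdot> num 0"
definition real_one :: tmb where "real_one = cn (Kc N N) \<cdot> num 5"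


section \<open>Countable and enumerable sets\<close>

datatype space = Unit_Interval | Reals | Cantor

primrec pt :: "space \<Rightarrow> tmb \<Rightarrow> fmb" where
  "pt Unit_Interval x = (is_real x \<^bold>\<and> real_le real_zero x \<^bold>\<and> real_le x real_one)"
| "pt Reals x = is_real x"
| "pt Cantor x = (\<^bold>\<forall>\<^sub>0n. x \<cdot> n \<doteq> num 0 \<^bold>\<or> x \<cdot> n \<doteq> num 1)"

primrec pt_eq :: "space \<Rightarrow> tmb \<Rightarrow> tmb \<Rightarrow> fmb" where
  "pt_eq Unit_Interval x y = real_eq x y"
| "pt_eq Reals x y = real_eq x y"
| "pt_eq Cantor x y = heq T1 x y"

text \<open>
  A function from \<open>X\<close> to the natural numbers is a type-\<open>2\<close> object respecting the equality of \<open>X\<close>;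
  its values outside \<open>X\<close> are irrelevant.
\<close>

definition is_fun :: "space \<Rightarrow> tmb \<Rightarrow> fmb" where
  "is_fun X F = (\<^bold>\<forall>\<^sub>1x. \<^bold>\<forall>\<^sub>1y. pt X x \<^bold>\<and> pt X y \<^bold>\<and> pt_eq X x y \<^bold>\<longrightarrow> F \<cdot> x \<doteq> F \<cdot> y)"

definition is_subset :: "space \<Rightarrow> tmb \<Rightarrow> fmb" where
  "is_subset X A = (is_fun X A \<^bold>\<and> (\<^bold>\<forall>\<^sub>1x. pt X x \<^bold>\<longrightarrow> A \<cdot> x \<doteq> num 0 \<^bold>\<or> A \<cdot> x \<doteq> num 1))"

definition elem :: "space \<Rightarrow> tmb \<Rightarrow> tmb \<Rightarrow> fmb" where
  "elem X x A = (pt X x \<^bold>\<and> A \<cdot> x \<doteq> num 1)"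

definition inj_on_set :: "space \<Rightarrow> tmb \<Rightarrow> tmb \<Rightarrow> fmb" where
  "inj_on_set X Y A = (\<^bold>\<forall>\<^sub>1x. \<^bold>\<forall>\<^sub>1y. elem X x A \<^bold>\<and> elem X y A \<^bold>\<longrightarrow> Y \<cdot> x \<doteq> Y \<cdot> y \<^bold>\<longrightarrow> pt_eq X x y)"

definition surj_on_set :: "space \<Rightarrow> tmb \<Rightarrow> tmb \<Rightarrow> fmb" where
  "surj_on_set X Y A = (\<^bold>\<forall>\<^sub>0n. \<^bold>\<exists>\<^sub>1x. elem X x A \<^bold>\<and> Y \<cdot> x \<doteq> n)"

definition countableb :: "space \<Rightarrow> tmb \<Rightarrow> fmb" where
  "countableb X A = (\<^bold>\<exists>\<^sub>2Y. is_fun X Y \<^bold>\<and> inj_on_set X Y A)"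

definition strongly_countableb :: "space \<Rightarrow> tmb \<Rightarrow> fmb" where
  "strongly_countableb X A = (\<^bold>\<exists>\<^sub>2Y. is_fun X Y \<^bold>\<and> inj_on_set X Y A \<^bold>\<and> surj_on_set X Y A)"

definition nonemptyb :: "space \<Rightarrow> tmb \<Rightarrow> fmb" where
  "nonemptyb X A = (\<^bold>\<exists>\<^sub>1x. elem X x A)"

definition enumerableb :: "space \<Rightarrow> tmb \<Rightarrow> fmb" where
  "enumerableb X A = exb (N \<rightarrow>\<^sub>t T1) (\<lambda>s. (\<^bold>\<forall>\<^sub>0n. pt X (s \<cdot> n)) \<^bold>\<and>
     (\<^bold>\<forall>\<^sub>1x. pt X x \<^bold>\<longrightarrow> (elem X x A \<^bold>\<longleftrightarrow> (\<^bold>\<exists>\<^sub>0n. pt_eq X x (s \<cdot> n)))))"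

text \<open>
  The empty set is countable but is not listed by any infinite sequence, so without the
  nonemptiness condition \<open>cocode0 X\<close> would be refutable.  Strongly countable sets are nonempty.
\<close>

definition cocode0 :: "space \<Rightarrow> fmb" where
  "cocode0 X = (\<^bold>\<forall>\<^sub>2A. is_subset X A \<^bold>\<and> nonemptyb X A \<^bold>\<and> countableb X A \<^bold>\<longrightarrow> enumerableb X A)"

definition cocode1 :: "space \<Rightarrow> fmb" where
  "cocode1 X = (\<^bold>\<forall>\<^sub>2A. is_subset X A \<^bold>\<and> strongly_countableb X A \<^bold>\<longrightarrow> enumerableb X A)"

definition cocode :: "nat \<Rightarrow> space \<Rightarrow> fmb" where
  "cocode i X = (if i = 0 then cocode0 X else cocode1 X)"

end

theory Submission
  imports Defs "HOL-Library.Countable" "HOL-Computational_Algebra.Fraction_Field"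
begin

text \<open>
  By Henkin's completeness theorem it suffices to verify the equivalences in an arbitrary model of
  \<open>ACA0w\<close>, which may be taken to be the extensional collapse of a term model.  In it \<open>QF-AC\<close> makes
  equality of numbers decidable by a functional and \<open>(\<exists>\<^sup>2)\<close> eliminates number quantifiers, so
  arithmetical comprehension and induction hold, with parameters of all types.

  If \<open>X\<close> is an arithmetically definable retract of \<open>Z\<close>, through \<open>h: X \<rightarrow> Z\<close> and \<open>g: Z \<rightarrow> X\<close> with
  \<open>g (h x) = x\<close>, then \<open>cocode Z\<close> implies \<open>cocode X\<close>: a countable \<open>A \<subseteq> X\<close> is replaced by the set of all
  \<open>z\<close> with \<open>g z \<in> A\<close> and \<open>h (g z) = z\<close>, and an enumeration of that set is mapped back by \<open>g\<close>.
  The unit interval is a retract of the reals through the identity, the reals are one of Cantor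
  space through left Dedekind cuts, and Cantor space is one of the unit interval by reading
  a sequence of bits as digits in base 4.
\<close>

section \<open>Substitution and renaming of parameters\<close>

text \<open>Membership of \<open>z\<close> in the image of a set under an injection into
  \<open>Z\<close> is an existential statement about points, while
  \<open>(\<exists>\<^sup>2)\<close> removes only number quantifiers. A map \<open>g\<close> in the
  opposite direction names the only possible preimage and makes the image arithmetical in
  \<open>g\<close>, \<open>h\<close> and \<open>A\<close>; for this reason spaces are compared by
  retracts and not merely by injections. The maps must also ignore how a real is presented. Lying
  above a given rational is invariant under equality of reals, so the left cut is canonical and
  equal reals yield one and the same bit sequence. Binary digits are not canonical in this sense;
  base 4 with the digits 0 and 1 leaves gaps for thresholds, and the digits are recovered by
  comparing the real with rationals. The numbers of the model may be nonstandard. Only arithmetical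
  induction is available for them, so each inductive fact comes with an object formula expressing
  it. Ordered algebra is gained by turning these numbers into a type, and passing to its ring of
  differences and its field of fractions.\<close>

lemma tm_subst_cong:
  "has_type \<Gamma> t \<tau> \<Longrightarrow> (\<And>i. i < length \<Gamma> \<Longrightarrow> \<sigma> i = \<rho> i) \<Longrightarrow> tm_subst \<sigma> t = tm_subst \<rho> t"
  by (induction t arbitrary: \<tau>) auto

lemma tm_subst_Bnd [simp]: "tm_subst Bnd t = t"
  by (induction t) auto

lemma tm_subst_comp: "tm_subst \<sigma> (tm_subst \<rho> t) = tm_subst (\<lambda>i. tm_subst \<sigma> (\<rho> i)) t"
  by (induction t) auto

lemma up_simps [simp]: "up \<sigma> 0 = Bnd 0" "up \<sigma> (Suc j) = tm_subst (\<lambda>k. Bnd (Suc k)) (\<sigma> j)"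
  by (auto simp: up_def)

lemma up_comp: "(\<lambda>i. tm_subst (up \<sigma>) (up \<rho> i)) = up (\<lambda>i. tm_subst \<sigma> (\<rho> i))"
proof
  fix i show "tm_subst (up \<sigma>) (up \<rho> i) = up (\<lambda>i. tm_subst \<sigma> (\<rho> i)) i"
    by (cases i) (auto simp: tm_subst_comp)
qed

lemma subst_comp: "subst \<sigma> (subst \<rho> \<phi>) = subst (\<lambda>i. tm_subst \<sigma> (\<rho> i)) \<phi>"
  by (induction \<phi> arbitrary: \<sigma> \<rho>) (auto simp: tm_subst_comp up_comp)

lemma up_Bnd [simp]: "up Bnd = Bnd"
proof
  fix i show "up Bnd i = Bnd i" by (cases i) auto
qed

lemma subst_Bnd [simp]: "subst Bnd \<phi> = \<phi>"
  by (induction \<phi>) auto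

lemma inst_subst_up: "inst t (subst (up \<sigma>) \<phi>) = subst (case_nat t \<sigma>) \<phi>"
proof -
  have "(\<lambda>i. tm_subst (case_nat t Bnd) (up \<sigma> i)) = case_nat t \<sigma>"
  proof
    fix i show "tm_subst (case_nat t Bnd) (up \<sigma> i) = case_nat t \<sigma> i"
      by (cases i) (auto simp: tm_subst_comp)
  qed
  then show ?thesis
    by (simp add: inst_def subst_comp)
qed

lemma has_type_subst:
  "has_type \<Gamma> t \<tau> \<Longrightarrow> (\<And>i. i < length \<Gamma> \<Longrightarrow> has_type \<Delta> (\<sigma> i) (\<Gamma> ! i)) \<Longrightarrow> has_type \<Delta> (tm_subst \<sigma> t) \<tau>"
  by (induction t arbitrary: \<tau>) fastforce+

lemma has_type_closed: "has_type [] t \<tau> \<Longrightarrow> has_type \<Gamma> t \<tau>"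
  using has_type_subst[of "[]" t \<tau> \<Gamma> Bnd] by simp

lemma has_type_up:
  assumes "\<And>i. i < length \<Gamma> \<Longrightarrow> has_type \<Delta> (\<sigma> i) (\<Gamma> ! i)" and "i < length (\<tau> # \<Gamma>)"
  shows "has_type (\<tau> # \<Delta>) (up \<sigma> i) ((\<tau> # \<Gamma>) ! i)"
  using assms by (cases i) (auto intro!: has_type_subst[where \<Gamma> = \<Delta>])

lemma wff_subst:
  "wff \<Gamma> \<phi> \<Longrightarrow> (\<And>i. i < length \<Gamma> \<Longrightarrow> has_type \<Delta> (\<sigma> i) (\<Gamma> ! i)) \<Longrightarrow> wff \<Delta> (subst \<sigma> \<phi>)"
proof (induction \<phi> arbitrary: \<Gamma> \<Delta> \<sigma>)
  case (Forall \<tau> \<phi>)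
  have "wff (\<tau> # \<Delta>) (subst (up \<sigma>) \<phi>)"
    using Forall.prems by (intro Forall.IH[of "\<tau> # \<Gamma>"] has_type_up) auto
  then show ?case by simp
qed (auto intro: has_type_subst)

lemma wff_inst: "wff [\<tau>] \<phi> \<Longrightarrow> has_type [] t \<tau> \<Longrightarrow> wff [] (inst t \<phi>)"
  unfolding inst_def by (rule wff_subst) auto

lemma has_type_unique: "has_type \<Gamma> t \<tau> \<Longrightarrow> has_type \<Gamma> t \<tau>' \<Longrightarrow> \<tau> = \<tau>'"
proof (induction t arbitrary: \<tau> \<tau>')
  case (App t1 t2)
  then show ?case by (metis has_type.simps(4) ty.inject)
qed auto

section \<open>Renaming of parameters\<close>

primrec tm_ren :: "(nat \<times> ty \<Rightarrow> nat) \<Rightarrow> tm \<Rightarrow> tm" where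
  "tm_ren r (Bnd i) = Bnd i"
| "tm_ren r (Par x \<tau>) = Par (r (x, \<tau>)) \<tau>"
| "tm_ren r (Cn c) = Cn c"
| "tm_ren r (App s t) = App (tm_ren r s) (tm_ren r t)"

primrec ren :: "(nat \<times> ty \<Rightarrow> nat) \<Rightarrow> fm \<Rightarrow> fm" where
  "ren r (Eq s t) = Eq (tm_ren r s) (tm_ren r t)"
| "ren r Fls = Fls"
| "ren r (Imp \<phi> \<psi>) = Imp (ren r \<phi>) (ren r \<psi>)"
| "ren r (Forall \<tau> \<phi>) = Forall \<tau> (ren r \<phi>)"

lemma ren_Neg [simp]: "ren r (Neg \<phi>) = Neg (ren r \<phi>)"
  by (simp add: Neg_def)

lemma tm_ren_subst: "tm_ren r (tm_subst \<sigma> t) = tm_subst (\<lambda>i. tm_ren r (\<sigma> i)) (tm_ren r t)"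
  by (induction t) auto

lemma ren_subst: "ren r (subst \<sigma> \<phi>) = subst (\<lambda>i. tm_ren r (\<sigma> i)) (ren r \<phi>)"
proof (induction \<phi> arbitrary: \<sigma>)
  case (Forall \<tau> \<phi>)
  have "(\<lambda>i. tm_ren r (up \<sigma> i)) = up (\<lambda>i. tm_ren r (\<sigma> i))"
  proof
    fix i show "tm_ren r (up \<sigma> i) = up (\<lambda>i. tm_ren r (\<sigma> i)) i"
      by (cases i) (auto simp: tm_ren_subst)
  qed
  then show ?case using Forall by simp
qed (auto simp: tm_ren_subst)

lemma ren_inst: "ren r (inst t \<phi>) = inst (tm_ren r t) (ren r \<phi>)"
proof -
  have "(\<lambda>i. tm_ren r (case_nat t Bnd i)) = case_nat (tm_ren r t) Bnd"
  proof
    fix i show "tm_ren r (case_nat t Bnd i) = case_nat (tm_ren r t) Bnd i" by (cases i) auto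
  qed
  then show ?thesis by (simp add: inst_def ren_subst)
qed

lemma has_type_ren: "has_type \<Gamma> t \<tau> \<Longrightarrow> has_type \<Gamma> (tm_ren r t) \<tau>"
  by (induction t arbitrary: \<tau>) auto

lemma wff_ren: "wff \<Gamma> \<phi> \<Longrightarrow> wff \<Gamma> (ren r \<phi>)"
  by (induction \<phi> arbitrary: \<Gamma>) (auto intro: has_type_ren)

lemma tm_ren_cong: "(\<And>p. p \<in> tm_params t \<Longrightarrow> r p = r' p) \<Longrightarrow> tm_ren r t = tm_ren r' t"
  by (induction t) auto

lemma ren_cong: "(\<And>p. p \<in> params \<phi> \<Longrightarrow> r p = r' p) \<Longrightarrow> ren r \<phi> = ren r' \<phi>"
  by (induction \<phi>) (auto intro: tm_ren_cong)

text \<open>A parameter is a name together with its type, and a renaming supplies new names only;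
  hence \<open>fst\<close> is the identity renaming.\<close>

lemma tm_ren_fst [simp]: "tm_ren fst t = t"
  by (induction t) auto

lemma ren_fst [simp]: "ren fst \<phi> = \<phi>"
  by (induction \<phi>) auto

lemma finite_tm_params [simp]: "finite (tm_params t)"
  by (induction t) auto

lemma finite_params [simp]: "finite (params \<phi>)"
  by (induction \<phi>) auto

lemma fresh_param:
  assumes "finite (A :: (nat \<times> ty) set)"
  obtains x where "(x, \<tau>) \<notin> A"
proof -
  have "finite (fst ` A)" using assms by simp
  then obtain x where "x \<notin> fst ` A" using ex_new_if_finite infinite_UNIV_nat by metis
  then show thesis using that by force
qed


section \<open>Completeness\<close>

definition sparams :: "fm set \<Rightarrow> (nat \<times> ty) set" where
  "sparams T = \<Union>(params ` T)"

lemma sparams_insert [simp]: "sparams (insert \<phi> T) = params \<phi> \<union> sparams T"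
  by (auto simp: sparams_def)

text \<open>
  The renaming absorbs the change of eigenvariables in \<open>AllI\<close> that weakening makes necessary.
\<close>

lemma deriv_rename:
  "T \<turnstile> \<phi> \<Longrightarrow> finite (sparams T) \<Longrightarrow> finite (sparams S) \<Longrightarrow> ren r ` T \<subseteq> S \<Longrightarrow> S \<turnstile> ren r \<phi>"
proof (induction arbitrary: r S rule: deriv.induct)
  case (Assm \<phi> T)
  then show ?case by (auto intro!: deriv.Assm wff_ren)
next
  case (ImpI \<phi> T \<psi>)
  have "insert (ren r \<phi>) S \<turnstile> ren r \<psi>"
    using ImpI.prems by (intro ImpI.IH) auto
  then show ?case using ImpI.hyps by (auto intro!: deriv.ImpI wff_ren)
next
  case (ImpE T \<phi> \<psi>)
  have "S \<turnstile> ren r (Imp \<phi> \<psi>)" "S \<turnstile> ren r \<phi>"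
    using ImpE.prems by (auto intro!: ImpE.IH simp del: ren.simps)
  then show ?case by (auto intro: deriv.ImpE)
next
  case (Contr \<phi> T)
  have "insert (ren r (Neg \<phi>)) S \<turnstile> ren r Fls"
    using Contr.prems by (intro Contr.IH) (auto simp: Neg_def)
  then show ?case using Contr.hyps by (auto intro!: deriv.Contr wff_ren)
next
  case (AllI x \<tau> \<phi> T)
  have "finite (params (ren r \<phi>) \<union> sparams S)" using AllI.prems by simp
  then obtain y where y: "(y, \<tau>) \<notin> params (ren r \<phi>) \<union> sparams S"
    using fresh_param by metis
  \<comment> \<open>\<open>?r\<close> sends the eigenvariable to a name fresh for \<open>S\<close>
    and agrees with \<open>r\<close> elsewhere. As the eigenvariable occurs neither in
    \<open>T\<close> nor in \<open>\<phi>\<close>, the change is invisible there, while the premise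
    becomes one whose eigenvariable is legal over \<open>S\<close>.\<close>
  let ?r = "r((x, \<tau>) := y)"
  have \<phi>: "ren ?r \<phi> = ren r \<phi>" using AllI.hyps by (intro ren_cong) auto
  have "ren ?r \<psi> = ren r \<psi>" if "\<psi> \<in> T" for \<psi>
    using AllI.hyps that by (intro ren_cong) auto
  then have T: "ren ?r ` T = ren r ` T" by (intro image_cong) auto
  have "S \<turnstile> ren ?r (inst (Par x \<tau>) \<phi>)"
    using AllI.prems by (intro AllI.IH) (simp_all only: T)
  then have "S \<turnstile> inst (Par y \<tau>) (ren r \<phi>)" by (simp add: ren_inst \<phi>)
  then have "S \<turnstile> Forall \<tau> (ren r \<phi>)"
    using y by (intro deriv.AllI[of y]) (auto simp: sparams_def)
  then show ?case by simp
next
  case (AllE T \<tau> \<phi> t)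
  have "S \<turnstile> ren r (Forall \<tau> \<phi>)" using AllE.prems by (intro AllE.IH)
  then show ?case using AllE.hyps
    by (auto simp: ren_inst intro!: deriv.AllE has_type_ren)
next
  case (EqRefl t T)
  then show ?case by (auto intro!: deriv.EqRefl has_type_ren)
next
  case (EqSubst \<phi> T s t)
  have "S \<turnstile> ren r (Eq s t)" "S \<turnstile> ren r (inst s \<phi>)"
    using EqSubst.prems EqSubst.IH by blast+
  then show ?case using EqSubst.hyps
    by (auto simp: ren_inst intro: deriv.EqSubst wff_ren)
qed

lemma deriv_weaken:
  "T \<turnstile> \<phi> \<Longrightarrow> T \<subseteq> S \<Longrightarrow> finite (sparams S) \<Longrightarrow> S \<turnstile> \<phi>"
  using deriv_rename[of T \<phi> S fst]
  by (auto simp: sparams_def intro: finite_subset[of "\<Union>(params ` T)" "\<Union>(params ` S)"])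

text \<open>The clauses are those that the true sentences of a term model satisfy. The universal
  clause speaks of instances by closed terms, which include the parameters; its direction from right
  to left is what witnesses are added for.\<close>

definition henkin :: "fm set \<Rightarrow> bool" where
  "henkin X \<longleftrightarrow> Fls \<notin> X \<and>
     (\<forall>\<phi> \<psi>. wff [] \<phi> \<longrightarrow> wff [] \<psi> \<longrightarrow> (Imp \<phi> \<psi> \<in> X \<longleftrightarrow> (\<phi> \<in> X \<longrightarrow> \<psi> \<in> X))) \<and>
     (\<forall>\<tau> \<phi>. wff [\<tau>] \<phi> \<longrightarrow> (Forall \<tau> \<phi> \<in> X \<longleftrightarrow> (\<forall>t. has_type [] t \<tau> \<longrightarrow> inst t \<phi> \<in> X))) \<and>
     (\<forall>t. has_type [] t N \<longrightarrow> Eq t t \<in> X) \<and>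
     (\<forall>\<phi> s t. wff [N] \<phi> \<longrightarrow> Eq s t \<in> X \<longrightarrow> inst s \<phi> \<in> X \<longrightarrow> inst t \<phi> \<in> X)"

instance ty :: countable by countable_datatype
instance cnst :: countable by countable_datatype
instance tm :: countable by countable_datatype
instance fm :: countable by countable_datatype

lemma wff_Neg [simp]: "wff \<Gamma> (Neg \<phi>) \<longleftrightarrow> wff \<Gamma> \<phi>"
  by (simp add: Neg_def)

text \<open>One stage of Lindenbaum's construction with Henkin witnesses. Naming a counterexample to
  a refuted universal formula by a fresh parameter keeps consistency, for otherwise
  \<open>Contr\<close> and \<open>AllI\<close> would prove the universal formula. At most two
  formulas are added, so only finitely many parameters occur and a fresh one remains for the next
  stage.\<close>

lemma henkin_step:
  assumes fin: "finite (sparams \<Gamma>)" and con: "\<not> \<Gamma> \<turnstile> Fls"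
  obtains \<Delta> where "\<Gamma> \<subseteq> \<Delta>" "finite (sparams \<Delta>)" "\<not> \<Delta> \<turnstile> Fls"
    "wff [] \<phi> \<Longrightarrow> \<phi> \<in> \<Delta> \<or> insert \<phi> \<Gamma> \<turnstile> Fls"
    "\<And>\<tau> \<psi>. \<phi> = Neg (Forall \<tau> \<psi>) \<Longrightarrow> wff [] \<phi> \<Longrightarrow>
       insert \<phi> \<Gamma> \<turnstile> Fls \<or> (\<exists>x. Neg (inst (Par x \<tau>) \<psi>) \<in> \<Delta>)"
proof (cases "wff [] \<phi> \<and> \<not> insert \<phi> \<Gamma> \<turnstile> Fls")
  case True
  show thesis
  proof (cases "\<exists>\<tau> \<psi>. \<phi> = Neg (Forall \<tau> \<psi>)")
    case ex: True
    then obtain \<tau> \<psi> where \<phi>: "\<phi> = Neg (Forall \<tau> \<psi>)" by blast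
    have "finite (sparams (insert \<phi> \<Gamma>))" using fin by simp
    then obtain x where x: "(x, \<tau>) \<notin> sparams (insert \<phi> \<Gamma>)" using fresh_param by metis
    let ?\<chi> = "Neg (inst (Par x \<tau>) \<psi>)"
    let ?\<Delta> = "insert ?\<chi> (insert \<phi> \<Gamma>)"
    have w: "wff [\<tau>] \<psi>" using True \<phi> by (simp add: Neg_def)
    have "\<not> ?\<Delta> \<turnstile> Fls"
    proof
      assume "?\<Delta> \<turnstile> Fls"
      then have "insert \<phi> \<Gamma> \<turnstile> inst (Par x \<tau>) \<psi>"
        using w by (intro deriv.Contr[OF wff_inst]) auto
      then have "insert \<phi> \<Gamma> \<turnstile> Forall \<tau> \<psi>"
        using x \<phi> by (intro deriv.AllI[of x]) (auto simp: sparams_def Neg_def)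
      moreover have "insert \<phi> \<Gamma> \<turnstile> Imp (Forall \<tau> \<psi>) Fls"
        using True \<phi> by (intro deriv.Assm) (auto simp: Neg_def)
      ultimately have "insert \<phi> \<Gamma> \<turnstile> Fls" by (blast intro: deriv.ImpE)
      then show False using True by blast
    qed
    moreover have "\<exists>x. Neg (inst (Par x \<tau>') \<psi>') \<in> ?\<Delta>" if "\<phi> = Neg (Forall \<tau>' \<psi>')" for \<tau>' \<psi>'
      using that \<phi> by (auto simp: Neg_def)
    ultimately show thesis using fin by (intro that[of ?\<Delta>]) auto
  next
    case False
    then show thesis using True fin by (intro that[of "insert \<phi> \<Gamma>"]) auto
  qed
next
  case False
  then show thesis using fin con by (intro that[of \<Gamma>]) auto
qed

theorem henkin_completeness:
  assumes w: "wff [] \<phi>" and fin: "finite (sparams T)" and nd: "\<not> T \<turnstile> \<phi>"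
  obtains X where "henkin X" "\<And>\<psi>. \<psi> \<in> T \<Longrightarrow> wff [] \<psi> \<Longrightarrow> \<psi> \<in> X" "\<phi> \<notin> X"
proof -
  define good where "good S \<longleftrightarrow> finite (sparams S) \<and> \<not> S \<turnstile> Fls" for S
  define next_ok where "next_ok n S S' \<longleftrightarrow> S \<subseteq> S' \<and>
     (wff [] (from_nat n) \<longrightarrow> from_nat n \<in> S' \<or> insert (from_nat n) S \<turnstile> Fls) \<and>
     (\<forall>\<tau> \<psi>. from_nat n = Neg (Forall \<tau> \<psi>) \<longrightarrow> wff [] (Forall \<tau> \<psi>) \<longrightarrow>
       insert (from_nat n) S \<turnstile> Fls \<or> (\<exists>x. Neg (inst (Par x \<tau>) \<psi>) \<in> S'))" for n S S'
  have "\<exists>S'. good S' \<and> next_ok n S S'" if "good S" for n S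
    using that henkin_step[of S "from_nat n"] unfolding good_def next_ok_def
    by (metis wff_Neg)
  moreover have g0: "good (insert (Neg \<phi>) T)"
    using fin nd w deriv.Contr by (auto simp: good_def)
  ultimately have "\<exists>S. \<forall>n. (good (S n) \<and> (n = 0 \<longrightarrow> S n = insert (Neg \<phi>) T)) \<and> next_ok n (S n) (S (Suc n))"
    by (intro dependent_nat_choice) auto
  then obtain S where S0: "S 0 = insert (Neg \<phi>) T" and S: "\<And>n. good (S n)"
    and Sn: "\<And>n. next_ok n (S n) (S (Suc n))"
    by blast
  have mono: "S m \<subseteq> S n" if "m \<le> n" for m n
    using lift_Suc_mono_le[of S] Sn that by (auto simp: next_ok_def)
  have weak: "S n \<turnstile> \<psi>" if "S m \<turnstile> \<psi>" "m \<le> n" for m n \<psi>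
    using deriv_weaken[OF that(1) mono[OF that(2)]] S by (auto simp: good_def)
  have weaki: "insert \<chi> (S n) \<turnstile> \<psi>" if "S n \<turnstile> \<psi>" for n \<chi> \<psi>
    using deriv_weaken[OF that, of "insert \<chi> (S n)"] S by (auto simp: good_def)
  \<comment> \<open>Derivability at some stage is used in place of the union of the stages: closure
    under the rules is then immediate once derivations are brought to a common stage.\<close>
  define X where "X = {\<psi>. \<exists>n. S n \<turnstile> \<psi>}"
  have Fls: "Fls \<notin> X" using S by (auto simp: X_def good_def)
  have mp: "\<psi> \<in> X" if "Imp \<chi> \<psi> \<in> X" "\<chi> \<in> X" for \<chi> \<psi>
  proof -
    obtain m n where "S m \<turnstile> Imp \<chi> \<psi>" "S n \<turnstile> \<chi>" using \<open>Imp \<chi> \<psi> \<in> X\<close> \<open>\<chi> \<in> X\<close> by (auto simp: X_def)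
    then have "S (max m n) \<turnstile> Imp \<chi> \<psi>" "S (max m n) \<turnstile> \<chi>" by (auto elim: weak)
    then show ?thesis by (auto simp: X_def intro: deriv.ImpE)
  qed
  have neg: "\<psi> \<in> X \<or> Neg \<psi> \<in> X" if wp: "wff [] \<psi>" for \<psi>
  proof -
    have "\<psi> \<in> S (Suc (to_nat \<psi>)) \<or> insert \<psi> (S (to_nat \<psi>)) \<turnstile> Fls"
      using Sn[of "to_nat \<psi>"] wp by (auto simp: next_ok_def)
    then show ?thesis using wp unfolding X_def Neg_def
      by (blast intro: deriv.Assm deriv.ImpI)
  qed
  have imp: "Imp \<chi> \<psi> \<in> X" if "\<chi> \<in> X \<longrightarrow> \<psi> \<in> X" "wff [] \<chi>" "wff [] \<psi>" for \<chi> \<psi>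
  proof (cases "\<psi> \<in> X")
    case True
    then show ?thesis using that weaki unfolding X_def by (blast intro: deriv.ImpI)
  next
    case False
    then have "Neg \<chi> \<in> X" using that neg by blast
    then obtain n where n: "S n \<turnstile> Neg \<chi>" by (auto simp: X_def)
    have fin2: "finite (sparams (insert (Neg \<psi>) (insert \<chi> (S n))))"
      using S by (auto simp: good_def)
    have "insert (Neg \<psi>) (insert \<chi> (S n)) \<turnstile> Imp \<chi> Fls"
      using deriv_weaken[OF n _ fin2] by (auto simp: Neg_def)
    moreover have "insert (Neg \<psi>) (insert \<chi> (S n)) \<turnstile> \<chi>"
      using that by (auto intro: deriv.Assm)
    ultimately have "insert \<chi> (S n) \<turnstile> \<psi>"
      using that by (auto intro: deriv.Contr deriv.ImpE)
    then show ?thesis using that unfolding X_def by (blast intro: deriv.ImpI)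
  qed
  have all: "Forall \<tau> \<psi> \<in> X" if wp: "wff [\<tau>] \<psi>" and ha: "\<forall>t. has_type [] t \<tau> \<longrightarrow> inst t \<psi> \<in> X" for \<tau> \<psi>
  proof (rule ccontr)
    let ?n = "to_nat (Neg (Forall \<tau> \<psi>))"
    assume na: "Forall \<tau> \<psi> \<notin> X"
    then have "Neg (Forall \<tau> \<psi>) \<in> X" using neg[of "Forall \<tau> \<psi>"] wp by auto
    then obtain m where m: "S m \<turnstile> Neg (Forall \<tau> \<psi>)" by (auto simp: X_def)
    \<comment> \<open>At its own stage the negated universal formula was consistent, since otherwise
      the universal formula would have been derivable there; therefore a counterexample was
      added.\<close>
    have "\<not> insert (Neg (Forall \<tau> \<psi>)) (S ?n) \<turnstile> Fls"
    proof
      assume "insert (Neg (Forall \<tau> \<psi>)) (S ?n) \<turnstile> Fls"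
      then have "S ?n \<turnstile> Forall \<tau> \<psi>" using wp by (auto intro: deriv.Contr[of "Forall \<tau> \<psi>"])
      then show False using na by (auto simp: X_def)
    qed
    then obtain x where "Neg (inst (Par x \<tau>) \<psi>) \<in> S (Suc ?n)"
      using Sn[of ?n] wp unfolding next_ok_def from_nat_to_nat wff.simps by blast
    then have "S (Suc ?n) \<turnstile> Neg (inst (Par x \<tau>) \<psi>)"
      using wp by (intro deriv.Assm) (auto intro: wff_inst)
    then have "Imp (inst (Par x \<tau>) \<psi>) Fls \<in> X" by (auto simp: X_def Neg_def)
    moreover have "inst (Par x \<tau>) \<psi> \<in> X" using ha by simp
    ultimately show False using mp Fls by blast
  qed
  have alle: "inst t \<psi> \<in> X" if "Forall \<tau> \<psi> \<in> X" "has_type [] t \<tau>" for \<tau> \<psi> t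
    using that by (auto simp: X_def intro: deriv.AllE)
  have eqs: "inst t \<psi> \<in> X" if wp: "wff [N] \<psi>" and e: "Eq s t \<in> X" "inst s \<psi> \<in> X" for \<psi> s t
  proof -
    obtain m n where "S m \<turnstile> Eq s t" "S n \<turnstile> inst s \<psi>" using e by (auto simp: X_def)
    then have "S (max m n) \<turnstile> Eq s t" "S (max m n) \<turnstile> inst s \<psi>" by (auto elim: weak)
    then show ?thesis using wp by (auto simp: X_def intro: deriv.EqSubst)
  qed
  have refl: "Eq t t \<in> X" if "has_type [] t N" for t
    using that by (auto simp: X_def intro: deriv.EqRefl)
  have "henkin X"
    unfolding henkin_def using Fls mp imp all alle eqs refl by blast
  moreover have "\<psi> \<in> X" if "\<psi> \<in> T" "wff [] \<psi>" for \<psi>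
    using that S0 by (auto simp: X_def intro: deriv.Assm intro!: exI[of _ 0])
  moreover have "\<phi> \<notin> X"
  proof
    assume "\<phi> \<in> X"
    moreover have "Imp \<phi> Fls \<in> X"
      using S0 w by (auto simp: X_def Neg_def intro!: exI[of _ 0] intro: deriv.Assm)
    ultimately show False using mp Fls by blast
  qed
  ultimately show thesis by (rule that)
qed

section \<open>The axioms are free of parameters\<close>

lemmas fmb_defs = cn_def ap_def eqb_def negb_def conjb_def disjb_def impb_def iffb_def
  allb_def exb_def
lemmas fm_defs = Neg_def Conj_def Disj_def Iff_def Exists_def
lemmas arith_defs = addf_def mulf_def predf_def pow2_def add_def mul_def monus_def leb_def lessb_def

lemma params_heq:
  "(\<And>d. tm_params (s d) = {}) \<Longrightarrow> (\<And>d. tm_params (t d) = {}) \<Longrightarrow> params (heq \<tau> s t d) = {}"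
  by (induction \<tau> arbitrary: s t d) (auto simp: fmb_defs)

lemma tm_params_subst: "tm_params t = {} \<Longrightarrow> (\<And>i. tm_params (\<sigma> i) = {}) \<Longrightarrow> tm_params (tm_subst \<sigma> t) = {}"
  by (induction t) auto

lemma params_subst: "params \<phi> = {} \<Longrightarrow> (\<And>i. tm_params (\<sigma> i) = {}) \<Longrightarrow> params (subst \<sigma> \<phi>) = {}"
proof (induction \<phi> arbitrary: \<sigma>)
  case (Forall \<tau> \<phi>)
  have "tm_params (up \<sigma> i) = {}" for i
    using Forall.prems by (cases i) (auto simp: tm_params_subst)
  then show ?case using Forall by simp
qed (auto simp: tm_params_subst)

lemma params_univ_closure [simp]: "params (univ_closure \<Gamma> \<phi>) = params \<phi>"
  by (induction \<Gamma> arbitrary: \<phi>) auto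

lemma params_inst: "params \<phi> = {} \<Longrightarrow> tm_params t = {} \<Longrightarrow> params (inst t \<phi>) = {}"
  unfolding inst_def by (rule params_subst) (auto split: nat.split)

lemma params_RCA0w: "\<phi> \<in> RCA0w \<Longrightarrow> params \<phi> = {}"
proof (induction rule: RCA0w.induct)
  case (K \<rho> \<tau>)
  show ?case by (simp add: allb_def params_heq ap_def cn_def)
next
  case (S \<delta> \<rho> \<tau>)
  then show ?case by (simp add: allb_def params_heq ap_def cn_def)
next
  case (Extensionality \<rho> \<tau>)
  then show ?case by (simp add: allb_def impb_def params_heq ap_def)
next
  case (QF_ind A \<Gamma>)
  then show ?case by (simp add: fm_defs params_inst params_subst)
next
  case (QF_AC A \<Gamma>)
  then show ?case by (simp add: fm_defs params_subst)
qed (auto simp: fmb_defs fm_defs)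

text \<open>Completeness is set up for theories in which finitely many parameters occur. The axiom
  set is infinite, but its formulas are closed, so that every parameter is still available as a
  witness.\<close>

lemma params_ACA0w: "\<phi> \<in> ACA0w \<Longrightarrow> params \<phi> = {}"
proof -
  have "params (exists2 0) = {}"
    by (simp add: exists2_def fmb_defs fm_defs arith_defs numeral_2_eq_2)
  then show "\<phi> \<in> ACA0w \<Longrightarrow> params \<phi> = {}"
    by (auto simp: ACA0w_def params_RCA0w)
qed


section \<open>Structures and the semantics of formulas with named bound variables\<close>

text \<open>The argument that \<open>allb\<close> and \<open>exb\<close> pass to their bodies at
  depth \<open>k\<close>: a variable is addressed by the depth of its binder and converted into an
  index at the place of use.\<close>

definition lvl :: "nat \<Rightarrow> tmb" where "lvl k = (\<lambda>d. Bnd (d - Suc k))"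

text \<open>\<open>s\<close> only refers to variables bound at depths below \<open>n\<close>.\<close>

definition stab :: "nat \<Rightarrow> tmb \<Rightarrow> bool" where
  "stab n s \<longleftrightarrow> (\<forall>d\<ge>n. s (Suc d) = tm_subst (\<lambda>i. Bnd (Suc i)) (s d))"

lemma stab_lvl [simp]: "k < n \<Longrightarrow> stab n (lvl k)"
  by (auto simp: stab_def lvl_def)

lemma stab_cn [simp]: "stab n (cn c)"
  by (auto simp: stab_def cn_def)

lemma stab_ap [simp]: "stab n s \<Longrightarrow> stab n t \<Longrightarrow> stab n (s \<cdot> t)"
  by (auto simp: stab_def ap_def)

lemma stab_Suc [simp]: "stab n s \<Longrightarrow> stab (Suc n) s"
  by (auto simp: stab_def)

lemma stab_num [simp]: "stab n (num k)"
  by (induction k) auto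

lemma stab_arith [simp]:
  "stab n s \<Longrightarrow> stab n (addf s)" "stab n s \<Longrightarrow> stab n (mulf s)" "stab n predf"
  "stab n s \<Longrightarrow> stab n (pow2 s)" "stab n s \<Longrightarrow> stab n t \<Longrightarrow> stab n (s \<^bold>+ t)"
  "stab n s \<Longrightarrow> stab n t \<Longrightarrow> stab n (s \<^bold>* t)" "stab n s \<Longrightarrow> stab n t \<Longrightarrow> stab n (monus s t)"
  by (auto simp: arith_defs)

definition HT :: "ty list \<Rightarrow> tmb \<Rightarrow> ty \<Rightarrow> bool" where
  "HT \<Gamma> s \<tau> \<longleftrightarrow> has_type \<Gamma> (s (length \<Gamma>)) \<tau>"

definition WF :: "ty list \<Rightarrow> fmb \<Rightarrow> bool" where
  "WF \<Gamma> \<phi> \<longleftrightarrow> wff \<Gamma> (\<phi> (length \<Gamma>))"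

lemma has_type_shift: "has_type (\<sigma> # \<Gamma>) (tm_subst (\<lambda>i. Bnd (Suc i)) t) \<tau> \<longleftrightarrow> has_type \<Gamma> t \<tau>"
  by (induction t arbitrary: \<tau>) auto

lemma HT_Cons [simp]: "stab (length \<Gamma>) s \<Longrightarrow> HT (\<sigma> # \<Gamma>) s \<tau> \<longleftrightarrow> HT \<Gamma> s \<tau>"
  by (simp add: HT_def stab_def has_type_shift)

lemma HT_lvl [simp]: "k < length \<Gamma> \<Longrightarrow> HT \<Gamma> (lvl k) \<tau> \<longleftrightarrow> \<Gamma> ! (length \<Gamma> - Suc k) = \<tau>"
  by (auto simp: HT_def lvl_def)

lemma HT_ap [simp]: "HT \<Gamma> (s \<cdot> t) \<tau> \<longleftrightarrow> (\<exists>\<sigma>. HT \<Gamma> s (\<sigma> \<rightarrow>\<^sub>t \<tau>) \<and> HT \<Gamma> t \<sigma>)"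
  by (simp add: HT_def ap_def)

lemma HT_cn [simp]: "HT \<Gamma> (cn c) \<tau> \<longleftrightarrow> cty c = \<tau>"
  by (simp add: HT_def cn_def)

lemma HT_num [simp]: "HT \<Gamma> (num k) \<tau> \<longleftrightarrow> \<tau> = N"
  by (induction k arbitrary: \<tau>) auto

lemma HT_addf [simp]: "HT \<Gamma> (addf s) \<tau> \<longleftrightarrow> \<tau> = T1 \<and> HT \<Gamma> s N"
  unfolding addf_def by simp blast

lemma HT_mulf [simp]: "HT \<Gamma> (mulf s) \<tau> \<longleftrightarrow> \<tau> = T1 \<and> HT \<Gamma> s N"
  unfolding mulf_def by simp blast

lemma HT_predf [simp]: "HT \<Gamma> predf \<tau> \<longleftrightarrow> \<tau> = T1"
  unfolding predf_def by simp blast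

lemma HT_pow2 [simp]: "HT \<Gamma> (pow2 s) \<tau> \<longleftrightarrow> \<tau> = N \<and> HT \<Gamma> s N"
  unfolding pow2_def by (simp del: num.simps) blast

lemma HT_arith [simp]:
  "HT \<Gamma> (s \<^bold>+ t) \<tau> \<longleftrightarrow> \<tau> = N \<and> HT \<Gamma> s N \<and> HT \<Gamma> t N"
  "HT \<Gamma> (s \<^bold>* t) \<tau> \<longleftrightarrow> \<tau> = N \<and> HT \<Gamma> s N \<and> HT \<Gamma> t N"
  "HT \<Gamma> (monus s t) \<tau> \<longleftrightarrow> \<tau> = N \<and> HT \<Gamma> s N \<and> HT \<Gamma> t N"
  by (simp_all add: add_def mul_def monus_def del: num.simps) blast+

lemma WF_simps [simp]:
  "WF \<Gamma> (s \<doteq> t) \<longleftrightarrow> HT \<Gamma> s N \<and> HT \<Gamma> t N"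
  "WF \<Gamma> (\<^bold>\<not> \<phi>) \<longleftrightarrow> WF \<Gamma> \<phi>"
  "WF \<Gamma> (\<phi> \<^bold>\<and> \<psi>) \<longleftrightarrow> WF \<Gamma> \<phi> \<and> WF \<Gamma> \<psi>"
  "WF \<Gamma> (\<phi> \<^bold>\<or> \<psi>) \<longleftrightarrow> WF \<Gamma> \<phi> \<and> WF \<Gamma> \<psi>"
  "WF \<Gamma> (\<phi> \<^bold>\<longrightarrow> \<psi>) \<longleftrightarrow> WF \<Gamma> \<phi> \<and> WF \<Gamma> \<psi>"
  "WF \<Gamma> (\<phi> \<^bold>\<longleftrightarrow> \<psi>) \<longleftrightarrow> WF \<Gamma> \<phi> \<and> WF \<Gamma> \<psi>"
  "WF \<Gamma> (allb \<tau> F) \<longleftrightarrow> WF (\<tau> # \<Gamma>) (F (lvl (length \<Gamma>)))"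
  "WF \<Gamma> (exb \<tau> F) \<longleftrightarrow> WF (\<tau> # \<Gamma>) (F (lvl (length \<Gamma>)))"
  by (auto simp: WF_def HT_def fmb_defs fm_defs lvl_def)

lemma WF_le [simp]: "WF \<Gamma> (s \<^bold>\<le> t) \<longleftrightarrow> HT \<Gamma> s N \<and> HT \<Gamma> t N"
  unfolding leb_def by (simp del: num.simps)

lemma WF_less [simp]: "WF \<Gamma> (s \<^bold>< t) \<longleftrightarrow> HT \<Gamma> s N \<and> HT \<Gamma> t N"
  unfolding lessb_def by (simp del: num.simps)

lemma WF_heq [simp]:
  "stab (length \<Gamma>) s \<Longrightarrow> stab (length \<Gamma>) t \<Longrightarrow> HT \<Gamma> s \<tau> \<Longrightarrow> HT \<Gamma> t \<tau> \<Longrightarrow> WF \<Gamma> (heq \<tau> s t)"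
  by (induction \<tau> arbitrary: s t \<Gamma>) auto

text \<open>Equality of numbers is left open as \<open>rel\<close> because two readings are needed:
  membership of the equation in a Henkin set for the term model, and identity for its
  quotient.\<close>

locale struct =
  fixes dom :: "ty \<Rightarrow> 'u set"
    and app :: "'u \<Rightarrow> 'u \<Rightarrow> 'u"  (infixl \<open>\<bullet>\<close> 90)
    and itp :: "tm \<Rightarrow> 'u"
    and rel :: "'u \<Rightarrow> 'u \<Rightarrow> bool"
begin

primrec ev :: "'u list \<Rightarrow> tm \<Rightarrow> 'u" where
  "ev e (Bnd i) = e ! i"
| "ev e (Par x \<tau>) = itp (Par x \<tau>)"
| "ev e (Cn c) = itp (Cn c)"
| "ev e (App s t) = ev e s \<bullet> ev e t"

primrec sat :: "'u list \<Rightarrow> fm \<Rightarrow> bool" where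
  "sat e (Eq s t) \<longleftrightarrow> rel (ev e s) (ev e t)"
| "sat e Fls \<longleftrightarrow> False"
| "sat e (Imp \<phi> \<psi>) \<longleftrightarrow> (sat e \<phi> \<longrightarrow> sat e \<psi>)"
| "sat e (Forall \<tau> \<phi>) \<longleftrightarrow> (\<forall>x\<in>dom \<tau>. sat (x # e) \<phi>)"

primrec sim :: "ty \<Rightarrow> 'u \<Rightarrow> 'u \<Rightarrow> bool" where
  "sim N a b = rel a b"
| "sim (\<rho> \<rightarrow>\<^sub>t \<tau>) a b = (\<forall>x\<in>dom \<rho>. sim \<tau> (a \<bullet> x) (b \<bullet> x))"

definition V :: "'u list \<Rightarrow> tmb \<Rightarrow> 'u" where "V e s = ev e (s (length e))"
definition SAT :: "'u list \<Rightarrow> fmb \<Rightarrow> bool" where "SAT e \<phi> \<longleftrightarrow> sat e (\<phi> (length e))"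

lemma ev_shift: "ev (x # e) (tm_subst (\<lambda>i. Bnd (Suc i)) t) = ev e t"
  by (induction t) auto

lemma V_Cons [simp]: "stab (length e) s \<Longrightarrow> V (x # e) s = V e s"
  by (simp add: V_def stab_def ev_shift)

lemma V_lvl [simp]: "V e (lvl k) = e ! (length e - Suc k)"
  by (simp add: V_def lvl_def)

lemma V_simps [simp]: "V e (s \<cdot> t) = V e s \<bullet> V e t" "V e (cn c) = itp (Cn c)"
  by (auto simp: V_def ap_def cn_def)

lemma SAT_simps [simp]:
  "SAT e (s \<doteq> t) \<longleftrightarrow> rel (V e s) (V e t)"
  "SAT e (\<^bold>\<not> \<phi>) \<longleftrightarrow> \<not> SAT e \<phi>"
  "SAT e (\<phi> \<^bold>\<and> \<psi>) \<longleftrightarrow> SAT e \<phi> \<and> SAT e \<psi>"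
  "SAT e (\<phi> \<^bold>\<or> \<psi>) \<longleftrightarrow> SAT e \<phi> \<or> SAT e \<psi>"
  "SAT e (\<phi> \<^bold>\<longrightarrow> \<psi>) \<longleftrightarrow> (SAT e \<phi> \<longrightarrow> SAT e \<psi>)"
  "SAT e (\<phi> \<^bold>\<longleftrightarrow> \<psi>) \<longleftrightarrow> (SAT e \<phi> \<longleftrightarrow> SAT e \<psi>)"
  "SAT e (allb \<tau> F) \<longleftrightarrow> (\<forall>x\<in>dom \<tau>. SAT (x # e) (F (lvl (length e))))"
  "SAT e (exb \<tau> F) \<longleftrightarrow> (\<exists>x\<in>dom \<tau>. SAT (x # e) (F (lvl (length e))))"
  by (auto simp: SAT_def V_def fmb_defs fm_defs lvl_def)

lemma SAT_heq_sim:
  "stab (length e) s \<Longrightarrow> stab (length e) t \<Longrightarrow> SAT e (heq \<tau> s t) \<longleftrightarrow> sim \<tau> (V e s) (V e t)"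
  by (induction \<tau> arbitrary: s t e) auto

end

section \<open>The extensional collapse of the term model\<close>

lemma has_type_nth:
  "list_all2 (has_type \<Delta>) e \<Gamma> \<Longrightarrow> i < length \<Gamma> \<Longrightarrow> has_type \<Delta> (e ! i) (\<Gamma> ! i)"
  by (simp add: list_all2_conv_all_nth)

lemma subst_cong: "wff \<Gamma> \<phi> \<Longrightarrow> (\<And>i. i < length \<Gamma> \<Longrightarrow> \<sigma> i = \<rho> i) \<Longrightarrow> subst \<sigma> \<phi> = subst \<rho> \<phi>"
proof (induction \<phi> arbitrary: \<Gamma> \<sigma> \<rho>)
  case (Forall \<tau> \<phi>)
  have "up \<sigma> i = up \<rho> i" if "i < length (\<tau> # \<Gamma>)" for i
    using that Forall.prems by (cases i) auto
  then have "subst (up \<sigma>) \<phi> = subst (up \<rho>) \<phi>"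
    using Forall.prems(1) by (intro Forall.IH[of "\<tau> # \<Gamma>"]) auto
  then show ?case by simp
next
  case (Imp \<phi>1 \<phi>2)
  have "subst \<sigma> \<phi>1 = subst \<rho> \<phi>1" "subst \<sigma> \<phi>2 = subst \<rho> \<phi>2"
    using Imp.prems by (auto intro!: Imp.IH[of \<Gamma>])
  then show ?case by simp
qed (auto intro: tm_subst_cong)

locale henkin_set =
  fixes X :: "fm set"
  assumes henkin: "henkin X" and ax: "\<And>\<psi>. \<psi> \<in> ACA0w \<Longrightarrow> wff [] \<psi> \<Longrightarrow> \<psi> \<in> X"
begin

sublocale T: struct "\<lambda>\<tau>. {t. has_type [] t \<tau>}" App "\<lambda>t. t" "\<lambda>s t. Eq s t \<in> X" .

lemma T_ev: "T.ev e t = tm_subst (nth e) t"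
  by (induction t) auto

text \<open>The truth lemma. An environment of closed terms acts as a substitution, and implications
  and quantifiers are settled by the corresponding clauses of \<open>henkin\<close>.\<close>

lemma T_sat:
  "wff \<Gamma> \<phi> \<Longrightarrow> list_all2 (has_type []) e \<Gamma> \<Longrightarrow> T.sat e \<phi> \<longleftrightarrow> subst (nth e) \<phi> \<in> X"
proof (induction \<phi> arbitrary: \<Gamma> e)
  case (Imp \<phi>1 \<phi>2)
  have "wff [] (subst (nth e) \<phi>1)" "wff [] (subst (nth e) \<phi>2)"
    using Imp.prems by (auto intro!: wff_subst[of \<Gamma>] has_type_nth[of "[]"])
  moreover have "T.sat e \<phi>1 \<longleftrightarrow> subst (nth e) \<phi>1 \<in> X" "T.sat e \<phi>2 \<longleftrightarrow> subst (nth e) \<phi>2 \<in> X"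
    using Imp.prems by (auto intro!: Imp.IH[of \<Gamma>])
  ultimately show ?case using henkin by (simp add: henkin_def)
next
  case (Forall \<tau> \<phi>)
  have "wff [\<tau>] (subst (up (nth e)) \<phi>)"
    using Forall.prems by (auto intro!: wff_subst[of "\<tau> # \<Gamma>"] has_type_up has_type_nth simp del: length_Cons)
  then have "subst (nth e) (Forall \<tau> \<phi>) \<in> X \<longleftrightarrow>
      (\<forall>t. has_type [] t \<tau> \<longrightarrow> inst t (subst (up (nth e)) \<phi>) \<in> X)"
    using henkin by (simp add: henkin_def)
  moreover have "inst t (subst (up (nth e)) \<phi>) = subst (nth (t # e)) \<phi>" for t
  proof -
    have "case_nat t (nth e) = nth (t # e)" by (auto simp: fun_eq_iff split: nat.split)
    then show ?thesis by (simp add: inst_subst_up)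
  qed
  ultimately show ?case using Forall.prems Forall.IH[of "\<tau> # \<Gamma>"] by simp
qed (use henkin in \<open>auto simp: T_ev henkin_def\<close>)

lemma T_sat_closed: "wff [] \<phi> \<Longrightarrow> T.sat [] \<phi> \<longleftrightarrow> \<phi> \<in> X"
  using T_sat[of "[]" \<phi> "[]"] subst_cong[of "[]" \<phi> "nth []" Bnd] by simp

abbreviation "hty t \<tau> \<equiv> has_type [] t \<tau>"

lemma Eq_subst: "wff [N] \<phi> \<Longrightarrow> Eq s t \<in> X \<Longrightarrow> inst s \<phi> \<in> X \<Longrightarrow> inst t \<phi> \<in> X"
  using henkin by (auto simp: henkin_def)

lemma inst_closed: "hty t \<tau> \<Longrightarrow> tm_subst \<sigma> t = t"
  using tm_subst_cong[of "[]" t \<tau> \<sigma> Bnd] by simp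

lemma Eq_refl: "hty t N \<Longrightarrow> Eq t t \<in> X"
  using henkin by (auto simp: henkin_def)

lemma Eq_trans: "Eq s t \<in> X \<Longrightarrow> Eq t u \<in> X \<Longrightarrow> hty s N \<Longrightarrow> Eq s u \<in> X"
  using Eq_subst[of "Eq s (Bnd 0)" t u] by (simp add: inst_def inst_closed has_type_closed)

lemma Eq_sym: "Eq s t \<in> X \<Longrightarrow> hty s N \<Longrightarrow> Eq t s \<in> X"
  using Eq_subst[of "Eq (Bnd 0) s" s t] by (simp add: inst_def inst_closed has_type_closed Eq_refl)

lemma hty_App: "hty s (\<sigma> \<rightarrow>\<^sub>t \<tau>) \<Longrightarrow> hty t \<sigma> \<Longrightarrow> hty (App s t) \<tau>"
  by auto

lemma sim_Fn: "T.sim (\<sigma> \<rightarrow>\<^sub>t \<tau>) s t \<longleftrightarrow> (\<forall>u. hty u \<sigma> \<longrightarrow> T.sim \<tau> (App s u) (App t u))"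
  by simp

declare has_type.simps(4) [simp del] T.sim.simps(2) [simp del]

lemma sim_refl: "hty t \<tau> \<Longrightarrow> T.sim \<tau> t t"
proof (induction \<tau> arbitrary: t)
  case (Fn \<sigma> \<tau>)
  then show ?case unfolding sim_Fn by (blast intro: hty_App)
qed (simp add: Eq_refl)

lemma sim_sym: "T.sim \<tau> s t \<Longrightarrow> hty s \<tau> \<Longrightarrow> hty t \<tau> \<Longrightarrow> T.sim \<tau> t s"
proof (induction \<tau> arbitrary: s t)
  case (Fn \<sigma> \<tau>)
  then show ?case unfolding sim_Fn by (blast intro: hty_App)
qed (simp add: Eq_sym)

lemma sim_trans: "T.sim \<tau> s t \<Longrightarrow> T.sim \<tau> t u \<Longrightarrow> hty s \<tau> \<Longrightarrow> hty t \<tau> \<Longrightarrow> hty u \<tau> \<Longrightarrow> T.sim \<tau> s u"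
proof (induction \<tau> arbitrary: s t u)
  case N
  then show ?case using Eq_trans by simp
next
  case (Fn \<sigma> \<tau>)
  show ?case unfolding sim_Fn
  proof (intro allI impI)
    fix x assume x: "hty x \<sigma>"
    have "T.sim \<tau> (App s x) (App t x)" "T.sim \<tau> (App t x) (App u x)"
      using Fn.prems x unfolding sim_Fn by blast+
    then show "T.sim \<tau> (App s x) (App u x)"
      by (rule Fn.IH(2)) (rule hty_App[OF _ x], fact)+
  qed
qed

text \<open>Agreement of \<open>s\<close> and \<open>s'\<close> at \<open>t\<close> is part of the
  first hypothesis; that \<open>s'\<close> respects agreement of its arguments is the extensionality
  axiom, which belongs to \<open>X\<close>. This makes application well defined on classes.\<close>

lemma sim_app:
  assumes "T.sim (\<sigma> \<rightarrow>\<^sub>t \<tau>) s s'" "T.sim \<sigma> t t'" "hty s (\<sigma> \<rightarrow>\<^sub>t \<tau>)" "hty s' (\<sigma> \<rightarrow>\<^sub>t \<tau>)" "hty t \<sigma>" "hty t' \<sigma>"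
  shows "T.sim \<tau> (App s t) (App s' t')"
proof -
  let ?E = "allb (\<sigma> \<rightarrow>\<^sub>t \<tau>) (\<lambda>z. allb \<sigma> (\<lambda>x. allb \<sigma> (\<lambda>y. heq \<sigma> x y \<^bold>\<longrightarrow> heq \<tau> (z \<cdot> x) (z \<cdot> y))))"
  have "WF [] ?E" by (simp)
  then have "?E 0 \<in> X" using ax RCA0w.Extensionality by (simp add: WF_def ACA0w_def)
  then have "T.SAT [] ?E" using T_sat_closed \<open>WF [] ?E\<close> by (simp add: T.SAT_def WF_def)
  then have "T.sim \<tau> (App s' t) (App s' t')"
    using assms by (simp add: T.SAT_heq_sim)
  moreover have "T.sim \<tau> (App s t) (App s' t)"
    using assms by (simp add: sim_Fn)
  ultimately show ?thesis
    using hty_App[OF assms(3,5)] hty_App[OF assms(4,5)] hty_App[OF assms(4,6)] sim_trans by blast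
qed

text \<open>A closed term has only one type, so the class needs no type index, and classes of terms
  of different types never meet.\<close>

definition cls :: "tm \<Rightarrow> tm set" where
  "cls t = {s. \<exists>\<tau>. hty s \<tau> \<and> hty t \<tau> \<and> T.sim \<tau> s t}"

definition qdom :: "ty \<Rightarrow> tm set set" where "qdom \<tau> = cls ` {t. hty t \<tau>}"

definition qapp :: "tm set \<Rightarrow> tm set \<Rightarrow> tm set" where
  "qapp c d = cls (App (SOME s. s \<in> c) (SOME t. t \<in> d))"

lemma cls_eq_iff:
  assumes "hty s \<tau>" "hty t \<tau>"
  shows "cls s = cls t \<longleftrightarrow> T.sim \<tau> s t"
proof
  assume "cls s = cls t"
  moreover have "s \<in> cls s" using assms by (auto simp: cls_def sim_refl)
  ultimately show "T.sim \<tau> s t" using assms by (auto simp: cls_def dest: has_type_unique)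
next
  have "cls s \<subseteq> cls t" if "T.sim \<tau> s t" "hty s \<tau>" "hty t \<tau>" for s t
    using that by (auto simp: cls_def) (metis has_type_unique sim_trans)
  then show "T.sim \<tau> s t \<Longrightarrow> cls s = cls t" using assms sim_sym by blast
qed

lemma cls_some: "hty t \<tau> \<Longrightarrow> hty (SOME s. s \<in> cls t) \<tau> \<and> T.sim \<tau> (SOME s. s \<in> cls t) t"
proof -
  assume t: "hty t \<tau>"
  then have "t \<in> cls t" by (auto simp: cls_def sim_refl)
  then have "(SOME s. s \<in> cls t) \<in> cls t" by (rule someI)
  then show ?thesis using t by (auto simp: cls_def dest: has_type_unique)
qed

lemma qapp_cls: "hty s (\<sigma> \<rightarrow>\<^sub>t \<tau>) \<Longrightarrow> hty t \<sigma> \<Longrightarrow> qapp (cls s) (cls t) = cls (App s t)"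
  unfolding qapp_def using cls_some[of s "\<sigma> \<rightarrow>\<^sub>t \<tau>"] cls_some[of t \<sigma>]
  by (subst cls_eq_iff[where \<tau> = \<tau>]) (auto intro: sim_app hty_App)

sublocale Q: struct qdom qapp cls "(=)" .

lemma Q_ev:
  "has_type \<Gamma> t \<tau> \<Longrightarrow> list_all2 (has_type []) e \<Gamma> \<Longrightarrow> Q.ev (map cls e) t = cls (T.ev e t)"
proof (induction t arbitrary: \<tau>)
  case (App t1 t2)
  then obtain \<sigma> where \<sigma>: "has_type \<Gamma> t1 (\<sigma> \<rightarrow>\<^sub>t \<tau>)" "has_type \<Gamma> t2 \<sigma>"
    by (auto simp: has_type.simps(4))
  have "hty (T.ev e t1) (\<sigma> \<rightarrow>\<^sub>t \<tau>)" "hty (T.ev e t2) \<sigma>"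
    unfolding T_ev using \<sigma> App.prems by (auto intro!: has_type_subst[of \<Gamma>] has_type_nth)
  then show ?case using App \<sigma> by (simp add: qapp_cls)
qed (auto simp: list_all2_lengthD)

lemma qdom_ball: "(\<forall>x\<in>qdom \<tau>. P x) \<longleftrightarrow> (\<forall>t. hty t \<tau> \<longrightarrow> P (cls t))"
  by (auto simp: qdom_def)

text \<open>At type 0 two classes coincide exactly if the equation lies in \<open>X\<close>, and
  every quantifier ranges over classes of closed terms; hence the quotient changes no truth
  value.\<close>

lemma Q_sat: "wff \<Gamma> \<phi> \<Longrightarrow> list_all2 (has_type []) e \<Gamma> \<Longrightarrow> Q.sat (map cls e) \<phi> \<longleftrightarrow> T.sat e \<phi>"
proof (induction \<phi> arbitrary: \<Gamma> e)
  case (Eq s t)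
  have "hty (T.ev e s) N" "hty (T.ev e t) N"
    unfolding T_ev using Eq by (auto intro!: has_type_subst[of \<Gamma>] has_type_nth)
  then show ?case
    using Eq cls_eq_iff[of "T.ev e s" N "T.ev e t"] Q_ev[of \<Gamma> s N e] Q_ev[of \<Gamma> t N e] by simp
next
  case (Forall \<tau> \<phi>)
  have "Q.sat (map cls (t # e)) \<phi> \<longleftrightarrow> T.sat (t # e) \<phi>" if "hty t \<tau>" for t
    using Forall.prems that by (intro Forall.IH[of "\<tau> # \<Gamma>"]) auto
  then show ?case by (auto simp: qdom_ball)
qed auto

lemma Q_sat_closed: "wff [] \<phi> \<Longrightarrow> Q.sat [] \<phi> \<longleftrightarrow> \<phi> \<in> X"
  using Q_sat[of "[]" \<phi> "[]"] T_sat_closed by simp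

text \<open>Lets an element obtained semantically be put back into a term as a constant, which is
  how functionals enter the construction of further functionals.\<close>

lemma qdom_named: "x \<in> qdom \<tau> \<Longrightarrow> \<exists>t. hty t \<tau> \<and> Q.ev [] t = x"
  using Q_ev[of "[]" _ _ "[]"] tm_subst_cong[of "[]" _ _ "nth []" Bnd] by (fastforce simp: qdom_def T_ev)

lemma cls_qdom: "hty t \<tau> \<Longrightarrow> cls t \<in> qdom \<tau>"
  by (auto simp: qdom_def)

lemma qapp_qdom: "f \<in> qdom (\<sigma> \<rightarrow>\<^sub>t \<tau>) \<Longrightarrow> x \<in> qdom \<sigma> \<Longrightarrow> qapp f x \<in> qdom \<tau>"
  by (auto simp: qdom_def qapp_cls intro: hty_App)

lemma qdom_ext:
  assumes "f \<in> qdom (\<sigma> \<rightarrow>\<^sub>t \<tau>)" "g \<in> qdom (\<sigma> \<rightarrow>\<^sub>t \<tau>)" and eq: "\<And>x. x \<in> qdom \<sigma> \<Longrightarrow> qapp f x = qapp g x"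
  shows "f = g"
proof -
  obtain s t where st: "hty s (\<sigma> \<rightarrow>\<^sub>t \<tau>)" "f = cls s" "hty t (\<sigma> \<rightarrow>\<^sub>t \<tau>)" "g = cls t"
    using assms by (auto simp: qdom_def)
  have "T.sim \<tau> (App s u) (App t u)" if "hty u \<sigma>" for u
  proof -
    have "cls (App s u) = cls (App t u)"
      using eq[of "cls u"] that st by (auto simp: qdom_def qapp_cls)
    then show ?thesis using cls_eq_iff hty_App that st by blast
  qed
  then show ?thesis using st cls_eq_iff sim_Fn by metis
qed

end

section \<open>Extensional models of \<open>ACA0w\<close>\<close>

text \<open>Quantifiers are restricted to numbers, but variables of every type may be free; sets and
  functionals can thus be parameters of comprehension.\<close>

primrec arith :: "fm \<Rightarrow> bool" where
  "arith (Eq s t) \<longleftrightarrow> True"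
| "arith Fls \<longleftrightarrow> True"
| "arith (Imp \<phi> \<psi>) \<longleftrightarrow> arith \<phi> \<and> arith \<psi>"
| "arith (Forall \<tau> \<phi>) \<longleftrightarrow> \<tau> = N \<and> arith \<phi>"

definition AR :: "nat \<Rightarrow> fmb \<Rightarrow> bool" where "AR n \<phi> \<longleftrightarrow> arith (\<phi> n)"

lemma AR_simps [simp]:
  "AR n (s \<doteq> t)" "AR n (s \<^bold>\<le> t)" "AR n (s \<^bold>< t)"
  "AR n (\<^bold>\<not> \<phi>) \<longleftrightarrow> AR n \<phi>"
  "AR n (\<phi> \<^bold>\<and> \<psi>) \<longleftrightarrow> AR n \<phi> \<and> AR n \<psi>"
  "AR n (\<phi> \<^bold>\<or> \<psi>) \<longleftrightarrow> AR n \<phi> \<and> AR n \<psi>"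
  "AR n (\<phi> \<^bold>\<longrightarrow> \<psi>) \<longleftrightarrow> AR n \<phi> \<and> AR n \<psi>"
  "AR n (\<phi> \<^bold>\<longleftrightarrow> \<psi>) \<longleftrightarrow> AR n \<phi> \<and> AR n \<psi>"
  "AR n (allb \<tau> F) \<longleftrightarrow> \<tau> = N \<and> AR (Suc n) (F (lvl n))"
  "AR n (exb \<tau> F) \<longleftrightarrow> \<tau> = N \<and> AR (Suc n) (F (lvl n))"
  by (auto simp: AR_def fmb_defs fm_defs lvl_def leb_def lessb_def)

locale aca_model = struct dom app itp "(=)"
  for dom :: "ty \<Rightarrow> 'u set" and app :: "'u \<Rightarrow> 'u \<Rightarrow> 'u"  (infixl \<open>\<bullet>\<close> 90) and itp :: "tm \<Rightarrow> 'u" +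
  assumes sat_ax: "\<psi> \<in> ACA0w \<Longrightarrow> wff [] \<psi> \<Longrightarrow> sat [] \<psi>"
    and dom_named: "x \<in> dom \<tau> \<Longrightarrow> \<exists>t. has_type [] t \<tau> \<and> ev [] t = x"
    and app_dom [simp]: "f \<in> dom (\<sigma> \<rightarrow>\<^sub>t \<tau>) \<Longrightarrow> x \<in> dom \<sigma> \<Longrightarrow> f \<bullet> x \<in> dom \<tau>"
    and itp_Cn [simp]: "itp (Cn c) \<in> dom (cty c)"
    and itp_Par [simp]: "itp (Par k \<tau>) \<in> dom \<tau>"
    and dom_ext: "f \<in> dom (\<sigma> \<rightarrow>\<^sub>t \<tau>) \<Longrightarrow> g \<in> dom (\<sigma> \<rightarrow>\<^sub>t \<tau>) \<Longrightarrow>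
      (\<And>x. x \<in> dom \<sigma> \<Longrightarrow> f \<bullet> x = g \<bullet> x) \<Longrightarrow> f = g"
begin

abbreviation envs :: "'u list \<Rightarrow> ty list \<Rightarrow> bool" where
  "envs e \<Gamma> \<equiv> list_all2 (\<lambda>x \<tau>. x \<in> dom \<tau>) e \<Gamma>"

lemma SAT_ax: "\<psi> 0 \<in> ACA0w \<Longrightarrow> WF [] \<psi> \<Longrightarrow> SAT [] \<psi>"
  using sat_ax by (simp add: SAT_def WF_def)

lemma sim_eq: "a \<in> dom \<tau> \<Longrightarrow> b \<in> dom \<tau> \<Longrightarrow> sim \<tau> a b \<longleftrightarrow> a = b"
proof (induction \<tau> arbitrary: a b)
  case (Fn \<sigma> \<tau>)
  have "a \<bullet> x \<in> dom \<tau>" "b \<bullet> x \<in> dom \<tau>" if "x \<in> dom \<sigma>" for x using Fn.prems that by auto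
  then show ?case using Fn dom_ext[of a \<sigma> \<tau> b] by auto
qed simp

lemma SAT_heq [simp]:
  "stab (length e) s \<Longrightarrow> stab (length e) t \<Longrightarrow> V e s \<in> dom \<tau> \<Longrightarrow> V e t \<in> dom \<tau> \<Longrightarrow>
     SAT e (heq \<tau> s t) \<longleftrightarrow> V e s = V e t"
  by (simp add: SAT_heq_sim sim_eq)

lemma ev_dom: "has_type \<Gamma> t \<tau> \<Longrightarrow> envs e \<Gamma> \<Longrightarrow> ev e t \<in> dom \<tau>"
proof (induction t arbitrary: \<tau>)
  case (Cn c)
  then show ?case using itp_Cn[of c] by simp
next
  case (App s t)
  then show ?case by fastforce
qed (auto simp: list_all2_conv_all_nth)

abbreviation "kc \<rho> \<tau> \<equiv> itp (Cn (Kc \<rho> \<tau>))"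
abbreviation "sc \<delta> \<rho> \<tau> \<equiv> itp (Cn (Sc \<delta> \<rho> \<tau>))"
abbreviation "rc \<equiv> itp (Cn Rec)"
abbreviation "zr \<equiv> itp (Cn Zero)"
abbreviation "succ \<equiv> itp (Cn Succ)"

lemma cn_dom [simp]:
  "kc \<rho> \<tau> \<in> dom (\<rho> \<rightarrow>\<^sub>t \<tau> \<rightarrow>\<^sub>t \<rho>)" "rc \<in> dom ((N \<rightarrow>\<^sub>t N \<rightarrow>\<^sub>t N) \<rightarrow>\<^sub>t N \<rightarrow>\<^sub>t N \<rightarrow>\<^sub>t N)"
  "sc \<delta> \<rho> \<tau> \<in> dom ((\<delta> \<rightarrow>\<^sub>t \<rho> \<rightarrow>\<^sub>t \<tau>) \<rightarrow>\<^sub>t (\<delta> \<rightarrow>\<^sub>t \<rho>) \<rightarrow>\<^sub>t \<delta> \<rightarrow>\<^sub>t \<tau>)"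
  "zr \<in> dom N" "succ \<in> dom T1"
  using itp_Cn[of "Kc \<rho> \<tau>"] itp_Cn[of Rec] itp_Cn[of Zero] itp_Cn[of Succ] itp_Cn[of "Sc \<delta> \<rho> \<tau>"] by auto

lemma succ_dom [simp]: "x \<in> dom N \<Longrightarrow> succ \<bullet> x \<in> dom N"
  by (rule app_dom[OF cn_dom(5)])

lemma kc_eq [simp]: "x \<in> dom \<rho> \<Longrightarrow> y \<in> dom \<tau> \<Longrightarrow> kc \<rho> \<tau> \<bullet> x \<bullet> y = x"
proof -
  assume xy: "x \<in> dom \<rho>" "y \<in> dom \<tau>"
  let ?F = "allb \<rho> (\<lambda>x. allb \<tau> (\<lambda>y. heq \<rho> (cn (Kc \<rho> \<tau>) \<cdot> x \<cdot> y) x))"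
  have "SAT [] ?F" by (rule SAT_ax) (auto simp: ACA0w_def intro: RCA0w.K)
  then have "SAT [y, x] (heq \<rho> (cn (Kc \<rho> \<tau>) \<cdot> lvl 0 \<cdot> lvl 1) (lvl 0))"
    using xy by simp
  moreover have "kc \<rho> \<tau> \<bullet> x \<bullet> y \<in> dom \<rho>" using xy by (meson app_dom cn_dom)
  ultimately show ?thesis using xy by simp
qed

lemma sc_eq [simp]: "x \<in> dom (\<delta> \<rightarrow>\<^sub>t \<rho> \<rightarrow>\<^sub>t \<tau>) \<Longrightarrow> y \<in> dom (\<delta> \<rightarrow>\<^sub>t \<rho>) \<Longrightarrow> z \<in> dom \<delta> \<Longrightarrow>
    sc \<delta> \<rho> \<tau> \<bullet> x \<bullet> y \<bullet> z = x \<bullet> z \<bullet> (y \<bullet> z)"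
proof -
  assume xyz: "x \<in> dom (\<delta> \<rightarrow>\<^sub>t \<rho> \<rightarrow>\<^sub>t \<tau>)" "y \<in> dom (\<delta> \<rightarrow>\<^sub>t \<rho>)" "z \<in> dom \<delta>"
  let ?F = "allb (\<delta> \<rightarrow>\<^sub>t \<rho> \<rightarrow>\<^sub>t \<tau>) (\<lambda>x. allb (\<delta> \<rightarrow>\<^sub>t \<rho>) (\<lambda>y. allb \<delta> (\<lambda>z.
        heq \<tau> (cn (Sc \<delta> \<rho> \<tau>) \<cdot> x \<cdot> y \<cdot> z) (x \<cdot> z \<cdot> (y \<cdot> z)))))"
  have "SAT [] ?F" by (rule SAT_ax) (auto simp: ACA0w_def intro: RCA0w.S)
  then have "SAT [z, y, x] (heq \<tau> (cn (Sc \<delta> \<rho> \<tau>) \<cdot> lvl 0 \<cdot> lvl 1 \<cdot> lvl 2) (lvl 0 \<cdot> lvl 2 \<cdot> (lvl 1 \<cdot> lvl 2)))"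
    using xyz by (simp add: numeral_2_eq_2)
  moreover have "sc \<delta> \<rho> \<tau> \<bullet> x \<bullet> y \<bullet> z \<in> dom \<tau>" "x \<bullet> z \<bullet> (y \<bullet> z) \<in> dom \<tau>" using xyz by (meson app_dom cn_dom)+
  ultimately show ?thesis using xyz by simp
qed

lemma rc_zr [simp]: "f \<in> dom (N \<rightarrow>\<^sub>t T1) \<Longrightarrow> m \<in> dom N \<Longrightarrow> rc \<bullet> f \<bullet> m \<bullet> zr = m"
  using SAT_ax[of "allb (N \<rightarrow>\<^sub>t N \<rightarrow>\<^sub>t N) (\<lambda>f. \<^bold>\<forall>\<^sub>0m. cn Rec \<cdot> f \<cdot> m \<cdot> cn Zero \<doteq> m)"] RCA0w.Rec_Zero
  by (auto simp: ACA0w_def)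

lemma rc_succ [simp]: "f \<in> dom (N \<rightarrow>\<^sub>t T1) \<Longrightarrow> m \<in> dom N \<Longrightarrow> n \<in> dom N \<Longrightarrow>
    rc \<bullet> f \<bullet> m \<bullet> (succ \<bullet> n) = f \<bullet> n \<bullet> (rc \<bullet> f \<bullet> m \<bullet> n)"
  using SAT_ax[of "allb (N \<rightarrow>\<^sub>t N \<rightarrow>\<^sub>t N) (\<lambda>f. \<^bold>\<forall>\<^sub>0m. \<^bold>\<forall>\<^sub>0n.
        cn Rec \<cdot> f \<cdot> m \<cdot> (cn Succ \<cdot> n) \<doteq> f \<cdot> n \<cdot> (cn Rec \<cdot> f \<cdot> m \<cdot> n))"] RCA0w.Rec_Succ
  by (auto simp: ACA0w_def)

lemma succ_neq [simp]: "x \<in> dom N \<Longrightarrow> succ \<bullet> x \<noteq> zr"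
  using SAT_ax[of "\<^bold>\<forall>\<^sub>0x. \<^bold>\<not> cn Succ \<cdot> x \<doteq> cn Zero"] RCA0w.Succ_not_Zero
  by (auto simp: ACA0w_def)

lemma succ_inj [simp]: "x \<in> dom N \<Longrightarrow> y \<in> dom N \<Longrightarrow> succ \<bullet> x = succ \<bullet> y \<longleftrightarrow> x = y"
  using SAT_ax[of "\<^bold>\<forall>\<^sub>0x. \<^bold>\<forall>\<^sub>0y. cn Succ \<cdot> x \<doteq> cn Succ \<cdot> y \<^bold>\<longrightarrow> x \<doteq> y"] RCA0w.Succ_inject
  by (auto simp: ACA0w_def)


subsection \<open>Abstraction and arithmetical comprehension\<close>

text \<open>Bracket abstraction with \<open>Sc\<close> and \<open>Kc\<close>: the identity is S K K,
  whatever is independent of the variable becomes a constant function, and S distributes over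
  application. The abstract is chosen before the environment, hence uniform in it.\<close>

lemma abstraction:
  "has_type (\<sigma> # \<Gamma>) t \<tau> \<Longrightarrow> \<exists>t'. has_type \<Gamma> t' (\<sigma> \<rightarrow>\<^sub>t \<tau>) \<and>
     (\<forall>e x. envs e \<Gamma> \<longrightarrow> x \<in> dom \<sigma> \<longrightarrow> ev e t' \<bullet> x = ev (x # e) t)"
proof (induction t arbitrary: \<tau>)
  case (Bnd i)
  show ?case
  proof (cases i)
    case 0
    have "kc \<sigma> \<sigma> \<in> dom (\<sigma> \<rightarrow>\<^sub>t \<sigma> \<rightarrow>\<^sub>t \<sigma>)" "kc \<sigma> (\<sigma> \<rightarrow>\<^sub>t \<sigma>) \<in> dom (\<sigma> \<rightarrow>\<^sub>t (\<sigma> \<rightarrow>\<^sub>t \<sigma>) \<rightarrow>\<^sub>t \<sigma>)" by simp_all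
    then have "sc \<sigma> (\<sigma> \<rightarrow>\<^sub>t \<sigma>) \<sigma> \<bullet> kc \<sigma> (\<sigma> \<rightarrow>\<^sub>t \<sigma>) \<bullet> kc \<sigma> \<sigma> \<bullet> x = x" if "x \<in> dom \<sigma>" for x
      using that app_dom[OF cn_dom(1)[of \<sigma> \<sigma>] that] by simp
    then show ?thesis using Bnd 0
      by (intro exI[of _ "App (App (Cn (Sc \<sigma> (\<sigma> \<rightarrow>\<^sub>t \<sigma>) \<sigma>)) (Cn (Kc \<sigma> (\<sigma> \<rightarrow>\<^sub>t \<sigma>)))) (Cn (Kc \<sigma> \<sigma>))"]) auto
  next
    case (Suc j)
    then have "e ! j \<in> dom \<tau>" if "envs e \<Gamma>" for e
      using Bnd that by (auto simp: list_all2_conv_all_nth)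
    then show ?thesis using Suc Bnd by (intro exI[of _ "App (Cn (Kc \<tau> \<sigma>)) (Bnd j)"]) auto
  qed
next
  case (Par y \<rho>)
  then show ?case by (intro exI[of _ "App (Cn (Kc \<tau> \<sigma>)) (Par y \<rho>)"]) auto
next
  case (Cn c)
  then show ?case using itp_Cn[of c] by (intro exI[of _ "App (Cn (Kc \<tau> \<sigma>)) (Cn c)"]) auto
next
  case (App s t)
  then obtain \<rho> where st: "has_type (\<sigma> # \<Gamma>) s (\<rho> \<rightarrow>\<^sub>t \<tau>)" "has_type (\<sigma> # \<Gamma>) t \<rho>" by auto
  obtain s' where s': "has_type \<Gamma> s' (\<sigma> \<rightarrow>\<^sub>t \<rho> \<rightarrow>\<^sub>t \<tau>)"
    "\<And>e x. envs e \<Gamma> \<Longrightarrow> x \<in> dom \<sigma> \<Longrightarrow> ev e s' \<bullet> x = ev (x # e) s" using App.IH(1)[OF st(1)] by blast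
  obtain t' where t': "has_type \<Gamma> t' (\<sigma> \<rightarrow>\<^sub>t \<rho>)"
    "\<And>e x. envs e \<Gamma> \<Longrightarrow> x \<in> dom \<sigma> \<Longrightarrow> ev e t' \<bullet> x = ev (x # e) t" using App.IH(2)[OF st(2)] by blast
  have "sc \<sigma> \<rho> \<tau> \<bullet> ev e s' \<bullet> ev e t' \<bullet> x = ev (x # e) s \<bullet> ev (x # e) t" if "envs e \<Gamma>" "x \<in> dom \<sigma>" for e x
    using that s' t' ev_dom by (simp add: ev_dom[OF s'(1)] ev_dom[OF t'(1)])
  then show ?case using s'(1) t'(1)
    by (intro exI[of _ "App (App (Cn (Sc \<sigma> \<rho> \<tau>)) s') t'"]) auto
qed

lemma lam:
  assumes "HT (\<sigma> # \<Gamma>) s \<tau>" "envs e \<Gamma>"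
  obtains f where "f \<in> dom (\<sigma> \<rightarrow>\<^sub>t \<tau>)" "\<And>x. x \<in> dom \<sigma> \<Longrightarrow> f \<bullet> x = V (x # e) s"
proof -
  obtain t' where "has_type \<Gamma> t' (\<sigma> \<rightarrow>\<^sub>t \<tau>)"
    "\<forall>e x. envs e \<Gamma> \<longrightarrow> x \<in> dom \<sigma> \<longrightarrow> ev e t' \<bullet> x = ev (x # e) (s (Suc (length \<Gamma>)))"
    using abstraction assms(1) by (auto simp: HT_def) blast
  then show thesis using assms(2)
    by (intro that[of "ev e t'"]) (auto simp: V_def ev_dom list_all2_lengthD)
qed

lemma lam2:
  assumes "HT (\<rho> # \<sigma> # \<Gamma>) s \<tau>" "envs e \<Gamma>"
  obtains f where "f \<in> dom (\<sigma> \<rightarrow>\<^sub>t \<rho> \<rightarrow>\<^sub>t \<tau>)"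
    "\<And>x y. x \<in> dom \<sigma> \<Longrightarrow> y \<in> dom \<rho> \<Longrightarrow> f \<bullet> x \<bullet> y = V (y # x # e) s"
proof -
  obtain t1 where t1: "has_type (\<sigma> # \<Gamma>) t1 (\<rho> \<rightarrow>\<^sub>t \<tau>)"
    "\<forall>e x. envs e (\<sigma> # \<Gamma>) \<longrightarrow> x \<in> dom \<rho> \<longrightarrow> ev e t1 \<bullet> x = ev (x # e) (s (Suc (Suc (length \<Gamma>))))"
    using abstraction assms(1) unfolding HT_def by fastforce
  obtain t2 where "has_type \<Gamma> t2 (\<sigma> \<rightarrow>\<^sub>t \<rho> \<rightarrow>\<^sub>t \<tau>)"
    "\<forall>e x. envs e \<Gamma> \<longrightarrow> x \<in> dom \<sigma> \<longrightarrow> ev e t2 \<bullet> x = ev (x # e) t1"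
    using abstraction[OF t1(1)] by blast
  then show thesis using assms(2) t1(2)
    by (intro that[of "ev e t2"]) (auto simp: V_def ev_dom list_all2_lengthD)
qed

section \<open>Functionals for case distinction, equality, quantification and search\<close>

abbreviation "one \<equiv> succ \<bullet> zr"

text \<open>Recursion with start value \<open>x\<close> and a step function that always returns
  \<open>y\<close>.\<close>

lemma cond_fun:
  obtains c where "c \<in> dom (N \<rightarrow>\<^sub>t N \<rightarrow>\<^sub>t T1)"
    "\<And>x y. x \<in> dom N \<Longrightarrow> y \<in> dom N \<Longrightarrow> c \<bullet> x \<bullet> y \<bullet> zr = x"
    "\<And>x y n. x \<in> dom N \<Longrightarrow> y \<in> dom N \<Longrightarrow> n \<in> dom N \<Longrightarrow> c \<bullet> x \<bullet> y \<bullet> (succ \<bullet> n) = y"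
proof -
  let ?s = "cn Rec \<cdot> (cn (Kc T1 N) \<cdot> (cn (Kc N N) \<cdot> lvl 1)) \<cdot> lvl 0"
  have "HT [N, N] ?s T1" by simp
  then obtain c where c: "c \<in> dom (N \<rightarrow>\<^sub>t N \<rightarrow>\<^sub>t T1)"
      "\<And>x y. x \<in> dom N \<Longrightarrow> y \<in> dom N \<Longrightarrow> c \<bullet> x \<bullet> y = V [y, x] ?s"
    by (rule lam2[of _ _ "[]" _ _ "[]"]) auto
  have k: "kc N N \<bullet> y \<in> dom T1" "kc T1 N \<bullet> (kc N N \<bullet> y) \<in> dom (N \<rightarrow>\<^sub>t T1)" if "y \<in> dom N" for y
    using that by (meson app_dom cn_dom)+
  have "rc \<bullet> (kc T1 N \<bullet> (kc N N \<bullet> y)) \<bullet> x \<bullet> n \<in> dom N" if "y \<in> dom N" "x \<in> dom N" "n \<in> dom N" for x y n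
    using that k app_dom cn_dom by meson
  then show thesis using c k by (intro that[of c]) auto
qed

text \<open>An existential quantifier is not allowed in quantifier-free induction. The predecessor
  is therefore given by the term \<open>predf\<close>, and the induction formula says that a nonzero
  number is the successor of its value.\<close>

lemma zr_or_succ:
  assumes "n \<in> dom N" shows "n = zr \<or> (\<exists>m\<in>dom N. n = succ \<bullet> m)"
proof -
  let ?p = "predf 0"
  let ?A = "Imp (Imp (Eq (Bnd 0) (Cn Zero)) Fls) (Eq (Bnd 0) (App (Cn Succ) (App ?p (Bnd 0))))"
  let ?F = "univ_closure []
        (Imp (Conj (inst (Cn Zero) ?A)
                   (Forall N (Imp ?A (subst (\<lambda>i. if i = 0 then App (Cn Succ) (Bnd 0) else Bnd i) ?A))))
             (Forall N ?A))"
  have p: "?p = App (App (Cn Rec) (Cn (Kc N N))) (Cn Zero)" by (simp add: predf_def ap_def cn_def)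
  have "?F \<in> ACA0w"
    unfolding ACA0w_def p by (intro insertI2 RCA0w.QF_ind) auto
  then have *: "sat [] ?F"
    by (rule sat_ax) (auto simp: p inst_def fm_defs)
  have d: "rc \<bullet> kc N N \<bullet> zr \<bullet> m \<in> dom N" if "m \<in> dom N" for m
    using that by (meson app_dom cn_dom)
  have "n = zr \<or> n = succ \<bullet> (rc \<bullet> kc N N \<bullet> zr \<bullet> n)"
    using * assms d by (auto simp: p inst_def fm_defs)
  then show ?thesis using d assms by blast
qed

text \<open>The axiom is taken for an equation \<open>f(n) = 0\<close> with \<open>f\<close> as a
  side variable. Once comprehension supplies characteristic functions with 0 for truth, this one
  instance covers all arithmetical formulas.\<close>

lemma fun_induct:
  assumes f: "f \<in> dom T1" and z: "f \<bullet> zr = zr" and s: "\<And>n. n \<in> dom N \<Longrightarrow> f \<bullet> n = zr \<Longrightarrow> f \<bullet> (succ \<bullet> n) = zr"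
    and n: "n \<in> dom N"
  shows "f \<bullet> n = zr"
proof -
  let ?A = "Eq (App (Bnd 1) (Bnd 0)) (Cn Zero)"
  let ?F = "univ_closure [T1]
        (Imp (Conj (inst (Cn Zero) ?A)
                   (Forall N (Imp ?A (subst (\<lambda>i. if i = 0 then App (Cn Succ) (Bnd 0) else Bnd i) ?A))))
             (Forall N ?A))"
  have "?F \<in> ACA0w"
    unfolding ACA0w_def by (intro insertI2 RCA0w.QF_ind) auto
  then have "sat [] ?F"
    by (rule sat_ax) (auto simp: inst_def fm_defs)
  then have *: "\<forall>f\<in>dom T1. f \<bullet> zr = zr \<and> (\<forall>n\<in>dom N. f \<bullet> n = zr \<longrightarrow> f \<bullet> (succ \<bullet> n) = zr) \<longrightarrow>
      (\<forall>n\<in>dom N. f \<bullet> n = zr)"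
    by (simp (no_asm_use) add: inst_def fm_defs)
  show ?thesis using bspec[OF * f] z s n by blast
qed

text \<open>\<open>QF_AC\<close> chooses for arguments of type 1 only, so a pair of numbers is
  encoded as a function with value \<open>x\<close> at 0 and \<open>y\<close> at 1. Choice yields a
  functional that tells whether these two values agree, and precomposing it with the functional of
  \<open>cond_fun\<close> decides equality.\<close>

lemma eq_fun:
  obtains q where "q \<in> dom (N \<rightarrow>\<^sub>t T1)"
    "\<And>x y. x \<in> dom N \<Longrightarrow> y \<in> dom N \<Longrightarrow> q \<bullet> x \<bullet> y = (if x = y then zr else one)"
proof -
  let ?E = "Eq (App (Bnd 1) (Cn Zero)) (App (Bnd 1) (App (Cn Succ) (Cn Zero)))"
  let ?A = "Conj (Imp ?E (Eq (Bnd 0) (Cn Zero))) (Imp (Neg ?E) (Eq (Bnd 0) (App (Cn Succ) (Cn Zero))))"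
  let ?F = "univ_closure [] (Imp (Forall T1 (Exists N ?A))
             (Exists T2 (Forall T1
               (subst (\<lambda>i. if i = 0 then App (Bnd 1) (Bnd 0) else if i = 1 then Bnd 0 else Bnd i) ?A))))"
  have "?F \<in> ACA0w"
    unfolding ACA0w_def by (intro insertI2 RCA0w.QF_AC) (auto simp: fm_defs)
  then have "sat [] ?F"
    by (rule sat_ax) (auto simp: fm_defs)
  moreover have "\<forall>f\<in>dom T1. \<exists>n\<in>dom N. (f \<bullet> zr = f \<bullet> one \<longrightarrow> n = zr) \<and> (f \<bullet> zr = f \<bullet> one \<or> n = one)"
    using cn_dom(4) succ_dom by blast
  ultimately have "\<exists>\<Phi>\<in>dom T2. \<forall>f\<in>dom T1. (f \<bullet> zr = f \<bullet> one \<longrightarrow> \<Phi> \<bullet> f = zr) \<and> (f \<bullet> zr = f \<bullet> one \<or> \<Phi> \<bullet> f = one)"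
    by (simp add: fm_defs)
  then obtain \<Phi> where \<Phi>: "\<Phi> \<in> dom T2"
    "\<And>f. f \<in> dom T1 \<Longrightarrow> \<Phi> \<bullet> f = (if f \<bullet> zr = f \<bullet> one then zr else one)"
    by (metis (full_types))
  obtain c where c: "c \<in> dom (N \<rightarrow>\<^sub>t N \<rightarrow>\<^sub>t T1)"
    "\<And>x y. x \<in> dom N \<Longrightarrow> y \<in> dom N \<Longrightarrow> c \<bullet> x \<bullet> y \<bullet> zr = x"
    "\<And>x y n. x \<in> dom N \<Longrightarrow> y \<in> dom N \<Longrightarrow> n \<in> dom N \<Longrightarrow> c \<bullet> x \<bullet> y \<bullet> (succ \<bullet> n) = y"
    using cond_fun by blast
  have "HT [N, N, T2, N \<rightarrow>\<^sub>t N \<rightarrow>\<^sub>t T1] (lvl 1 \<cdot> (lvl 0 \<cdot> lvl 2 \<cdot> lvl 3)) N" by simp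
  then obtain q where q: "q \<in> dom (N \<rightarrow>\<^sub>t T1)"
      "\<And>x y. x \<in> dom N \<Longrightarrow> y \<in> dom N \<Longrightarrow> q \<bullet> x \<bullet> y = V [y, x, \<Phi>, c] (lvl 1 \<cdot> (lvl 0 \<cdot> lvl 2 \<cdot> lvl 3))"
    using \<Phi> c by (elim lam2[of _ _ _ _ _ "[\<Phi>, c]"]) auto
  have "c \<bullet> x \<bullet> y \<in> dom T1" if "x \<in> dom N" "y \<in> dom N" for x y using that c(1) by (meson app_dom)
  then show thesis using q c \<Phi> by (intro that[of q]) auto
qed

lemma ex_fun:
  obtains \<phi> where "\<phi> \<in> dom T2" "\<And>f. f \<in> dom T1 \<Longrightarrow> \<phi> \<bullet> f = zr \<longleftrightarrow> (\<exists>n\<in>dom N. f \<bullet> n = zr)"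
proof -
  have "WF [] exists2" by (simp add: exists2_def)
  then have "SAT [] exists2" by (intro SAT_ax) (auto simp: ACA0w_def)
  then have "\<exists>\<phi>\<in>dom T2. \<forall>f\<in>dom T1. (\<exists>n\<in>dom N. f \<bullet> n = zr) \<longleftrightarrow> \<phi> \<bullet> f = zr"
    unfolding exists2_def by auto
  then show thesis using that by blast
qed

lemma all_fun:
  obtains a where "a \<in> dom T2" "\<And>f. f \<in> dom T1 \<Longrightarrow> a \<bullet> f = (if \<forall>n\<in>dom N. f \<bullet> n = zr then zr else one)"
proof -
  obtain \<phi> where \<phi>: "\<phi> \<in> dom T2" "\<And>f. f \<in> dom T1 \<Longrightarrow> \<phi> \<bullet> f = zr \<longleftrightarrow> (\<exists>n\<in>dom N. f \<bullet> n = zr)"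
    using ex_fun by blast
  obtain q where q: "q \<in> dom (N \<rightarrow>\<^sub>t T1)"
    "\<And>x y. x \<in> dom N \<Longrightarrow> y \<in> dom N \<Longrightarrow> q \<bullet> x \<bullet> y = (if x = y then zr else one)"
    using eq_fun by blast
  \<comment> \<open>With \<open>q\<close> the equality functional, \<open>q 1 (q 0 v)\<close>
    negates truth values: it is 0 exactly if \<open>v\<close> is not 0. The universal quantifier is
    the negated existential quantifier of the negated function.\<close>
  have "HT [N, T1, N \<rightarrow>\<^sub>t T1] (lvl 0 \<cdot> num 1 \<cdot> (lvl 0 \<cdot> num 0 \<cdot> (lvl 1 \<cdot> lvl 2))) N" by simp
  then obtain r where r: "r \<in> dom (T1 \<rightarrow>\<^sub>t T1)" "\<And>f n. f \<in> dom T1 \<Longrightarrow> n \<in> dom N \<Longrightarrow>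
       r \<bullet> f \<bullet> n = V [n, f, q] (lvl 0 \<cdot> num 1 \<cdot> (lvl 0 \<cdot> num 0 \<cdot> (lvl 1 \<cdot> lvl 2)))"
    using q by (elim lam2[of _ _ _ _ _ "[q]"]) auto
  have r2: "r \<bullet> f \<bullet> n = (if f \<bullet> n = zr then one else zr)" if "f \<in> dom T1" "n \<in> dom N" for f n
    using that r(2) q(2) by auto
  have "HT [T1, T2, T1 \<rightarrow>\<^sub>t T1, N \<rightarrow>\<^sub>t T1] (lvl 0 \<cdot> num 1 \<cdot> (lvl 0 \<cdot> num 0 \<cdot> (lvl 2 \<cdot> (lvl 1 \<cdot> lvl 3)))) N" by simp
  then obtain a where a: "a \<in> dom T2" "\<And>f. f \<in> dom T1 \<Longrightarrow>
       a \<bullet> f = V [f, \<phi>, r, q] (lvl 0 \<cdot> num 1 \<cdot> (lvl 0 \<cdot> num 0 \<cdot> (lvl 2 \<cdot> (lvl 1 \<cdot> lvl 3))))"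
    using q r \<phi> by (elim lam[of _ _ _ _ "[\<phi>, r, q]"]) auto
  have "a \<bullet> f = (if \<forall>n\<in>dom N. f \<bullet> n = zr then zr else one)" if f: "f \<in> dom T1" for f
  proof -
    have rf: "r \<bullet> f \<in> dom T1" using r(1) f by (meson app_dom)
    have "\<phi> \<bullet> (r \<bullet> f) = zr \<longleftrightarrow> (\<exists>n\<in>dom N. f \<bullet> n \<noteq> zr)"
      using \<phi>(2)[OF rf] r2[OF f] by auto
    moreover have "\<phi> \<bullet> (r \<bullet> f) \<in> dom N" using rf \<phi>(1) by (meson app_dom)
    ultimately have "a \<bullet> f = q \<bullet> one \<bullet> (if \<exists>n\<in>dom N. f \<bullet> n \<noteq> zr then zr else one)"
      using a(2)[OF f] q(2)[OF cn_dom(4)] by (simp add: eq_commute)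
    then show ?thesis using q(2)[of one] by simp
  qed
  then show thesis using a(1) that by blast
qed

text \<open>Feferman's search functional. With the quantifier \<open>\<phi>\<close> as a side
  variable, the condition that \<open>\<phi>(f) = 0\<close> implies \<open>f(n) = 0\<close> is
  quantifier-free and solvable in \<open>n\<close> for every \<open>f\<close>, so
  \<open>QF_AC\<close> applies to it.\<close>

lemma mu_fun:
  obtains \<mu> where "\<mu> \<in> dom T2"
    "\<And>f. f \<in> dom T1 \<Longrightarrow> \<exists>n\<in>dom N. f \<bullet> n = zr \<Longrightarrow> f \<bullet> (\<mu> \<bullet> f) = zr"
proof -
  obtain \<phi> where \<phi>: "\<phi> \<in> dom T2" "\<And>f. f \<in> dom T1 \<Longrightarrow> \<phi> \<bullet> f = zr \<longleftrightarrow> (\<exists>n\<in>dom N. f \<bullet> n = zr)"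
    using ex_fun by blast
  let ?A = "Imp (Eq (App (Bnd 2) (Bnd 1)) (Cn Zero)) (Eq (App (Bnd 1) (Bnd 0)) (Cn Zero))"
  let ?F = "univ_closure [T2] (Imp (Forall T1 (Exists N ?A))
             (Exists T2 (Forall T1
               (subst (\<lambda>i. if i = 0 then App (Bnd 1) (Bnd 0) else if i = 1 then Bnd 0 else Bnd i) ?A))))"
  have "?F \<in> ACA0w"
    unfolding ACA0w_def by (intro insertI2 RCA0w.QF_AC) (auto simp: fm_defs)
  then have "sat [] ?F"
    by (rule sat_ax) (auto simp: fm_defs)
  then have "\<forall>\<phi>\<in>dom T2. (\<forall>f\<in>dom T1. \<exists>n\<in>dom N. \<phi> \<bullet> f = zr \<longrightarrow> f \<bullet> n = zr) \<longrightarrow>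
      (\<exists>\<Phi>\<in>dom T2. \<forall>f\<in>dom T1. \<phi> \<bullet> f = zr \<longrightarrow> f \<bullet> (\<Phi> \<bullet> f) = zr)"
    by (simp add: fm_defs)
  moreover have "\<forall>f\<in>dom T1. \<exists>n\<in>dom N. \<phi> \<bullet> f = zr \<longrightarrow> f \<bullet> n = zr"
    using \<phi>(2) cn_dom(4) by blast
  ultimately obtain \<Phi> where \<Phi>: "\<Phi> \<in> dom T2" "\<And>f. f \<in> dom T1 \<Longrightarrow> \<phi> \<bullet> f = zr \<longrightarrow> f \<bullet> (\<Phi> \<bullet> f) = zr"
    using \<phi>(1) by blast
  then show thesis using \<phi>(2) that by blast
qed

end

context aca_model
begin

lemma ev_closed: "has_type [] t \<tau> \<Longrightarrow> ev e t = ev [] t"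
  by (induction t arbitrary: \<tau>) auto

lemma named:
  assumes "x \<in> dom \<tau>"
  obtains t where "\<And>\<Gamma>. has_type \<Gamma> t \<tau>" "\<And>e. ev e t = x"
  using dom_named[OF assms] ev_closed has_type_closed by metis

text \<open>The characteristic term is built along the formula, 0 standing for truth: equations use
  \<open>eq_fun\<close>, implications \<open>cond_fun\<close>, and number quantifiers
  \<open>all_fun\<close> applied to an abstraction.\<close>

lemma comprehension_term:
  "arith \<phi> \<Longrightarrow> wff \<Gamma> \<phi> \<Longrightarrow> \<exists>t. has_type \<Gamma> t N \<and>
     (\<forall>e. envs e \<Gamma> \<longrightarrow> ev e t = (if sat e \<phi> then zr else one))"
proof (induction \<phi> arbitrary: \<Gamma>)
  case (Eq s t)
  obtain q where q: "q \<in> dom (N \<rightarrow>\<^sub>t T1)"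
    "\<And>x y. x \<in> dom N \<Longrightarrow> y \<in> dom N \<Longrightarrow> q \<bullet> x \<bullet> y = (if x = y then zr else one)"
    using eq_fun by blast
  obtain u where "\<And>\<Gamma>. has_type \<Gamma> u (N \<rightarrow>\<^sub>t T1)" "\<And>e. ev e u = q" using named[OF q(1)] by blast
  moreover have "ev e s \<in> dom N" "ev e t \<in> dom N" if "envs e \<Gamma>" for e
    using Eq that ev_dom by auto
  ultimately show ?case using Eq q by (intro exI[of _ "App (App u s) t"]) auto
next
  case Fls
  then show ?case by (intro exI[of _ "App (Cn Succ) (Cn Zero)"]) auto
next
  case (Imp \<phi> \<psi>)
  obtain c where c: "c \<in> dom (N \<rightarrow>\<^sub>t N \<rightarrow>\<^sub>t T1)"
    "\<And>x y. x \<in> dom N \<Longrightarrow> y \<in> dom N \<Longrightarrow> c \<bullet> x \<bullet> y \<bullet> zr = x"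
    "\<And>x y n. x \<in> dom N \<Longrightarrow> y \<in> dom N \<Longrightarrow> n \<in> dom N \<Longrightarrow> c \<bullet> x \<bullet> y \<bullet> (succ \<bullet> n) = y"
    using cond_fun by blast
  obtain u where "\<And>\<Gamma>. has_type \<Gamma> u (N \<rightarrow>\<^sub>t N \<rightarrow>\<^sub>t T1)" "\<And>e. ev e u = c" using named[OF c(1)] by blast
  moreover obtain s where "has_type \<Gamma> s N" "\<And>e. envs e \<Gamma> \<Longrightarrow> ev e s = (if sat e \<phi> then zr else one)"
    using Imp.IH(1)[of \<Gamma>] Imp.prems by auto
  moreover obtain t where "has_type \<Gamma> t N" "\<And>e. envs e \<Gamma> \<Longrightarrow> ev e t = (if sat e \<psi> then zr else one)"
    using Imp.IH(2)[of \<Gamma>] Imp.prems by auto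
  \<comment> \<open>Case distinction on the premise: if its value is 0, the result is the value of
    the conclusion, otherwise it is 0, the implication being vacuously true.\<close>
  ultimately show ?case using c
    by (intro exI[of _ "App (App (App u t) (Cn Zero)) s"]) auto
next
  case (Forall \<tau> \<phi>)
  obtain a where a: "a \<in> dom T2" "\<And>f. f \<in> dom T1 \<Longrightarrow> a \<bullet> f = (if \<forall>n\<in>dom N. f \<bullet> n = zr then zr else one)"
    using all_fun by blast
  obtain u where u: "\<And>\<Gamma>. has_type \<Gamma> u T2" "\<And>e. ev e u = a" using named[OF a(1)] by blast
  obtain s where s: "has_type (N # \<Gamma>) s N" "\<And>e. envs e (N # \<Gamma>) \<Longrightarrow> ev e s = (if sat e \<phi> then zr else one)"
    using Forall.IH[of "N # \<Gamma>"] Forall.prems by auto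
  obtain t where t: "has_type \<Gamma> t T1" "\<And>e x. envs e \<Gamma> \<Longrightarrow> x \<in> dom N \<Longrightarrow> ev e t \<bullet> x = ev (x # e) s"
    using abstraction[OF s(1)] by blast
  have "a \<bullet> ev e t = (if sat e (Forall \<tau> \<phi>) then zr else one)" if e: "envs e \<Gamma>" for e
  proof -
    have "ev e t \<bullet> n = (if sat (n # e) \<phi> then zr else one)" if "n \<in> dom N" for n
      using t(2)[OF e that] s(2)[of "n # e"] e that by auto
    then show ?thesis using a(2)[OF ev_dom[OF t(1) e]] Forall.prems(1) by auto
  qed
  moreover have "has_type \<Gamma> (App u t) N" using t(1) u(1) by (auto intro!: exI[of _ T1])
  ultimately show ?case using u(2) by (intro exI[of _ "App u t"]) simp
qed

lemma comprehension:
  assumes "AR (Suc (length \<Gamma>)) \<phi>" "WF (\<sigma> # \<Gamma>) \<phi>" "envs e \<Gamma>"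
  obtains f where "f \<in> dom (\<sigma> \<rightarrow>\<^sub>t N)"
    "\<And>x. x \<in> dom \<sigma> \<Longrightarrow> f \<bullet> x = (if SAT (x # e) \<phi> then zr else one)"
proof -
  obtain t where t: "has_type (\<sigma> # \<Gamma>) t N" "\<forall>e. envs e (\<sigma> # \<Gamma>) \<longrightarrow>
      ev e t = (if sat e (\<phi> (Suc (length \<Gamma>))) then zr else one)"
    using comprehension_term assms(1,2) by (auto simp: WF_def AR_def) blast
  obtain f where "f \<in> dom (\<sigma> \<rightarrow>\<^sub>t N)" "\<And>x. x \<in> dom \<sigma> \<Longrightarrow> f \<bullet> x = V (x # e) (\<lambda>_. t)"
    using lam[of \<sigma> \<Gamma> "\<lambda>_. t" N e] t assms(3) by (auto simp: HT_def)
  then show thesis using t(2) assms(3)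
    by (intro that[of f]) (auto simp: V_def SAT_def list_all2_lengthD)
qed

lemma comprehension2:
  assumes "AR (Suc (Suc (length \<Gamma>))) \<phi>" "WF (\<rho> # \<sigma> # \<Gamma>) \<phi>" "envs e \<Gamma>"
  obtains f where "f \<in> dom (\<sigma> \<rightarrow>\<^sub>t \<rho> \<rightarrow>\<^sub>t N)"
    "\<And>x y. x \<in> dom \<sigma> \<Longrightarrow> y \<in> dom \<rho> \<Longrightarrow> f \<bullet> x \<bullet> y = (if SAT (y # x # e) \<phi> then zr else one)"
proof -
  obtain t where t: "has_type (\<rho> # \<sigma> # \<Gamma>) t N" "\<forall>e. envs e (\<rho> # \<sigma> # \<Gamma>) \<longrightarrow>
      ev e t = (if sat e (\<phi> (Suc (Suc (length \<Gamma>)))) then zr else one)"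
    using comprehension_term assms(1,2) by (auto simp: WF_def AR_def) blast
  obtain f where "f \<in> dom (\<sigma> \<rightarrow>\<^sub>t \<rho> \<rightarrow>\<^sub>t N)"
      "\<And>x y. x \<in> dom \<sigma> \<Longrightarrow> y \<in> dom \<rho> \<Longrightarrow> f \<bullet> x \<bullet> y = V (y # x # e) (\<lambda>_. t)"
    using lam2[of \<rho> \<sigma> \<Gamma> "\<lambda>_. t" N e] t assms(3) by (auto simp: HT_def)
  then show thesis using t(2) assms(3)
    by (intro that[of f]) (auto simp: V_def SAT_def list_all2_lengthD)
qed

lemma zr_neq_one [simp]: "zr \<noteq> one"
  using succ_neq[of zr] by (metis cn_dom(4))

lemma induction_fm:
  assumes x: "x \<in> dom N" and \<phi>: "AR (Suc (length \<Gamma>)) \<phi>" "WF (N # \<Gamma>) \<phi>" "envs e \<Gamma>"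
    and z: "SAT (zr # e) \<phi>"
    and s: "\<And>n. n \<in> dom N \<Longrightarrow> SAT (n # e) \<phi> \<Longrightarrow> SAT (succ \<bullet> n # e) \<phi>"
  shows "SAT (x # e) \<phi>"
proof -
  obtain f where f: "f \<in> dom T1" "\<And>x. x \<in> dom N \<Longrightarrow> f \<bullet> x = (if SAT (x # e) \<phi> then zr else one)"
    using comprehension[OF \<phi>] by blast
  have "f \<bullet> x = zr"
    using f(1) _ _ x
  proof (rule fun_induct)
    show "f \<bullet> zr = zr" using f(2) z by simp
    show "f \<bullet> (succ \<bullet> n) = zr" if "n \<in> dom N" "f \<bullet> n = zr" for n
      using f(2)[of n] f(2)[of "succ \<bullet> n"] that s[of n] by (auto split: if_splits)
  qed
  then show ?thesis using f(2)[OF x] by (auto split: if_splits)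
qed


subsection \<open>Arithmetic in the model\<close>

definition pl :: "'u \<Rightarrow> 'u \<Rightarrow> 'u" where "pl a b = rc \<bullet> (kc T1 N \<bullet> succ) \<bullet> a \<bullet> b"
definition ml :: "'u \<Rightarrow> 'u \<Rightarrow> 'u" where
  "ml a b = rc \<bullet> (kc T1 N \<bullet> (rc \<bullet> (kc T1 N \<bullet> succ) \<bullet> a)) \<bullet> zr \<bullet> b"
definition pd :: "'u \<Rightarrow> 'u" where "pd a = rc \<bullet> kc N N \<bullet> zr \<bullet> a"
definition mo :: "'u \<Rightarrow> 'u \<Rightarrow> 'u" where "mo a b = rc \<bullet> (kc T1 N \<bullet> (rc \<bullet> kc N N \<bullet> zr)) \<bullet> a \<bullet> b"
definition pw :: "'u \<Rightarrow> 'u" where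
  "pw a = rc \<bullet> (kc T1 N \<bullet> (rc \<bullet> (kc T1 N \<bullet> (rc \<bullet> (kc T1 N \<bullet> succ) \<bullet> (succ \<bullet> one))) \<bullet> zr)) \<bullet> one \<bullet> a"

lemma V_arith [simp]:
  "V e (s \<^bold>+ t) = pl (V e s) (V e t)" "V e (s \<^bold>* t) = ml (V e s) (V e t)"
  "V e (monus s t) = mo (V e s) (V e t)" "V e (pow2 t) = pw (V e t)"
  by (simp_all add: arith_defs pl_def ml_def mo_def pw_def numeral_2_eq_2)

lemma kc_step: "f \<in> dom T1 \<Longrightarrow> kc T1 N \<bullet> f \<in> dom (N \<rightarrow>\<^sub>t T1)"
  by (rule app_dom[OF cn_dom(1)])

lemma rc_dom: "f \<in> dom (N \<rightarrow>\<^sub>t T1) \<Longrightarrow> m \<in> dom N \<Longrightarrow> rc \<bullet> f \<bullet> m \<in> dom T1"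
  by (meson app_dom cn_dom)

lemma arith_fun_dom:
  "a \<in> dom N \<Longrightarrow> rc \<bullet> (kc T1 N \<bullet> succ) \<bullet> a \<in> dom T1" "rc \<bullet> kc N N \<bullet> zr \<in> dom T1"
  "a \<in> dom N \<Longrightarrow> rc \<bullet> (kc T1 N \<bullet> (rc \<bullet> (kc T1 N \<bullet> succ) \<bullet> a)) \<bullet> zr \<in> dom T1"
  by (simp_all add: rc_dom kc_step)

lemma arith_dom [simp]:
  "a \<in> dom N \<Longrightarrow> b \<in> dom N \<Longrightarrow> pl a b \<in> dom N" "a \<in> dom N \<Longrightarrow> b \<in> dom N \<Longrightarrow> ml a b \<in> dom N"
  "a \<in> dom N \<Longrightarrow> pd a \<in> dom N" "a \<in> dom N \<Longrightarrow> b \<in> dom N \<Longrightarrow> mo a b \<in> dom N" "a \<in> dom N \<Longrightarrow> pw a \<in> dom N"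
  unfolding pl_def ml_def pd_def mo_def pw_def
  by (rule app_dom[of _ N N], simp_all add: rc_dom kc_step)+

lemma pl_zr [simp]: "a \<in> dom N \<Longrightarrow> pl a zr = a"
  and pl_succ [simp]: "a \<in> dom N \<Longrightarrow> b \<in> dom N \<Longrightarrow> pl a (succ \<bullet> b) = succ \<bullet> pl a b"
  using arith_dom(1)[of a b] by (simp_all add: pl_def kc_step)

lemma ml_zr [simp]: "a \<in> dom N \<Longrightarrow> ml a zr = zr"
  and ml_succ [simp]: "a \<in> dom N \<Longrightarrow> b \<in> dom N \<Longrightarrow> ml a (succ \<bullet> b) = pl a (ml a b)"
  using arith_dom(2)[of a b] by (simp_all add: ml_def pl_def kc_step arith_fun_dom)

lemma pd_zr [simp]: "pd zr = zr"
  and pd_succ [simp]: "a \<in> dom N \<Longrightarrow> pd (succ \<bullet> a) = a"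
  using arith_dom(3)[of a] by (simp_all add: pd_def)

lemma mo_zr [simp]: "a \<in> dom N \<Longrightarrow> mo a zr = a"
  and mo_succ [simp]: "a \<in> dom N \<Longrightarrow> b \<in> dom N \<Longrightarrow> mo a (succ \<bullet> b) = pd (mo a b)"
  using arith_dom(4)[of a b] by (simp_all add: mo_def pd_def kc_step arith_fun_dom)

lemma pw_zr [simp]: "pw zr = one"
  and pw_succ [simp]: "a \<in> dom N \<Longrightarrow> pw (succ \<bullet> a) = ml (succ \<bullet> one) (pw a)"
  using arith_dom(5)[of a] by (simp_all add: pw_def ml_def kc_step arith_fun_dom)

lemma zr_pl [simp]: "b \<in> dom N \<Longrightarrow> pl zr b = b"
  using induction_fm[of b "[]" "num 0 \<^bold>+ lvl 0 \<doteq> lvl 0" "[]"] by simp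

lemma succ_pl [simp]: "a \<in> dom N \<Longrightarrow> b \<in> dom N \<Longrightarrow> pl (succ \<bullet> a) b = succ \<bullet> pl a b"
  using induction_fm[of b "[N]" "(cn Succ \<cdot> lvl 0) \<^bold>+ lvl 1 \<doteq> cn Succ \<cdot> (lvl 0 \<^bold>+ lvl 1)" "[a]"] by simp

lemma pl_comm: "a \<in> dom N \<Longrightarrow> b \<in> dom N \<Longrightarrow> pl a b = pl b a"
  using induction_fm[of b "[N]" "lvl 0 \<^bold>+ lvl 1 \<doteq> lvl 1 \<^bold>+ lvl 0" "[a]"] by simp

lemma pl_assoc: "a \<in> dom N \<Longrightarrow> b \<in> dom N \<Longrightarrow> c \<in> dom N \<Longrightarrow> pl (pl a b) c = pl a (pl b c)"
  using induction_fm[of c "[N, N]" "(lvl 0 \<^bold>+ lvl 1) \<^bold>+ lvl 2 \<doteq> lvl 0 \<^bold>+ (lvl 1 \<^bold>+ lvl 2)" "[b, a]"] by simp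

lemma pl_cancel: "a \<in> dom N \<Longrightarrow> b \<in> dom N \<Longrightarrow> c \<in> dom N \<Longrightarrow> pl a c = pl b c \<Longrightarrow> a = b"
  using induction_fm[of c "[N, N]" "lvl 0 \<^bold>+ lvl 2 \<doteq> lvl 1 \<^bold>+ lvl 2 \<^bold>\<longrightarrow> lvl 0 \<doteq> lvl 1" "[b, a]"] by simp

lemma zr_ml [simp]: "b \<in> dom N \<Longrightarrow> ml zr b = zr"
  using induction_fm[of b "[]" "num 0 \<^bold>* lvl 0 \<doteq> num 0" "[]"] by simp

lemma pl_left_comm: "a \<in> dom N \<Longrightarrow> b \<in> dom N \<Longrightarrow> c \<in> dom N \<Longrightarrow> pl a (pl b c) = pl b (pl a c)"
  by (metis pl_assoc pl_comm)

lemma succ_ml [simp]: "a \<in> dom N \<Longrightarrow> b \<in> dom N \<Longrightarrow> ml (succ \<bullet> a) b = pl b (ml a b)"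
  using induction_fm[of b "[N]" "(cn Succ \<cdot> lvl 0) \<^bold>* lvl 1 \<doteq> lvl 1 \<^bold>+ lvl 0 \<^bold>* lvl 1" "[a]"]
  by (simp add: pl_left_comm)

lemma ml_comm: "a \<in> dom N \<Longrightarrow> b \<in> dom N \<Longrightarrow> ml a b = ml b a"
  using induction_fm[of b "[N]" "lvl 0 \<^bold>* lvl 1 \<doteq> lvl 1 \<^bold>* lvl 0" "[a]"] by simp

lemma ml_distrib: "a \<in> dom N \<Longrightarrow> b \<in> dom N \<Longrightarrow> c \<in> dom N \<Longrightarrow> ml (pl a b) c = pl (ml a c) (ml b c)"
  using induction_fm[of c "[N, N]" "(lvl 0 \<^bold>+ lvl 1) \<^bold>* lvl 2 \<doteq> lvl 0 \<^bold>* lvl 2 \<^bold>+ lvl 1 \<^bold>* lvl 2" "[b, a]"]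
  by (simp add: pl_left_comm pl_assoc)

lemma ml_assoc: "a \<in> dom N \<Longrightarrow> b \<in> dom N \<Longrightarrow> c \<in> dom N \<Longrightarrow> ml (ml a b) c = ml a (ml b c)"
  using induction_fm[of c "[N, N]" "(lvl 0 \<^bold>* lvl 1) \<^bold>* lvl 2 \<doteq> lvl 0 \<^bold>* (lvl 1 \<^bold>* lvl 2)" "[b, a]"]
    ml_distrib ml_comm by simp

lemma pl_total:
  assumes "a \<in> dom N" "b \<in> dom N" shows "\<exists>c\<in>dom N. pl a c = b \<or> pl b c = a"
proof -
  let ?\<phi> = "\<^bold>\<exists>\<^sub>0c. lvl 1 \<^bold>+ c \<doteq> lvl 0 \<^bold>\<or> lvl 0 \<^bold>+ c \<doteq> lvl 1"
  have "SAT [a, b] ?\<phi>"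
  proof (rule induction_fm[where \<Gamma> = "[N]"])
    fix n assume n: "n \<in> dom N" "SAT [n, b] ?\<phi>"
    then obtain c where c: "c \<in> dom N" "pl n c = b \<or> pl b c = n" by auto
    have "\<exists>c\<in>dom N. pl (succ \<bullet> n) c = b \<or> pl b c = succ \<bullet> n"
    proof (cases "pl b c = n")
      case True
      then show ?thesis using n c assms by (intro bexI[of _ "succ \<bullet> c"]) auto
    next
      case False
      then have nc: "pl n c = b" using c by blast
      have "c \<noteq> zr" using False nc n c assms by auto
      then obtain d where d: "d \<in> dom N" "c = succ \<bullet> d" using zr_or_succ c by blast
      then show ?thesis using nc n by (intro bexI[of _ d]) auto
    qed
    then show "SAT [succ \<bullet> n, b] ?\<phi>" using n assms by simp
  qed (use assms in \<open>auto\<close>)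
  then show ?thesis using assms by simp
qed

lemma pl_eq_zr: "a \<in> dom N \<Longrightarrow> b \<in> dom N \<Longrightarrow> pl a b = zr \<Longrightarrow> a = zr"
  using zr_or_succ[of a] by auto

lemma mo_succ_succ: "a \<in> dom N \<Longrightarrow> b \<in> dom N \<Longrightarrow> mo (succ \<bullet> a) (succ \<bullet> b) = mo a b"
  using induction_fm[of b "[N]" "monus (cn Succ \<cdot> lvl 0) (cn Succ \<cdot> lvl 1) \<doteq> monus (lvl 0) (lvl 1)" "[a]"]
  by simp

lemma mo_pl: "a \<in> dom N \<Longrightarrow> b \<in> dom N \<Longrightarrow> mo (pl b a) b = a"
  using induction_fm[of b "[N]" "monus (lvl 1 \<^bold>+ lvl 0) (lvl 1) \<doteq> lvl 0" "[a]"]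
  by (simp add: mo_succ_succ del: mo_succ)

lemma mo_pl_zr: "a \<in> dom N \<Longrightarrow> c \<in> dom N \<Longrightarrow> mo a (pl a c) = zr"
proof -
  assume a: "a \<in> dom N" and c: "c \<in> dom N"
  have "mo a a = zr" using mo_pl[of zr a] a by simp
  then show ?thesis
    using induction_fm[of c "[N]" "monus (lvl 0) (lvl 0 \<^bold>+ lvl 1) \<doteq> num 0" "[a]"] a c by simp
qed

text \<open>The bridge from the defined order, truncated subtraction being 0, to the additive order
  that the type \<open>nn\<close> will carry. From left to right it rests on
  \<open>pl_total\<close>: a difference exists one way or the other.\<close>

lemma mo_eq_zr_iff:
  assumes a: "a \<in> dom N" and b: "b \<in> dom N"
  shows "mo a b = zr \<longleftrightarrow> (\<exists>c\<in>dom N. b = pl a c)"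
proof
  assume "mo a b = zr"
  moreover obtain c where "c \<in> dom N" "pl a c = b \<or> pl b c = a" using pl_total assms by blast
  ultimately show "\<exists>c\<in>dom N. b = pl a c" using mo_pl[of c b] assms by (metis pl_zr)
qed (use assms mo_pl_zr in blast)

end

section \<open>The natural numbers and the rationals of a fixed model as types\<close>

context henkin_set
begin

lemma aca_model_Q: "aca_model qdom qapp cls"
proof
  show "\<psi> \<in> ACA0w \<Longrightarrow> wff [] \<psi> \<Longrightarrow> Q.sat [] \<psi>" for \<psi>
    using ax by (simp add: Q_sat_closed)
  show "x \<in> qdom \<tau> \<Longrightarrow> \<exists>t. hty t \<tau> \<and> Q.ev [] t = x" for x \<tau>
    by (rule qdom_named)
  show "f = g" if "f \<in> qdom (\<sigma> \<rightarrow>\<^sub>t \<tau>)" "g \<in> qdom (\<sigma> \<rightarrow>\<^sub>t \<tau>)"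
    "\<And>x. x \<in> qdom \<sigma> \<Longrightarrow> qapp f x = qapp g x" for f g \<sigma> \<tau>
    using qdom_ext that by blast
qed (auto intro: qapp_qdom cls_qdom)

end

text \<open>The laws of the nonnegative part of a discretely ordered commutative ring, relative to a
  carrier set. Bundling carrier and operations into one tuple permits a choice between a model and
  the standard numbers before a type is introduced.\<close>

definition is_nums :: "'u set \<times> ('u \<Rightarrow> 'u \<Rightarrow> 'u) \<times> ('u \<Rightarrow> 'u \<Rightarrow> 'u) \<times> 'u \<times> 'u \<Rightarrow> bool" where
  "is_nums S = (case S of (C, p, t, z, u) \<Rightarrow>
     z \<in> C \<and> u \<in> C \<and> (\<forall>a\<in>C. \<forall>b\<in>C. p a b \<in> C \<and> t a b \<in> C) \<and>
     (\<forall>a\<in>C. \<forall>b\<in>C. p a b = p b a \<and> t a b = t b a) \<and>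
     (\<forall>a\<in>C. \<forall>b\<in>C. \<forall>c\<in>C. p (p a b) c = p a (p b c) \<and> t (t a b) c = t a (t b c) \<and>
        t (p a b) c = p (t a c) (t b c) \<and> (p a c = p b c \<longrightarrow> a = b)) \<and>
     (\<forall>a\<in>C. p a z = a \<and> t a z = z \<and> t a u = a) \<and>
     (\<forall>a\<in>C. \<forall>b\<in>C. (\<exists>c\<in>C. p a c = b \<or> p b c = a) \<and> (p a b = z \<longrightarrow> a = z)) \<and>
     (\<forall>a\<in>C. a = z \<or> (\<exists>b\<in>C. a = p b u)) \<and> z \<noteq> u)"

lemma (in aca_model) is_nums: "is_nums (dom N, pl, ml, zr, one)"
  unfolding is_nums_def case_prod_conv
proof (intro conjI ballI)
  show "a = zr \<or> (\<exists>b\<in>dom N. a = pl b one)" if "a \<in> dom N" for a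
    using zr_or_succ[OF that] by auto
  show "pl a c = pl b c \<longrightarrow> a = b" if "a \<in> dom N" "b \<in> dom N" "c \<in> dom N" for a b c
    using pl_cancel that by blast
qed (auto simp: pl_assoc ml_assoc ml_distrib pl_total intro: pl_comm ml_comm pl_eq_zr)

text \<open>The carrier has to consist of sets of terms, as the classes of a term model do;
  \<open>{Bnd n}\<close> serves as a label for \<open>n\<close>.\<close>

definition nat_nums :: "tm set set \<times> (tm set \<Rightarrow> tm set \<Rightarrow> tm set) \<times> (tm set \<Rightarrow> tm set \<Rightarrow> tm set) \<times> tm set \<times> tm set" where
  "nat_nums = (let \<iota> = \<lambda>n. {Bnd n} in (range \<iota>, \<lambda>a b. \<iota> (inv \<iota> a + inv \<iota> b), \<lambda>a b. \<iota> (inv \<iota> a * inv \<iota> b), \<iota> 0, \<iota> 1))"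

lemma is_nums_nat: "is_nums nat_nums"
proof -
  have "inj (\<lambda>n. {Bnd n})" by (auto intro: injI)
  then have [simp]: "inv (\<lambda>n. {Bnd n}) {Bnd k} = k" for k by (simp add: inv_f_eq)
  have "\<exists>c. a + c = b \<or> b + c = a" for a b :: nat by presburger
  moreover have "a = 0 \<or> (\<exists>b. a = Suc b)" for a :: nat by presburger
  ultimately show ?thesis
    unfolding is_nums_def nat_nums_def Let_def case_prod_conv by (auto simp: algebra_simps)
qed

definition claim :: "nat \<Rightarrow> fm" where
  "claim i = ((cocode i Unit_Interval \<^bold>\<longleftrightarrow> cocode i Reals) \<^bold>\<and> (cocode i Reals \<^bold>\<longleftrightarrow> cocode i Cantor)) 0"

text \<open>
  Type definitions cannot depend on a model, so one potential countermodel is fixed globally.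
  If there is none, the numbers below are a copy of \<open>nat\<close> and play no role.
\<close>

definition X0 :: "fm set" where
  "X0 = (SOME X. henkin_set X \<and> (\<exists>i. claim i \<notin> X))"

abbreviation "dm \<equiv> henkin_set.qdom X0"
abbreviation ap2 :: "tm set \<Rightarrow> tm set \<Rightarrow> tm set"  (infixl \<open>\<bullet>\<close> 90) where "ap2 \<equiv> henkin_set.qapp X0"
abbreviation "it \<equiv> henkin_set.cls X0"

definition nums where
  "nums = (if henkin_set X0
     then (dm N, aca_model.pl ap2 it, aca_model.ml ap2 it, it (Cn Zero), ap2 (it (Cn Succ)) (it (Cn Zero)))
     else nat_nums)"

lemma is_nums_nums: "is_nums nums"
  unfolding nums_def using aca_model.is_nums[OF henkin_set.aca_model_Q] is_nums_nat by simp

definition "nums_C = fst nums"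
definition "nums_p = fst (snd nums)"
definition "nums_t = fst (snd (snd nums))"
definition "nums_z = fst (snd (snd (snd nums)))"
definition "nums_u = snd (snd (snd (snd nums)))"

lemma nums_eq_tuple: "nums = (nums_C, nums_p, nums_t, nums_z, nums_u)"
  by (simp add: nums_C_def nums_p_def nums_t_def nums_z_def nums_u_def)

lemmas nums_facts = is_nums_nums[unfolded nums_eq_tuple is_nums_def case_prod_conv]

lemma nums_consts:
  "nums_z \<in> nums_C"
  "nums_u \<in> nums_C"
  "nums_z \<noteq> nums_u"
  using nums_facts by simp_all

lemma nums_closed:
  "a \<in> nums_C \<Longrightarrow> b \<in> nums_C \<Longrightarrow> nums_p a b \<in> nums_C"
  "a \<in> nums_C \<Longrightarrow> b \<in> nums_C \<Longrightarrow> nums_t a b \<in> nums_C"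
  using nums_facts[THEN conjunct2, THEN conjunct2, THEN conjunct1] by blast+

lemma nums_comm:
  "a \<in> nums_C \<Longrightarrow> b \<in> nums_C \<Longrightarrow> nums_p a b = nums_p b a"
  "a \<in> nums_C \<Longrightarrow> b \<in> nums_C \<Longrightarrow> nums_t a b = nums_t b a"
  using nums_facts[THEN conjunct2, THEN conjunct2, THEN conjunct2, THEN conjunct1] by blast+

lemma nums_ring:
  "a \<in> nums_C \<Longrightarrow> b \<in> nums_C \<Longrightarrow> c \<in> nums_C \<Longrightarrow> nums_p (nums_p a b) c = nums_p a (nums_p b c)"
  "a \<in> nums_C \<Longrightarrow> b \<in> nums_C \<Longrightarrow> c \<in> nums_C \<Longrightarrow> nums_t (nums_t a b) c = nums_t a (nums_t b c)"
  "a \<in> nums_C \<Longrightarrow> b \<in> nums_C \<Longrightarrow> c \<in> nums_C \<Longrightarrow> nums_t (nums_p a b) c = nums_p (nums_t a c) (nums_t b c)"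
  "a \<in> nums_C \<Longrightarrow> b \<in> nums_C \<Longrightarrow> c \<in> nums_C \<Longrightarrow> nums_p a c = nums_p b c \<Longrightarrow> a = b"
  using nums_facts[THEN conjunct2, THEN conjunct2, THEN conjunct2, THEN conjunct2, THEN conjunct1] by blast+

lemma nums_unit:
  "a \<in> nums_C \<Longrightarrow> nums_p a nums_z = a"
  "a \<in> nums_C \<Longrightarrow> nums_t a nums_z = nums_z"
  "a \<in> nums_C \<Longrightarrow> nums_t a nums_u = a"
  using nums_facts[THEN conjunct2, THEN conjunct2, THEN conjunct2, THEN conjunct2, THEN conjunct2, THEN conjunct1] by blast+

lemma nums_order:
  "a \<in> nums_C \<Longrightarrow> b \<in> nums_C \<Longrightarrow> \<exists>c\<in>nums_C. nums_p a c = b \<or> nums_p b c = a"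
  "a \<in> nums_C \<Longrightarrow> b \<in> nums_C \<Longrightarrow> nums_p a b = nums_z \<Longrightarrow> a = nums_z"
  using nums_facts[THEN conjunct2, THEN conjunct2, THEN conjunct2, THEN conjunct2, THEN conjunct2, THEN conjunct2, THEN conjunct1, THEN bspec, THEN bspec] by blast+

lemma nums_pred:
  "a \<in> nums_C \<Longrightarrow> a = nums_z \<or> (\<exists>b\<in>nums_C. a = nums_p b nums_u)"
  using nums_facts[THEN conjunct2, THEN conjunct2, THEN conjunct2, THEN conjunct2, THEN conjunct2, THEN conjunct2, THEN conjunct2] by blast

lemmas nums_laws = nums_consts(1,2) nums_closed nums_comm nums_ring nums_unit nums_order nums_pred nums_consts(3)

section \<open>The ordered semiring of the numbers of the model\<close>

typedef nn = nums_C
  using nums_laws(1) by blast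

setup_lifting type_definition_nn

instantiation nn :: comm_semiring_1
begin
lift_definition zero_nn :: nn is nums_z by (rule nums_laws)
lift_definition one_nn :: nn is nums_u by (rule nums_laws)
lift_definition plus_nn :: "nn \<Rightarrow> nn \<Rightarrow> nn" is nums_p by (rule nums_laws)
lift_definition times_nn :: "nn \<Rightarrow> nn \<Rightarrow> nn" is nums_t by (rule nums_laws)
instance
proof
  fix a b c :: nn
  show "a + b + c = a + (b + c)" by transfer (rule nums_laws)
  show "a + b = b + a" by transfer (rule nums_laws)
  show "a * b * c = a * (b * c)" by transfer (rule nums_laws)
  show "a * b = b * a" by transfer (rule nums_laws)
  show "(a + b) * c = a * c + b * c" by transfer (rule nums_laws)
  show "0 + a = a" by transfer (metis nums_laws(1,5,11))
  show "1 * a = a" by transfer (metis nums_laws(2,6,13))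
  show "0 * a = 0" by transfer (metis nums_laws(1,6,12))
  show "a * 0 = 0" by transfer (rule nums_laws)
  show "(0::nn) \<noteq> 1" by transfer (rule nums_laws)
qed
end

lemma nn_cancel: "a + c = b + c \<Longrightarrow> a = (b::nn)"
  by transfer (rule nums_laws)
lemma nn_total: "\<exists>c. a + c = b \<or> b + c = (a::nn)"
  by transfer (use nums_laws(14) in force)
lemma nn_zero_sum: "a + b = 0 \<Longrightarrow> a = (0::nn)"
  by transfer (rule nums_laws)
lemma nn_pred: "a = 0 \<or> (\<exists>b. a = b + (1::nn))"
  by transfer (use nums_laws(16) in force)

text \<open>Addition determines the order: cancellation makes differences unique,
  \<open>nn_total\<close> makes the order linear, and \<open>nn_pred\<close> excludes zero
  divisors.\<close>

instantiation nn :: linordered_semidom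
begin
definition less_eq_nn_def: "(a::nn) \<le> b \<longleftrightarrow> (\<exists>c. b = a + c)"
definition less_nn_def: "(a::nn) < b \<longleftrightarrow> a \<le> b \<and> a \<noteq> b"
definition minus_nn_def: "(a::nn) - b = (if b \<le> a then (THE c. a = b + c) else 0)"
instance
proof
  fix a b c :: nn
  have canc: "x + y = x + z \<Longrightarrow> y = z" for x y z :: nn using nn_cancel by (metis add.commute)
  have minus: "x + y - x = y" for x y :: nn
    unfolding minus_nn_def less_eq_nn_def by (auto intro!: the_equality dest: canc)
  have minus0: "x - y = 0" if "\<not> y \<le> x" for x y :: nn using that by (simp add: minus_nn_def)
  have le: "x \<le> x + y" for x y :: nn by (auto simp: less_eq_nn_def)
  have antisym: "x = y" if xy: "x \<le> y" "y \<le> x" for x y :: nn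
  proof -
    obtain u v where uv: "y = x + u" "x = y + v" using xy by (auto simp: less_eq_nn_def)
    then have "x + (u + v) = x + 0" by (metis add.assoc add_0_right)
    then have "u + v = 0" by (rule canc)
    then have "u = 0" by (rule nn_zero_sum)
    then show ?thesis using uv by simp
  qed
  have trans: "x \<le> z" if xy: "x \<le> y" "y \<le> z" for x y z :: nn
    using xy by (auto simp: less_eq_nn_def add.assoc)
  have total: "x \<le> y \<or> y \<le> x" for x y :: nn using nn_total[of x y] by (auto simp: less_eq_nn_def)
  show "(a < b) = (a \<le> b \<and> \<not> b \<le> a)" using antisym by (auto simp: less_nn_def)
  show "a \<le> a" using le[of a 0] by simp
  show "a \<le> b \<Longrightarrow> b \<le> c \<Longrightarrow> a \<le> c" by (rule trans)
  show "a \<le> b \<Longrightarrow> b \<le> a \<Longrightarrow> a = b" by (rule antisym)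
  show "a \<le> b \<or> b \<le> a" by (rule total)
  show "a \<le> b \<Longrightarrow> c + a \<le> c + b" by (auto simp: less_eq_nn_def add.assoc)
  show "(0::nn) < 1" using le[of 0 1] by (simp add: less_nn_def)
  show "a + b - a = b" by (rule minus)
  show "b \<le> a \<Longrightarrow> a - b + b = a" using minus by (metis add.commute less_eq_nn_def)
  have nz: "x * y \<noteq> 0" if "x \<noteq> 0" "y \<noteq> 0" for x y :: nn
  proof
    obtain u v where "x = u + 1" "y = v + 1" using nn_pred \<open>x \<noteq> 0\<close> \<open>y \<noteq> 0\<close> by blast
    moreover assume "x * y = 0"
    ultimately have "1 + (u * v + u + v) = 0" by (simp add: algebra_simps)
    then have "(1::nn) = 0" by (rule nn_zero_sum)
    then show False by simp
  qed
  then show "a \<noteq> 0 \<Longrightarrow> b \<noteq> 0 \<Longrightarrow> a * b \<noteq> 0" .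
  show "a < b \<Longrightarrow> 0 < c \<Longrightarrow> c * a < c * b"
  proof -
    assume "a < b" "0 < c"
    then obtain d where "b = a + d" "a \<noteq> b" by (auto simp: less_eq_nn_def less_nn_def)
    then have d: "b = a + d" "d \<noteq> 0" by auto
    then have "c * a \<noteq> c * b" using nz[of c d] \<open>0 < c\<close> canc[of "c * a" "c * d" 0]
      by (auto simp: less_nn_def algebra_simps)
    then show ?thesis using d by (auto simp: less_nn_def less_eq_nn_def distrib_left)
  qed
  show "a - b - c = a - (b + c)"
  proof (cases "b + c \<le> a")
    case True
    then obtain d where "a = b + (c + d)" by (auto simp: less_eq_nn_def add.assoc)
    then show ?thesis using minus[of b "c + d"] minus[of "b + c" d] minus[of c d] by (simp add: add.assoc)
  next
    case False
    show ?thesis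
    proof (cases "b \<le> a")
      case True
      then obtain d where d: "a = b + d" by (auto simp: less_eq_nn_def)
      then have "\<not> c \<le> d" using False by (auto simp: less_eq_nn_def add.assoc)
      then show ?thesis using False d minus minus0 by simp
    next
      case b: False
      have "0 - c = 0"
        using minus[of 0 0] minus0[of c 0] antisym[of c 0] le[of 0 c] by (cases "c \<le> 0") auto
      then show ?thesis using False b minus0 by simp
    qed
  qed
  show "a * (b - c) = a * b - a * c"
  proof (cases "c \<le> b")
    case True
    then obtain d where "b = c + d" by (auto simp: less_eq_nn_def)
    then show ?thesis using minus by (simp add: distrib_left)
  next
    case False
    then have "b \<le> c" using total by blast
    then obtain d where d: "c = b + d" by (auto simp: less_eq_nn_def)
    show ?thesis
    proof (cases "a * c \<le> a * b")
      case True
      have "a * b \<le> a * c" using d le by (simp add: distrib_left)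
      then have "a * b = a * c" using True antisym by blast
      then show ?thesis using False minus0 minus[of "a * b" 0] by simp
    next
      case F: False
      then show ?thesis using False minus0 by simp
    qed
  qed
qed
end

lemma nn_discrete: "a < b \<longleftrightarrow> a + 1 \<le> (b::nn)"
proof
  assume "a < b"
  then obtain c where "b = a + c" "c \<noteq> 0" by (auto simp: less_eq_nn_def less_nn_def)
  then show "a + 1 \<le> b" using nn_pred[of c] by (auto simp: less_eq_nn_def ac_simps)
next
  assume "a + 1 \<le> b"
  then show "a < b" by (meson less_add_one less_le_trans)
qed

lemma nn_nonneg [simp]: "0 \<le> (a::nn)"
  by (auto simp: less_eq_nn_def)


subsection \<open>The ring of differences and its fraction field\<close>

quotient_type zz = "nn \<times> nn" / "\<lambda>(a, b) (c, d). a + d = c + b"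
proof (rule equivpI)
  show "reflp (\<lambda>(a::nn, b) (c, d). a + d = c + b)" by (auto intro: reflpI)
  show "symp (\<lambda>(a::nn, b) (c, d). a + d = c + b)" by (auto intro: sympI)
  show "transp (\<lambda>(a::nn, b) (c, d). a + d = c + b)"
  proof (rule transpI, clarsimp)
    fix a b c d e f :: nn
    assume "a + d = c + b" "c + f = e + d"
    then have "(a + f) + (c + d) = (e + b) + (c + d)" by (metis add.assoc add.commute)
    then show "a + f = e + b" by (rule nn_cancel)
  qed
qed

instantiation zz :: comm_ring_1
begin
lift_definition zero_zz :: zz is "(0, 0)" .
lift_definition one_zz :: zz is "(1, 0)" .
lift_definition plus_zz :: "zz \<Rightarrow> zz \<Rightarrow> zz" is "\<lambda>(a, b) (c, d). (a + c, b + d)"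
  by (clarsimp simp: algebra_simps) (metis add.assoc add.commute)
lift_definition uminus_zz :: "zz \<Rightarrow> zz" is "\<lambda>(a, b). (b, a)"
  by (clarsimp simp: algebra_simps)
lift_definition minus_zz :: "zz \<Rightarrow> zz \<Rightarrow> zz" is "\<lambda>(a, b) (c, d). (a + d, b + c)"
  by (clarsimp simp: algebra_simps) (metis add.assoc add.commute)
lift_definition times_zz :: "zz \<Rightarrow> zz \<Rightarrow> zz" is "\<lambda>(a, b) (c, d). (a * c + b * d, a * d + b * c)"
proof (clarsimp)
  fix s t u v w x y z :: nn
  assume "s + v = u + t" and "w + z = y + x"
  \<comment> \<open>The first equation is multiplied by \<open>w\<close> and, read backwards, by
    \<open>x\<close>; the second by \<open>u\<close> and, read backwards, by \<open>v\<close>. After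
    expansion the mixed products \<open>v * w\<close>, \<open>u * x\<close>, \<open>u * w\<close>
    and \<open>v * x\<close> occur on both sides and cancel.\<close>
  then have "(s + v) * w + (u + t) * x + u * (w + z) + v * (y + x) =
      (u + t) * w + (s + v) * x + u * (y + x) + v * (w + z)" by (simp add: ac_simps)
  then have "(s * w + t * x + (u * z + v * y)) + (v * w + u * x + u * w + v * x) =
      (u * y + v * z + (s * x + t * w)) + (v * w + u * x + u * w + v * x)"
    by (simp only: algebra_simps)
  then show "s * w + t * x + (u * z + v * y) = u * y + v * z + (s * x + t * w)"
    by (rule nn_cancel)
qed
instance
  by standard (transfer; clarsimp simp: algebra_simps)+
end

instantiation zz :: linordered_idom
begin
lift_definition less_eq_zz :: "zz \<Rightarrow> zz \<Rightarrow> bool" is "\<lambda>(a, b) (c, d). a + d \<le> c + b"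
proof (clarsimp)
  fix a b a' b' c d c' d' :: nn
  assume 1: "a + b' = a' + b" "c + d' = c' + d"
  have "a + d \<le> c + b \<longleftrightarrow> (a + d) + (b' + d') \<le> (c + b) + (b' + d')" by simp
  also have "\<dots> \<longleftrightarrow> (a + b') + (d + d') \<le> (c + d') + (b + b')" by (simp add: ac_simps)
  also have "\<dots> \<longleftrightarrow> (a' + d') + (b + d) \<le> (c' + b') + (b + d)" unfolding 1 by (simp add: ac_simps)
  finally show "a + d \<le> c + b \<longleftrightarrow> a' + d' \<le> c' + b'" by simp
qed
definition less_zz_def: "(a::zz) < b \<longleftrightarrow> a \<le> b \<and> \<not> b \<le> a"
definition zz_abs_def: "abs (a::zz) = (if a < 0 then - a else a)"
definition zz_sgn_def: "sgn (a::zz) = (if a = 0 then 0 else if 0 < a then 1 else - 1)"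
instance
proof
  fix a b c :: zz
  show "(a < b) = (a \<le> b \<and> \<not> b \<le> a)" by (rule less_zz_def)
  show "a \<le> a" by transfer auto
  show "a \<le> b \<Longrightarrow> b \<le> c \<Longrightarrow> a \<le> c"
  proof (transfer, clarsimp)
    fix a b c d e f :: nn
    assume "a + d \<le> c + b" "c + f \<le> e + d"
    then have "(a + d) + (c + f) \<le> (c + b) + (e + d)" by (rule add_mono)
    then have "(a + f) + (c + d) \<le> (e + b) + (c + d)" by (simp add: ac_simps)
    then show "a + f \<le> e + b" by simp
  qed
  show "a \<le> b \<Longrightarrow> b \<le> a \<Longrightarrow> a = b" by transfer (auto simp: ac_simps intro: antisym)
  show "a \<le> b \<or> b \<le> a" by transfer (auto simp: ac_simps)
  show "a \<le> b \<Longrightarrow> c + a \<le> c + b"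
  proof (transfer, clarsimp)
    fix a b c d e f :: nn
    assume "a + d \<le> c + b"
    then have "(a + d) + (e + f) \<le> (c + b) + (e + f)" by simp
    then show "e + a + (f + d) \<le> e + c + (f + b)" by (simp add: ac_simps)
  qed
  show "\<bar>a\<bar> = (if a < 0 then - a else a)" by (rule zz_abs_def)
  show "sgn a = (if a = 0 then 0 else if 0 < a then 1 else - 1)" by (rule zz_sgn_def)
  have less: "x < y \<longleftrightarrow> \<not> y \<le> x" for x y :: zz
    unfolding less_zz_def by transfer (auto simp: ac_simps)
  \<comment> \<open>Writing \<open>c' = d' + k\<close> with \<open>k > 0\<close> turns each side
    into \<open>k\<close> times a side of the first hypothesis plus the same multiple of
    \<open>d'\<close>.\<close>
  have key: "c' * a' + d' * b' + (c' * b + d' * a) < c' * a + d' * b + (c' * b' + d' * a')"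
    if 1: "a' + b < a + b'" and 2: "d' < c'" for a b a' b' c' d' :: nn
  proof -
    obtain k where k: "c' = d' + k" "k \<noteq> 0" using 2 by (auto simp: less_eq_nn_def less_nn_def)
    then have "0 < k" by (simp add: less_nn_def)
    then have lt: "k * (a' + b) + d' * (a + a' + b + b') < k * (a + b') + d' * (a + a' + b + b')"
      using 1 by (simp add: mult_strict_left_mono)
    have "c' * a' + d' * b' + (c' * b + d' * a) = k * (a' + b) + d' * (a + a' + b + b')"
      "c' * a + d' * b + (c' * b' + d' * a') = k * (a + b') + d' * (a + a' + b + b')"
      unfolding k by (simp_all add: algebra_simps)
    then show ?thesis using lt by simp
  qed
  show "a < b \<Longrightarrow> 0 < c \<Longrightarrow> c * a < c * b"
    unfolding less by (transfer, clarsimp simp: not_le) (meson key not_le)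
qed
end

lemma nn_numeral: "(2::nn) = 1 + 1" "(3::nn) = 1 + 1 + 1"
  by simp_all

lemmas nn_algebra = nn_numeral algebra_simps

type_synonym qq = "zz fract"

\<comment> \<open>Embeddings of the numbers into the integers and rationals of the model\<close>
lifting_forget nn.lifting

lift_definition zn :: "nn \<Rightarrow> zz" is "\<lambda>a. (a, 0)" .

lemma zn_hom: "zn 0 = 0" "zn 1 = 1" "zn (a + b) = zn a + zn b" "zn (a * b) = zn a * zn b"
  by (transfer; simp)+

lemma zn_le: "zn a \<le> zn b \<longleftrightarrow> a \<le> b"
  by transfer simp

text \<open>The negative case is offset by one to match the coding of rationals, where an odd
  component \<open>2k + 1\<close> stands for the numerator \<open>-(k + 1)\<close>.\<close>

lemma zz_cases: obtains p where "z = zn p" | m where "z = - zn (m + 1)"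
proof -
  have "\<exists>p m. z = zn p - zn m" by transfer auto
  then obtain p m where z: "z = zn p - zn m" by blast
  consider "m \<le> p" | "p + 1 \<le> m" using nn_discrete not_le by blast
  then show thesis
  proof cases
    case 1
    then obtain c where "p = m + c" by (auto simp: less_eq_nn_def)
    then show thesis using z that(1)[of c] by (simp add: zn_hom)
  next
    case 2
    then obtain c where "m = p + 1 + c" by (auto simp: less_eq_nn_def)
    then show thesis using z that(2)[of c] by (simp add: zn_hom)
  qed
qed

definition qn :: "nn \<Rightarrow> qq" where "qn a = Fract (zn a) 1"

lemma qn_hom [simp]: "qn 0 = 0" "qn 1 = 1" "qn (a + b) = qn a + qn b" "qn (a * b) = qn a * qn b"
  by (simp_all add: qn_def zn_hom Zero_fract_def One_fract_def)

lemma qn_numeral [simp]: "qn (numeral k) = numeral k"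
proof (induction k)
  case (Bit0 k)
  then show ?case by (simp only: numeral_Bit0 qn_hom)
next
  case (Bit1 k)
  then show ?case by (simp only: numeral_Bit1 qn_hom)
qed (simp only: numeral_One qn_hom)

lemma qn_le [simp]: "qn a \<le> qn b \<longleftrightarrow> a \<le> b"
  by (simp add: qn_def zn_le)

lemma qn_less [simp]: "qn a < qn b \<longleftrightarrow> a < b"
  using qn_le[of b a] by (simp add: not_le[symmetric] del: qn_le)

lemma qn_eq [simp]: "qn a = qn b \<longleftrightarrow> a = b"
  using qn_le[of a b] qn_le[of b a] by (auto simp: order.eq_iff simp del: qn_le)

lemma qn_nonneg [simp]: "0 \<le> qn a"
  using qn_le[of 0 a] by (simp del: qn_le)

lemma qn_Suc_pos [simp]: "0 < qn a + 1"
  using qn_nonneg[of a] by linarith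

lemma qq_cases:
  obtains p d where "v = qn p / (qn d + 1)" | m d where "v = - (qn m + 1) / (qn d + 1)"
proof -
  have "\<exists>a b. v = Fract a b \<and> 0 < b" by (induct v rule: fract_induct_pos) blast
  then obtain a b where Fract: "v = Fract a b" and b: "0 < b" by blast
  have "\<exists>k. b = zn k"
  proof (cases b rule: zz_cases)
    case (2 m)
    then show ?thesis using b zn_le[of 0 "m + 1"] by (simp add: zn_hom(1))
  qed blast
  then obtain k where "b = zn k" by blast
  moreover have "k \<noteq> 0" using b \<open>b = zn k\<close> by (auto simp: zn_hom)
  ultimately obtain d where d: "b = zn (d + 1)" using nn_pred by blast
  have v: "v = Fract a 1 / Fract b 1" using Fract by simp
  show thesis
  proof (cases a rule: zz_cases)
    case (1 p)
    then show thesis using v d that(1)[of p d] by (simp add: qn_def zn_hom One_fract_def)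
  next
    case (2 m)
    have "v = - (Fract (zn (m + 1)) 1 / Fract b 1)" using v 2 by simp
    then show thesis using d that(2)[of m d]
      by (simp add: qn_def zn_hom One_fract_def)
  qed
qed

text \<open>A positive fraction has the form \<open>(c + 1) / (d + 1)\<close>, so its own
  denominator is a suitable multiplier. This is a number of the model; relative to the standard
  numbers the field need not be Archimedean.\<close>

lemma qq_archimedean: "0 < (v::qq) \<Longrightarrow> \<exists>d. 1 \<le> v * (qn d + 1)"
proof (cases v rule: qq_cases)
  case (1 p d)
  assume "0 < v"
  then have "p \<noteq> 0" using 1 by auto
  then obtain c where "p = c + 1" using nn_pred by blast
  then have "v * (qn d + 1) = qn c + 1" using 1 qn_Suc_pos[of d] by (simp add: field_simps)
  then show ?thesis using qn_nonneg[of c] by (intro exI[of _ d]) simp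
next
  case (2 m d)
  assume "0 < v"
  moreover have "v \<le> 0" unfolding 2
    using qn_Suc_pos[of d] qn_Suc_pos[of m] by (intro divide_nonpos_pos) linarith+
  ultimately show ?thesis by simp
qed

section \<open>Numbers, rationals and reals of the model\<close>

locale countermodel =
  assumes hX0: "henkin_set X0"
begin

sublocale aca_model dm ap2 it
  by (rule henkin_set.aca_model_Q[OF hX0])

lemma nums_eq: "nums_C = dm N" "nums_p = pl" "nums_t = ml" "nums_z = zr" "nums_u = one"
  using hX0 by (simp_all add: nums_C_def nums_p_def nums_t_def nums_z_def nums_u_def nums_def)

lemma Rep_dom [simp]: "Rep_nn n \<in> dm N"
  using Rep_nn[of n] by (simp add: nums_eq)

lemma Rep_zr: "Rep_nn 0 = zr" and Rep_one: "Rep_nn 1 = one"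
  by (simp_all add: zero_nn.rep_eq one_nn.rep_eq nums_eq)

lemma Rep_arith: "pl (Rep_nn a) (Rep_nn b) = Rep_nn (a + b)" "ml (Rep_nn a) (Rep_nn b) = Rep_nn (a * b)"
  by (simp_all add: plus_nn.rep_eq times_nn.rep_eq nums_eq)

lemma Rep_succ: "ap2 succ (Rep_nn a) = Rep_nn (a + 1)"
  by (simp add: Rep_arith[symmetric] Rep_one)

lemma Rep_Abs: "x \<in> dm N \<Longrightarrow> Rep_nn (Abs_nn x) = x"
  by (simp add: Abs_nn_inverse nums_eq)

lemma ball_nn: "(\<forall>x\<in>dm N. P x) \<longleftrightarrow> (\<forall>n. P (Rep_nn n))"
  by (metis Rep_Abs Rep_dom)

lemma bex_nn: "(\<exists>x\<in>dm N. P x) \<longleftrightarrow> (\<exists>n. P (Rep_nn n))"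
  by (metis Rep_Abs Rep_dom)

lemma V_num_Rep: "V e (num k) = Rep_nn (of_nat k)"
  by (induction k) (simp_all add: Rep_zr Rep_succ add.commute)

lemma mo_iff: "mo (Rep_nn a) (Rep_nn b) = Rep_nn 0 \<longleftrightarrow> a \<le> b"
  by (simp add: mo_eq_zr_iff Rep_zr bex_nn Rep_arith Rep_nn_inject less_eq_nn_def)

definition p2 :: "nn \<Rightarrow> nn" where "p2 n = Abs_nn (pw (Rep_nn n))"

lemma Rep_p2: "pw (Rep_nn n) = Rep_nn (p2 n)"
  by (simp add: p2_def Rep_Abs)

lemmas Rep_simps = Rep_arith Rep_succ Rep_p2 ball_nn bex_nn V_num_Rep mo_iff Rep_nn_inject

lemma SAT_le: "SAT e (s \<^bold>\<le> t) \<longleftrightarrow> mo (V e s) (V e t) = Rep_nn 0"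
  and SAT_less: "SAT e (s \<^bold>< t) \<longleftrightarrow> mo (ap2 succ (V e s)) (V e t) = Rep_nn 0"
  by (simp_all add: leb_def lessb_def V_num_Rep del: num.simps)

lemma p2_0 [simp]: "p2 0 = 1"
  by (simp add: p2_def Rep_zr Rep_one[symmetric] Rep_nn_inverse)

lemma p2_Suc [simp]: "p2 (n + 1) = 2 * p2 n"
proof -
  have "Rep_nn (p2 (n + 1)) = ml (ap2 succ one) (pw (Rep_nn n))"
    by (simp add: Rep_p2[symmetric] Rep_succ[symmetric])
  also have "\<dots> = Rep_nn (2 * p2 n)"
    by (simp add: Rep_one[symmetric] Rep_succ Rep_p2 Rep_arith)
  finally show ?thesis by (simp add: Rep_nn_inject)
qed

text \<open>Induction over \<open>nn\<close> is available for arithmetical properties. The formula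
  \<open>\<phi>\<close> certifies that \<open>P\<close> is one, and evaluating it through
  \<open>Rep_simps\<close> is the extra obligation in each use.\<close>

lemma nn_induct:
  assumes \<phi>: "AR (Suc (length \<Gamma>)) \<phi>" "WF (N # \<Gamma>) \<phi>" "envs e \<Gamma>"
    and P: "\<And>n. SAT (Rep_nn n # e) \<phi> \<longleftrightarrow> P n"
    and z: "P 0" and s: "\<And>n. P n \<Longrightarrow> P (n + 1)"
  shows "P n"
proof -
  have "SAT (Rep_nn n # e) \<phi>"
  proof (rule induction_fm[OF _ \<phi>])
    show "SAT (zr # e) \<phi>" using P z by (simp add: Rep_zr[symmetric])
    fix x assume x: "x \<in> dm N" "SAT (x # e) \<phi>"
    obtain k where k: "x = Rep_nn k" using x(1) Rep_Abs by metis
    then show "SAT (ap2 succ x # e) \<phi>" using P s x(2) by (simp add: Rep_succ)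
  qed simp
  then show ?thesis using P by simp
qed

lemma p2_gt: "n < p2 n"
proof -
  have "n + 1 \<le> p2 n"
  proof (rule nn_induct[where P = "\<lambda>n. n + 1 \<le> p2 n" and n = n and \<phi> = "cn Succ \<cdot> lvl 0 \<^bold>\<le> pow2 (lvl 0)" and \<Gamma> = "[]" and e = "[]"])
    fix n assume "n + 1 \<le> p2 n"
    moreover have "1 \<le> p2 n" using calculation nn_nonneg[of n] by (meson add_increasing order_trans order_refl)
    ultimately have "(n + 1) + 1 \<le> p2 n + p2 n" by (rule add_mono)
    then show "n + 1 + 1 \<le> p2 (n + 1)" by (simp add: mult_2)
  qed (simp_all add: SAT_le Rep_simps)
  then show ?thesis by (simp add: nn_discrete)
qed

lemma p2_add: "p2 (n + i) = p2 n * p2 i"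
  by (rule nn_induct[where P = "\<lambda>i. p2 (n + i) = p2 n * p2 i" and n = i and \<phi> = "pow2 (lvl 0 \<^bold>+ lvl 1) \<doteq> pow2 (lvl 0) \<^bold>* pow2 (lvl 1)" and \<Gamma> = "[N]" and e = "[Rep_nn n]"])
    (simp_all add: Rep_simps add.assoc[symmetric] ac_simps(4-6))

lemma nn_parity: "\<exists>k. n = 2 * k \<or> n = 2 * k + (1::nn)"
proof (rule nn_induct[where P = "\<lambda>n. \<exists>k. n = 2 * k \<or> n = 2 * k + 1" and n = n and \<phi> = "\<^bold>\<exists>\<^sub>0k. lvl 0 \<doteq> num 2 \<^bold>* k \<^bold>\<or> lvl 0 \<doteq> num 2 \<^bold>* k \<^bold>+ num 1" and \<Gamma> = "[]" and e = "[]"])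
  fix n :: nn assume "\<exists>k. n = 2 * k \<or> n = 2 * k + 1"
  then obtain k where "n = 2 * k \<or> n = 2 * k + 1" by blast
  then have "n + 1 = 2 * k + 1 \<or> n + 1 = 2 * (k + 1)" by (auto simp: nn_algebra simp del: one_add_one)
  then show "\<exists>k. n + 1 = 2 * k \<or> n + 1 = 2 * k + 1" by blast
next
  show "\<exists>k. (0::nn) = 2 * k \<or> 0 = 2 * k + 1" by (intro exI[of _ 0]) simp
qed (simp_all add: Rep_simps del: num.simps)

section \<open>Cantor's pairing function\<close>

definition pairP :: "nn \<Rightarrow> nn \<Rightarrow> nn \<Rightarrow> bool" where
  "pairP q a b \<longleftrightarrow> 2 * q = (a + b) * (a + b) + (3 * a + b)"

text \<open>The induction walks along the diagonals: the code after that of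
  \<open>(a, c + 1)\<close> belongs to \<open>(a + 1, c)\<close>, and after \<open>(a, 0)\<close>
  the next diagonal starts at \<open>(0, a + 1)\<close>.\<close>

lemma pairP_ex: "\<exists>a b. pairP q a b"
proof (rule nn_induct[where P = "\<lambda>q. \<exists>a b. pairP q a b" and n = q and \<phi> = "\<^bold>\<exists>\<^sub>0a. \<^bold>\<exists>\<^sub>0b. pairb (lvl 0) a b" and \<Gamma> = "[]" and e = "[]"])
  fix q assume "\<exists>a b. pairP q a b"
  then obtain a b where ab: "pairP q a b" by blast
  consider "b = 0" | c where "b = c + 1" using nn_pred by blast
  then show "\<exists>a b. pairP (q + 1) a b"
  proof cases
    case 1
    then have "pairP (q + 1) 0 (a + 1)" using ab by (simp add: pairP_def nn_algebra del: one_add_one)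
    then show ?thesis by blast
  next
    case 2
    then have "pairP (q + 1) (a + 1) c" using ab by (simp add: pairP_def nn_algebra del: one_add_one)
    then show ?thesis by blast
  qed
next
  show "\<exists>a b. pairP 0 a b" by (intro exI[of _ 0]) (simp add: pairP_def)
qed (simp_all add: Rep_simps pairb_def pairP_def del: num.simps)

lemma pairP_ex_code: "\<exists>q. pairP q a b"
proof -
  have "\<exists>q. 2 * q = s * s + s" for s :: nn
  proof (rule nn_induct[where P = "\<lambda>s. \<exists>q. 2 * q = s * s + s" and n = s and \<phi> = "\<^bold>\<exists>\<^sub>0q. num 2 \<^bold>* q \<doteq> lvl 0 \<^bold>* lvl 0 \<^bold>+ lvl 0" and \<Gamma> = "[]" and e = "[]"])
    fix s :: nn assume "\<exists>q. 2 * q = s * s + s"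
    then obtain q where "2 * q = s * s + s" by blast
    then have "2 * (q + s + 1) = (s + 1) * (s + 1) + (s + 1)" by (simp add: nn_algebra del: one_add_one)
    then show "\<exists>q. 2 * q = (s + 1) * (s + 1) + (s + 1)" by blast
  qed (simp_all add: Rep_simps del: num.simps)
  then obtain q where "2 * q = (a + b) * (a + b) + (a + b)" by blast
  then have "pairP (q + a) a b" by (simp add: pairP_def nn_algebra del: one_add_one)
  then show ?thesis by blast
qed

text \<open>Every code on the diagonal \<open>s = a + b\<close> lies below the first one on the
  next, because \<open>2q + 2b + 2 = (s + 1)(s + 1) + (s + 1)\<close>. So the code determines the
  diagonal, and on it \<open>2q\<close> determines \<open>a\<close>.\<close>

lemma pairP_unique:
  assumes "pairP q a b" "pairP q a' b'"
  shows "a = a' \<and> b = b'"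
proof -
  have less: False if h: "pairP q a b" "pairP q a' b'" "a + b < a' + b'" for a b a' b'
  proof -
    have le: "a + b + 1 \<le> a' + b'" using h by (simp add: nn_discrete)
    have "2 * q + 2 * b + 2 = (a + b + 1) * (a + b + 1) + (a + b + 1)"
      using h(1) by (simp add: pairP_def nn_algebra del: one_add_one)
    also have "\<dots> \<le> (a' + b') * (a' + b') + (a' + b')"
      using add_mono[OF mult_mono[OF le le] le] by simp
    also have "\<dots> \<le> (a' + b') * (a' + b') + (a' + b') + 2 * a'" by simp
    also have "\<dots> = 2 * q" using h(2) by (simp add: pairP_def nn_algebra del: one_add_one)
    finally have "2 * q + (2 * b + 2) \<le> 2 * q + 0" by (simp add: add.assoc)
    then have "2 * b + 2 \<le> 0" by (simp only: add_le_cancel_left)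
    moreover have "0 < 2 * b + (2::nn)" by (simp add: add_nonneg_pos)
    ultimately show False by simp
  qed
  have s: "a + b = a' + b'" using less assms by (meson linorder_neqE)
  have "2 * q = (a + b) * (a + b) + (a + b) + 2 * a" "2 * q = (a' + b') * (a' + b') + (a' + b') + 2 * a'"
    using assms by (simp_all add: pairP_def nn_algebra del: one_add_one)
  then have "2 * a = 2 * a'" unfolding s by simp
  then have "a = a'"
    using mult_strict_left_mono[of a a' 2] mult_strict_left_mono[of a' a 2] by (cases a a' rule: linorder_cases) auto
  then show ?thesis using s by simp
qed

end

section \<open>Typing and arithmetical complexity of the defined predicates\<close>

lemma WF_pairb [simp]: "WF \<Gamma> (pairb q a b) \<longleftrightarrow> HT \<Gamma> q N \<and> HT \<Gamma> a N \<and> HT \<Gamma> b N"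
  by (auto simp: pairb_def simp del: num.simps)

lemma WF_ratb [simp]:
  "stab (length \<Gamma>) q \<Longrightarrow> stab (length \<Gamma>) p \<Longrightarrow> stab (length \<Gamma>) m \<Longrightarrow> stab (length \<Gamma>) d \<Longrightarrow>
     WF \<Gamma> (ratb q p m d) \<longleftrightarrow> HT \<Gamma> q N \<and> HT \<Gamma> p N \<and> HT \<Gamma> m N \<and> HT \<Gamma> d N"
  by (auto simp: ratb_def simp del: num.simps)

lemma WF_rat_err [simp]:
  "stab (length \<Gamma>) q \<Longrightarrow> stab (length \<Gamma>) r \<Longrightarrow> stab (length \<Gamma>) n \<Longrightarrow>
     WF \<Gamma> (rat_less_err q r n) \<longleftrightarrow> HT \<Gamma> q N \<and> HT \<Gamma> r N \<and> HT \<Gamma> n N"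
  "stab (length \<Gamma>) q \<Longrightarrow> stab (length \<Gamma>) r \<Longrightarrow> stab (length \<Gamma>) n \<Longrightarrow>
     WF \<Gamma> (rat_le_err q r n) \<longleftrightarrow> HT \<Gamma> q N \<and> HT \<Gamma> r N \<and> HT \<Gamma> n N"
  by (auto simp: rat_less_err_def rat_le_err_def simp del: num.simps)

lemma AR_rat [simp]: "AR k (pairb q a b)" "AR k (ratb q p m d)" "AR k (rat_less_err q r n)" "AR k (rat_le_err q r n)"
  by (simp_all add: pairb_def ratb_def rat_less_err_def rat_le_err_def)

lemma AR_real [simp]: "AR k (is_real x)" "AR k (real_eq x y)" "AR k (real_le x y)"
  by (simp_all add: is_real_def real_eq_def real_le_def)

lemma AR_pt [simp]: "AR k (pt X x)" "AR k (pt_eq X x y)"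
  by (cases X; simp)+

lemma stab_real [simp]: "stab n real_zero" "stab n real_one"
  by (simp_all add: real_zero_def real_one_def)

lemma HT_real [simp]: "HT \<Gamma> real_zero \<tau> \<longleftrightarrow> \<tau> = T1" "HT \<Gamma> real_one \<tau> \<longleftrightarrow> \<tau> = T1"
  by (auto simp: real_zero_def real_one_def)

lemma HT_apN: "HT \<Gamma> x T1 \<Longrightarrow> HT \<Gamma> (x \<cdot> n) N \<longleftrightarrow> HT \<Gamma> n N"
  by (auto simp: HT_def ap_def dest: has_type_unique)

lemma WF_real [simp]:
  "stab (length \<Gamma>) x \<Longrightarrow> HT \<Gamma> x T1 \<Longrightarrow> WF \<Gamma> (is_real x)"
  "stab (length \<Gamma>) x \<Longrightarrow> HT \<Gamma> x T1 \<Longrightarrow> stab (length \<Gamma>) y \<Longrightarrow> HT \<Gamma> y T1 \<Longrightarrow> WF \<Gamma> (real_eq x y)"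
  "stab (length \<Gamma>) x \<Longrightarrow> HT \<Gamma> x T1 \<Longrightarrow> stab (length \<Gamma>) y \<Longrightarrow> HT \<Gamma> y T1 \<Longrightarrow> WF \<Gamma> (real_le x y)"
  by (simp_all add: is_real_def real_eq_def real_le_def HT_apN del: HT_ap)

lemma WF_pt [simp]:
  "stab (length \<Gamma>) x \<Longrightarrow> HT \<Gamma> x T1 \<Longrightarrow> WF \<Gamma> (pt X x)"
  "stab (length \<Gamma>) x \<Longrightarrow> HT \<Gamma> x T1 \<Longrightarrow> stab (length \<Gamma>) y \<Longrightarrow> HT \<Gamma> y T1 \<Longrightarrow> WF \<Gamma> (pt_eq X x y)"
  by (cases X; simp add: HT_apN del: HT_ap num.simps)+

context countermodel
begin

lemmas [simp del] = ml_succ pl_succ mo_succ succ_ml succ_pl pw_succ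

subsection \<open>Codes of rational numbers\<close>

definition ratP :: "nn \<Rightarrow> nn \<Rightarrow> nn \<Rightarrow> nn \<Rightarrow> bool" where
  "ratP q p m d \<longleftrightarrow> m = 0 \<and> pairP q (2 * p) d \<or> p = 0 \<and> (\<exists>k. m = k + 1 \<and> pairP q (2 * k + 1) d)"

lemma nn_double_inj: "2 * a = 2 * b \<Longrightarrow> a = (b::nn)"
  using mult_strict_left_mono[of a b 2] mult_strict_left_mono[of b a 2] by (cases a b rule: linorder_cases) auto

lemma nn_even_odd: "2 * a \<noteq> 2 * b + (1::nn)"
proof
  assume h: "2 * a = 2 * b + (1::nn)"
  show False
  proof (cases "a \<le> b")
    case True
    then have "2 * a \<le> 2 * b" by (simp add: mult_left_mono)
    then show ?thesis using h by (simp add: not_le[symmetric])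
  next
    case False
    then have "b + 1 \<le> a" by (simp add: nn_discrete[symmetric])
    then have "2 * (b + 1) \<le> 2 * a" by (simp add: mult_left_mono del: distrib_left_numeral)
    then show ?thesis unfolding h by simp
  qed
qed

lemma ratP_ex: "\<exists>p m d. ratP q p m d"
proof -
  obtain a d where ad: "pairP q a d" using pairP_ex by blast
  obtain k where "a = 2 * k \<or> a = 2 * k + 1" using nn_parity by blast
  then show ?thesis using ad unfolding ratP_def by blast
qed

lemma ratP_unique:
  assumes "ratP q p m d" "ratP q p' m' d'"
  shows "p = p' \<and> m = m' \<and> d = d'"
proof -
  have code: "\<exists>a. pairP q a d \<and> (m = 0 \<and> a = 2 * p \<or> p = 0 \<and> (\<exists>k. m = k + 1 \<and> a = 2 * k + 1))"
    if "ratP q p m d" for p m d using that unfolding ratP_def by blast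
  obtain a a' where "pairP q a d" "m = 0 \<and> a = 2 * p \<or> p = 0 \<and> (\<exists>k. m = k + 1 \<and> a = 2 * k + 1)"
    and "pairP q a' d'" "m' = 0 \<and> a' = 2 * p' \<or> p' = 0 \<and> (\<exists>k. m' = k + 1 \<and> a' = 2 * k + 1)"
    using code[OF assms(1)] code[OF assms(2)] by blast
  moreover have "a = a'" "d = d'" using pairP_unique calculation by blast+
  ultimately show ?thesis
    using nn_double_inj nn_even_odd by (metis add_right_cancel)
qed

definition vq :: "nn \<Rightarrow> qq" where
  "vq q = (THE v. \<exists>p m d. ratP q p m d \<and> v = (qn p - qn m) / (qn d + 1))"

lemma vq_eq: "ratP q p m d \<Longrightarrow> vq q = (qn p - qn m) / (qn d + 1)"
  unfolding vq_def using ratP_unique by (intro the_equality) blast+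

text \<open>Makes quantification over codes a quantification over all of \<open>qq\<close>; a bit
  sequence indexed by codes can therefore hold a whole cut.\<close>

lemma vq_surj: "\<exists>q. vq q = v"
proof (cases v rule: qq_cases)
  case (1 p d)
  obtain q where "pairP q (2 * p) d" using pairP_ex_code by blast
  then have "ratP q p 0 d" by (simp add: ratP_def)
  then have "vq q = v" using 1 by (simp add: vq_eq)
  then show ?thesis by blast
next
  case (2 m d)
  obtain q where "pairP q (2 * m + 1) d" using pairP_ex_code by blast
  then have "ratP q 0 (m + 1) d" by (simp add: ratP_def)
  then have "vq q = v" using 2 by (simp add: vq_eq)
  then show ?thesis by blast
qed

definition iv :: "nn \<Rightarrow> qq" where "iv n = 1 / qn (p2 n)"

lemma qn_p2_pos: "0 < qn (p2 n)"
  using le_less_trans[OF nn_nonneg p2_gt] qn_less[of 0 "p2 n"] by (simp del: qn_less)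

lemma iv_pos [simp]: "0 < iv n"
  by (simp add: iv_def qn_p2_pos)

lemma iv_Suc: "iv (n + 1) = iv n / 2"
  by (simp add: iv_def)

lemma iv_add: "iv (n + i) = iv n * iv i"
  by (simp add: iv_def p2_add)

lemma iv_0 [simp]: "iv 0 = 1"
  by (simp add: iv_def)

lemma iv_le: "iv (n + i) \<le> iv n"
proof -
  have "0 \<le> i" by simp
  then have "1 \<le> p2 i" using p2_gt[of i] by (metis le_less_trans nn_discrete add_0)
  then have "1 \<le> qn (p2 i)" using qn_le[of 1 "p2 i"] by (simp del: qn_le)
  then have "iv i \<le> 1" by (simp add: iv_def)
  then show ?thesis using iv_pos[of n] by (simp add: iv_add mult_left_le)
qed

lemma iv_small:
  assumes "0 < v" shows "\<exists>n. iv n < v"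
proof -
  obtain d where d: "1 \<le> v * (qn d + 1)" using qq_archimedean assms by blast
  have "qn (d + 1) < qn (p2 (d + 1))" by (simp only: qn_less p2_gt)
  then have "v * (qn d + 1) < v * qn (p2 (d + 1))" using assms by simp
  then have "1 < v * qn (p2 (d + 1))" using d by linarith
  then have "iv (d + 1) < v" using qn_p2_pos by (simp add: iv_def divide_less_eq del: p2_Suc)
  then show ?thesis by blast
qed

text \<open>The difference of the sides on the right is that of the sides on the left divided by
  \<open>D * D' * E\<close>, which is positive. The value \<open>c = 1\<close> serves the Cauchy
  condition, \<open>c = 2\<close> equality and order of reals.\<close>

lemma frac_cmp:
  fixes P M D P' M' D' E :: qq
  assumes "0 < D" "0 < D'" "0 < E"
  shows "E * (P * D' + M' * D) < E * (P' * D + M * D') + c * (D * D') \<longleftrightarrow>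
      (P - M) / D < (P' - M') / D' + c * (1 / E)"
    and "E * (P * D' + M' * D) \<le> E * (P' * D + M * D') + c * (D * D') \<longleftrightarrow>
      (P - M) / D \<le> (P' - M') / D' + c * (1 / E)"
proof -
  have e: "((P' - M') / D' + c * (1 / E)) - (P - M) / D =
      (E * (P' * D + M * D') + c * (D * D') - E * (P * D' + M' * D)) / (D * D' * E)"
    using assms by (simp add: field_simps)
  have pos: "0 < D * D' * E" using assms by simp
  then have np: "\<not> D * D' * E < 0" by (rule less_not_sym)
  have "(P - M) / D < (P' - M') / D' + c * (1 / E) \<longleftrightarrow> 0 < ((P' - M') / D' + c * (1 / E)) - (P - M) / D"
    by simp
  then show "E * (P * D' + M' * D) < E * (P' * D + M * D') + c * (D * D') \<longleftrightarrow>
      (P - M) / D < (P' - M') / D' + c * (1 / E)"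
    unfolding e using pos np by (simp only: zero_less_divide_iff) simp
  have "(P - M) / D \<le> (P' - M') / D' + c * (1 / E) \<longleftrightarrow> 0 \<le> ((P' - M') / D' + c * (1 / E)) - (P - M) / D"
    by simp
  then show "E * (P * D' + M' * D) \<le> E * (P' * D + M * D') + c * (D * D') \<longleftrightarrow>
      (P - M) / D \<le> (P' - M') / D' + c * (1 / E)"
    unfolding e using pos np by (simp only: zero_le_divide_iff not_le[symmetric]) (simp add: not_le)
qed

lemma SAT_pairb:
  "V e q = Rep_nn q' \<Longrightarrow> V e a = Rep_nn a' \<Longrightarrow> V e b = Rep_nn b' \<Longrightarrow> SAT e (pairb q a b) \<longleftrightarrow> pairP q' a' b'"
  by (simp add: pairb_def pairP_def Rep_simps del: num.simps)

lemma SAT_ratb: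
  assumes "V e q = Rep_nn q'" "V e p = Rep_nn p'" "V e m = Rep_nn m'" "V e d = Rep_nn d'"
    "stab (length e) q" "stab (length e) p" "stab (length e) m" "stab (length e) d"
  shows "SAT e (ratb q p m d) \<longleftrightarrow> ratP q' p' m' d'"
proof -
  have "SAT (Rep_nn k # e) (pairb q (cn Succ \<cdot> (num 2 \<^bold>* lvl (length e))) d) \<longleftrightarrow> pairP q' (2 * k + 1) d'" for k
    using assms by (intro SAT_pairb) (simp_all add: Rep_simps del: num.simps)
  moreover have "SAT e (pairb q (num 2 \<^bold>* p) d) \<longleftrightarrow> pairP q' (2 * p') d'"
    using assms by (intro SAT_pairb) (simp_all add: Rep_simps del: num.simps)
  ultimately show ?thesis using assms
    by (simp add: ratb_def ratP_def Rep_simps del: num.simps)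
qed

text \<open>Every number decodes to a fraction, and all decodings give the value \<open>vq\<close>;
  the six existential quantifiers thus collapse to the inequality of the values.\<close>

lemma SAT_rat_less_err:
  assumes "V e q = Rep_nn a" "V e r = Rep_nn b" "V e n = Rep_nn c"
    "stab (length e) q" "stab (length e) r" "stab (length e) n"
  shows "SAT e (rat_less_err q r n) \<longleftrightarrow> vq a < vq b + iv c"
proof -
  have "SAT e (rat_less_err q r n) \<longleftrightarrow> (\<exists>p m d p' m' d'. ratP a p m d \<and> ratP b p' m' d' \<and>
      p2 c * (p * (d' + 1) + m' * (d + 1)) + 1 \<le> p2 c * (p' * (d + 1) + m * (d' + 1)) + (d + 1) * (d' + 1))"
    using assms by (simp add: rat_less_err_def SAT_ratb SAT_less Rep_simps del: num.simps)
  also have "\<dots> \<longleftrightarrow> (\<exists>p m d p' m' d'. ratP a p m d \<and> ratP b p' m' d' \<and> vq a < vq b + iv c)"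
  proof -
    have "p2 c * (p * (d' + 1) + m' * (d + 1)) + 1 \<le> p2 c * (p' * (d + 1) + m * (d' + 1)) + (d + 1) * (d' + 1)
        \<longleftrightarrow> vq a < vq b + iv c" if "ratP a p m d" "ratP b p' m' d'" for p m d p' m' d'
    proof -
      have "p2 c * (p * (d' + 1) + m' * (d + 1)) + 1 \<le> p2 c * (p' * (d + 1) + m * (d' + 1)) + (d + 1) * (d' + 1)
        \<longleftrightarrow> qn (p2 c * (p * (d' + 1) + m' * (d + 1))) < qn (p2 c * (p' * (d + 1) + m * (d' + 1)) + (d + 1) * (d' + 1))"
        by (simp only: qn_less nn_discrete)
      also have "\<dots> \<longleftrightarrow> vq a < vq b + iv c"
        using frac_cmp(1)[of "qn d + 1" "qn d' + 1" "qn (p2 c)" "qn p" "qn m'" "qn p'" "qn m" 1] qn_p2_pos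
        by (simp add: vq_eq[OF that(1)] vq_eq[OF that(2)] iv_def)
      finally show ?thesis .
    qed
    then show ?thesis by blast
  qed
  also have "\<dots> \<longleftrightarrow> vq a < vq b + iv c" using ratP_ex by blast
  finally show ?thesis .
qed

lemma SAT_rat_le_err:
  assumes "V e q = Rep_nn a" "V e r = Rep_nn b" "V e n = Rep_nn c"
    "stab (length e) q" "stab (length e) r" "stab (length e) n"
  shows "SAT e (rat_le_err q r n) \<longleftrightarrow> vq a \<le> vq b + 2 * iv c"
proof -
  have "SAT e (rat_le_err q r n) \<longleftrightarrow> (\<exists>p m d p' m' d'. ratP a p m d \<and> ratP b p' m' d' \<and>
      p2 c * (p * (d' + 1) + m' * (d + 1)) \<le> p2 c * (p' * (d + 1) + m * (d' + 1)) + 2 * ((d + 1) * (d' + 1)))"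
    using assms by (simp add: rat_le_err_def SAT_ratb SAT_le Rep_simps del: num.simps)
  also have "\<dots> \<longleftrightarrow> (\<exists>p m d p' m' d'. ratP a p m d \<and> ratP b p' m' d' \<and> vq a \<le> vq b + 2 * iv c)"
  proof -
    have "p2 c * (p * (d' + 1) + m' * (d + 1)) \<le> p2 c * (p' * (d + 1) + m * (d' + 1)) + 2 * ((d + 1) * (d' + 1))
        \<longleftrightarrow> vq a \<le> vq b + 2 * iv c" if "ratP a p m d" "ratP b p' m' d'" for p m d p' m' d'
    proof -
      have "p2 c * (p * (d' + 1) + m' * (d + 1)) \<le> p2 c * (p' * (d + 1) + m * (d' + 1)) + 2 * ((d + 1) * (d' + 1))
        \<longleftrightarrow> qn (p2 c * (p * (d' + 1) + m' * (d + 1))) \<le> qn (p2 c * (p' * (d + 1) + m * (d' + 1)) + 2 * ((d + 1) * (d' + 1)))"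
        by (simp only: qn_le)
      also have "\<dots> \<longleftrightarrow> vq a \<le> vq b + 2 * iv c"
        using frac_cmp(2)[of "qn d + 1" "qn d' + 1" "qn (p2 c)" "qn p" "qn m'" "qn p'" "qn m" 2] qn_p2_pos
        by (simp add: vq_eq[OF that(1)] vq_eq[OF that(2)] iv_def)
      finally show ?thesis .
    qed
    then show ?thesis by blast
  qed
  also have "\<dots> \<longleftrightarrow> vq a \<le> vq b + 2 * iv c" using ratP_ex by blast
  finally show ?thesis .
qed


subsection \<open>Points of the three spaces\<close>

definition fn :: "tm set \<Rightarrow> nn \<Rightarrow> nn" where "fn x n = Abs_nn (ap2 x (Rep_nn n))"
definition vr :: "tm set \<Rightarrow> nn \<Rightarrow> qq" where "vr x n = vq (fn x n)"

lemma Rep_fn: "x \<in> dm T1 \<Longrightarrow> ap2 x (Rep_nn n) = Rep_nn (fn x n)"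
  by (simp add: fn_def Rep_Abs app_dom[of x N N])

lemma fn_ext: "x \<in> dm T1 \<Longrightarrow> y \<in> dm T1 \<Longrightarrow> (\<And>n. fn x n = fn y n) \<Longrightarrow> x = y"
  by (rule dom_ext[of x N N y]) (metis Rep_Abs Rep_fn)+

definition isR :: "(nn \<Rightarrow> qq) \<Rightarrow> bool" where
  "isR s \<longleftrightarrow> (\<forall>n i. s n < s (n + i) + iv n \<and> s (n + i) < s n + iv n)"
definition eqR :: "(nn \<Rightarrow> qq) \<Rightarrow> (nn \<Rightarrow> qq) \<Rightarrow> bool" where
  "eqR s t \<longleftrightarrow> (\<forall>n. s n \<le> t n + 2 * iv n \<and> t n \<le> s n + 2 * iv n)"
definition leR :: "(nn \<Rightarrow> qq) \<Rightarrow> (nn \<Rightarrow> qq) \<Rightarrow> bool" where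
  "leR s t \<longleftrightarrow> (\<forall>n. s n \<le> t n + 2 * iv n)"

lemma SAT_is_real:
  "V e x \<in> dm T1 \<Longrightarrow> stab (length e) x \<Longrightarrow> SAT e (is_real x) \<longleftrightarrow> isR (vr (V e x))"
  by (simp add: is_real_def isR_def Rep_simps vr_def Rep_fn SAT_rat_less_err[of _ _ "fn (V e x) n" _ "fn (V e x) m" _ k for n m k])

lemma SAT_real_eq:
  "V e x \<in> dm T1 \<Longrightarrow> stab (length e) x \<Longrightarrow> V e y \<in> dm T1 \<Longrightarrow> stab (length e) y \<Longrightarrow>
     SAT e (real_eq x y) \<longleftrightarrow> eqR (vr (V e x)) (vr (V e y))"
  by (simp add: real_eq_def eqR_def Rep_simps vr_def Rep_fn SAT_rat_le_err)

lemma SAT_real_le: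
  "V e x \<in> dm T1 \<Longrightarrow> stab (length e) x \<Longrightarrow> V e y \<in> dm T1 \<Longrightarrow> stab (length e) y \<Longrightarrow>
     SAT e (real_le x y) \<longleftrightarrow> leR (vr (V e x)) (vr (V e y))"
  by (simp add: real_le_def leR_def Rep_simps vr_def Rep_fn SAT_rat_le_err)

lemma V_real_const:
  "V e real_zero \<in> dm T1" "V e real_one \<in> dm T1"
  "vr (V e real_zero) = (\<lambda>_. 0)" "vr (V e real_one) = (\<lambda>_. 1)"
proof -
  have c: "kc N N \<in> dm (N \<rightarrow>\<^sub>t N \<rightarrow>\<^sub>t N)" by (rule cn_dom)
  show d: "V e real_zero \<in> dm T1" "V e real_one \<in> dm T1"
    by (simp_all add: real_zero_def real_one_def V_num_Rep app_dom[OF c] del: num.simps)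
  have "ratP 0 0 0 0" by (simp add: ratP_def pairP_def)
  then have "vq 0 = 0" by (simp add: vq_eq)
  moreover have "fn (V e real_zero) n = 0" for n
    by (simp add: fn_def real_zero_def V_num_Rep Rep_nn_inverse del: num.simps)
  ultimately show "vr (V e real_zero) = (\<lambda>_. 0)" by (simp add: vr_def fun_eq_iff)
  have "ratP 5 1 0 0" by (simp add: ratP_def pairP_def)
  then have "vq 5 = 1" by (simp add: vq_eq)
  moreover have "fn (V e real_one) n = 5" for n
    by (simp add: fn_def real_one_def V_num_Rep Rep_nn_inverse del: num.simps)
  ultimately show "vr (V e real_one) = (\<lambda>_. 1)" by (simp add: vr_def fun_eq_iff)
qed

primrec ptM :: "space \<Rightarrow> tm set \<Rightarrow> bool" where
  "ptM Unit_Interval x \<longleftrightarrow> isR (vr x) \<and> leR (\<lambda>_. 0) (vr x) \<and> leR (vr x) (\<lambda>_. 1)"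
| "ptM Reals x \<longleftrightarrow> isR (vr x)"
| "ptM Cantor x \<longleftrightarrow> (\<forall>n. fn x n = 0 \<or> fn x n = 1)"

primrec eqM :: "space \<Rightarrow> tm set \<Rightarrow> tm set \<Rightarrow> bool" where
  "eqM Unit_Interval x y \<longleftrightarrow> eqR (vr x) (vr y)"
| "eqM Reals x y \<longleftrightarrow> eqR (vr x) (vr y)"
| "eqM Cantor x y \<longleftrightarrow> x = y"

lemma SAT_pt:
  "V e x \<in> dm T1 \<Longrightarrow> stab (length e) x \<Longrightarrow> SAT e (pt X x) \<longleftrightarrow> ptM X (V e x)"
  by (cases X) (simp_all add: SAT_is_real SAT_real_le V_real_const Rep_simps Rep_fn del: num.simps)

lemma SAT_pt_eq:
  "V e x \<in> dm T1 \<Longrightarrow> stab (length e) x \<Longrightarrow> V e y \<in> dm T1 \<Longrightarrow> stab (length e) y \<Longrightarrow>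
     SAT e (pt_eq X x y) \<longleftrightarrow> eqM X (V e x) (V e y)"
  by (cases X) (simp_all add: SAT_real_eq del: heq.simps)

end

context aca_model
begin

section \<open>Uniform search for number witnesses\<close>

lemma lam3:
  assumes "HT (\<rho>' # \<rho> # \<sigma> # \<Gamma>) s \<tau>" "envs e \<Gamma>"
  obtains f where "f \<in> dom (\<sigma> \<rightarrow>\<^sub>t \<rho> \<rightarrow>\<^sub>t \<rho>' \<rightarrow>\<^sub>t \<tau>)"
    "\<And>x y z. x \<in> dom \<sigma> \<Longrightarrow> y \<in> dom \<rho> \<Longrightarrow> z \<in> dom \<rho>' \<Longrightarrow> f \<bullet> x \<bullet> y \<bullet> z = V (z # y # x # e) s"
proof -
  obtain t1 where t1: "has_type (\<rho> # \<sigma> # \<Gamma>) t1 (\<rho>' \<rightarrow>\<^sub>t \<tau>)"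
    "\<forall>e x. envs e (\<rho> # \<sigma> # \<Gamma>) \<longrightarrow> x \<in> dom \<rho>' \<longrightarrow> ev e t1 \<bullet> x = ev (x # e) (s (Suc (Suc (Suc (length \<Gamma>)))))"
    using abstraction assms(1) unfolding HT_def by fastforce
  have "HT (\<rho> # \<sigma> # \<Gamma>) (\<lambda>_. t1) (\<rho>' \<rightarrow>\<^sub>t \<tau>)" using t1(1) by (simp add: HT_def)
  then obtain f where f: "f \<in> dom (\<sigma> \<rightarrow>\<^sub>t \<rho> \<rightarrow>\<^sub>t \<rho>' \<rightarrow>\<^sub>t \<tau>)"
    "\<And>x y. x \<in> dom \<sigma> \<Longrightarrow> y \<in> dom \<rho> \<Longrightarrow> f \<bullet> x \<bullet> y = V (y # x # e) (\<lambda>_. t1)"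
    using assms(2) by (rule lam2) blast
  show thesis
  proof (rule that[OF f(1)])
    fix x y z assume xyz: "x \<in> dom \<sigma>" "y \<in> dom \<rho>" "z \<in> dom \<rho>'"
    then show "f \<bullet> x \<bullet> y \<bullet> z = V (z # y # x # e) s"
      using f(2)[OF xyz(1,2)] t1(2)[rule_format, of "y # x # e" z] assms(2)
      by (simp add: V_def list_all2_lengthD)
  qed
qed

lemma comprehension3:
  assumes "AR (Suc (Suc (Suc (length \<Gamma>)))) \<phi>" "WF (\<rho>' # \<rho> # \<sigma> # \<Gamma>) \<phi>" "envs e \<Gamma>"
  obtains f where "f \<in> dom (\<sigma> \<rightarrow>\<^sub>t \<rho> \<rightarrow>\<^sub>t \<rho>' \<rightarrow>\<^sub>t N)"
    "\<And>x y z. x \<in> dom \<sigma> \<Longrightarrow> y \<in> dom \<rho> \<Longrightarrow> z \<in> dom \<rho>' \<Longrightarrow>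
       f \<bullet> x \<bullet> y \<bullet> z = (if SAT (z # y # x # e) \<phi> then zr else one)"
proof -
  obtain t where t: "has_type (\<rho>' # \<rho> # \<sigma> # \<Gamma>) t N" "\<forall>e. envs e (\<rho>' # \<rho> # \<sigma> # \<Gamma>) \<longrightarrow>
      ev e t = (if sat e (\<phi> (Suc (Suc (Suc (length \<Gamma>))))) then zr else one)"
    using comprehension_term assms(1,2) unfolding WF_def AR_def by fastforce
  have "HT (\<rho>' # \<rho> # \<sigma> # \<Gamma>) (\<lambda>_. t) N" using t(1) by (simp add: HT_def)
  then obtain f where f: "f \<in> dom (\<sigma> \<rightarrow>\<^sub>t \<rho> \<rightarrow>\<^sub>t \<rho>' \<rightarrow>\<^sub>t N)"
    "\<And>x y z. x \<in> dom \<sigma> \<Longrightarrow> y \<in> dom \<rho> \<Longrightarrow> z \<in> dom \<rho>' \<Longrightarrow> f \<bullet> x \<bullet> y \<bullet> z = V (z # y # x # e) (\<lambda>_. t)"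
    using assms(3) by (rule lam3) blast
  show thesis
    by (rule that[OF f(1)]) (use f(2) t(2) assms(3) in \<open>simp add: V_def SAT_def list_all2_lengthD\<close>)
qed

text \<open>\<open>mu_fun\<close> is applied to the characteristic function of \<open>\<phi>\<close>
  in its last variable. As \<open>x\<close> may have any type, this yields witnesses as a functional
  of a point and a precision; nothing is claimed where no witness exists.\<close>

lemma search:
  assumes "AR (Suc (Suc (Suc (length \<Gamma>)))) \<phi>" "WF (N # N # \<sigma> # \<Gamma>) \<phi>" "envs e \<Gamma>"
  obtains f where "f \<in> dom (\<sigma> \<rightarrow>\<^sub>t T1)"
    "\<And>x n p. x \<in> dom \<sigma> \<Longrightarrow> n \<in> dom N \<Longrightarrow> p \<in> dom N \<Longrightarrow> SAT (p # n # x # e) \<phi> \<Longrightarrow>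
       SAT (f \<bullet> x \<bullet> n # n # x # e) \<phi>"
proof -
  obtain c where c: "c \<in> dom (\<sigma> \<rightarrow>\<^sub>t N \<rightarrow>\<^sub>t T1)"
    "\<And>x y z. x \<in> dom \<sigma> \<Longrightarrow> y \<in> dom N \<Longrightarrow> z \<in> dom N \<Longrightarrow>
       c \<bullet> x \<bullet> y \<bullet> z = (if SAT (z # y # x # e) \<phi> then zr else one)"
    using comprehension3[OF assms] by blast
  obtain \<mu> where \<mu>: "\<mu> \<in> dom T2"
    "\<And>f. f \<in> dom T1 \<Longrightarrow> \<exists>n\<in>dom N. f \<bullet> n = zr \<Longrightarrow> f \<bullet> (\<mu> \<bullet> f) = zr"
    using mu_fun by blast
  have "HT [N, \<sigma>, T2, \<sigma> \<rightarrow>\<^sub>t N \<rightarrow>\<^sub>t T1] (lvl 1 \<cdot> (lvl 0 \<cdot> lvl 2 \<cdot> lvl 3)) N" by simp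
  then obtain f where f: "f \<in> dom (\<sigma> \<rightarrow>\<^sub>t T1)"
    "\<And>x y. x \<in> dom \<sigma> \<Longrightarrow> y \<in> dom N \<Longrightarrow> f \<bullet> x \<bullet> y = V [y, x, \<mu>, c] (lvl 1 \<cdot> (lvl 0 \<cdot> lvl 2 \<cdot> lvl 3))"
    using \<mu>(1) c(1) by (elim lam2[of _ _ _ _ _ "[\<mu>, c]"]) auto
  show thesis
  proof (rule that[OF f(1)])
    fix x n p assume *: "x \<in> dom \<sigma>" "n \<in> dom N" "p \<in> dom N" "SAT (p # n # x # e) \<phi>"
    then have cd: "c \<bullet> x \<bullet> n \<in> dom T1" using c(1) by (meson app_dom)
    have "\<exists>p\<in>dom N. c \<bullet> x \<bullet> n \<bullet> p = zr" using c(2)[OF *(1-3)] * by (intro bexI[of _ p]) simp_all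
    then have "c \<bullet> x \<bullet> n \<bullet> (\<mu> \<bullet> (c \<bullet> x \<bullet> n)) = zr" by (rule \<mu>(2)[OF cd])
    moreover have "f \<bullet> x \<bullet> n = \<mu> \<bullet> (c \<bullet> x \<bullet> n)" using f(2)[OF *(1,2)] by simp
    moreover have "\<mu> \<bullet> (c \<bullet> x \<bullet> n) \<in> dom N" using cd \<mu>(1) by (meson app_dom)
    ultimately show "SAT (f \<bullet> x \<bullet> n # n # x # e) \<phi>"
      using c(2)[OF *(1,2), of "\<mu> \<bullet> (c \<bullet> x \<bullet> n)"] by (auto split: if_splits)
  qed
qed

end

context countermodel
begin

subsection \<open>Sequences of rationals\<close>

lemma isR_close: "isR s \<Longrightarrow> n \<le> m \<Longrightarrow> s n < s m + iv n \<and> s m < s n + iv n"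
  by (auto simp: isR_def less_eq_nn_def)

lemma iv_antimono: "n \<le> m \<Longrightarrow> iv m \<le> iv n"
  using iv_le by (auto simp: less_eq_nn_def)

lemma iv_le_1: "iv n \<le> 1"
  using iv_le[of 0 n] by simp

lemma isR_const: "isR (\<lambda>_. c)"
  by (simp add: isR_def)

text \<open>A failure at \<open>n\<close> leaves a fixed positive gap beyond the tolerance
  \<open>2 * iv n\<close>. Moving from \<open>n\<close> to a late \<open>m\<close> costs less than
  \<open>iv n\<close> for each sequence, so the gap would persist at \<open>m\<close>, against an
  error that becomes arbitrarily small.\<close>

lemma leR_criterion:
  assumes s: "isR s" and t: "isR t" and le: "\<And>k. \<exists>m\<ge>k. s m \<le> t m + c * iv k"
  shows "leR s t"
  unfolding leR_def
proof (intro allI, rule ccontr)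
  fix n assume "\<not> s n \<le> t n + 2 * iv n"
  then have pos: "0 < s n - t n - 2 * iv n" by simp
  let ?c = "max c 1"
  have "0 < (s n - t n - 2 * iv n) / ?c" using pos by simp
  then obtain k where "iv k < (s n - t n - 2 * iv n) / ?c" using iv_small by blast
  then have k: "?c * iv k < s n - t n - 2 * iv n" by (simp add: less_divide_eq mult.commute)
  obtain m where m: "n + k \<le> m" "s m \<le> t m + c * iv (n + k)" using le by blast
  have "n \<le> n + k" "k \<le> n + k" by simp_all
  then have nm: "n \<le> m" using m(1) order_trans by blast
  have "c * iv (n + k) \<le> ?c * iv (n + k)" by (intro mult_right_mono) (auto simp: less_imp_le)
  also have "\<dots> \<le> ?c * iv k" using iv_antimono[OF \<open>k \<le> n + k\<close>] by (intro mult_left_mono) auto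
  finally show False using isR_close[OF s nm] isR_close[OF t nm] m(2) k by linarith
qed

lemma leR_trans: "isR s \<Longrightarrow> isR t \<Longrightarrow> isR u \<Longrightarrow> leR s t \<Longrightarrow> leR t u \<Longrightarrow> leR s u"
proof (rule leR_criterion[of s u 4])
  fix k assume "leR s t" "leR t u"
  then have "s k \<le> t k + 2 * iv k" "t k \<le> u k + 2 * iv k" by (auto simp: leR_def)
  then show "\<exists>m\<ge>k. s m \<le> u m + 4 * iv k" by (intro exI[of _ k]) simp
qed

lemma eqR_leR: "eqR s t \<longleftrightarrow> leR s t \<and> leR t s"
  by (auto simp: eqR_def leR_def)

lemma eqR_refl: "eqR s s"
  by (simp add: eqR_def less_imp_le)

lemma eqR_sym: "eqR s t \<Longrightarrow> eqR t s"
  by (simp add: eqR_leR)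

lemma eqR_trans: "isR s \<Longrightarrow> isR t \<Longrightarrow> isR u \<Longrightarrow> eqR s t \<Longrightarrow> eqR t u \<Longrightarrow> eqR s u"
  using leR_trans unfolding eqR_leR by blast

lemma eqM_refl: "eqM X x x"
  by (cases X) (auto simp: eqR_refl)

lemma eqM_sym: "eqM X x y \<Longrightarrow> eqM X y x"
  by (cases X) (auto intro: eqR_sym)

lemma eqM_trans: "ptM X x \<Longrightarrow> ptM X y \<Longrightarrow> ptM X z \<Longrightarrow> eqM X x y \<Longrightarrow> eqM X y z \<Longrightarrow> eqM X x z"
  by (cases X) (auto intro: eqR_trans)

text \<open>Strict inequality of the rational \<open>q\<close> and the real \<open>s\<close>. The
  margin \<open>2 * iv n\<close> makes its negation literally \<open>s \<le> q\<close>, which the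
  object language expresses by \<open>rat_le_err\<close>.\<close>

definition ltq :: "qq \<Rightarrow> (nn \<Rightarrow> qq) \<Rightarrow> bool" where "ltq q s \<longleftrightarrow> (\<exists>n. q + 2 * iv n < s n)"

lemma ltq_late:
  assumes s: "isR s" and "ltq q s"
  obtains n where "\<And>m. n \<le> m \<Longrightarrow> q + iv n < s m"
proof -
  obtain n where "q + 2 * iv n < s n" using assms by (auto simp: ltq_def)
  then have "q + iv n < s m" if "n \<le> m" for m using isR_close[OF s that] by linarith
  then show thesis using that by blast
qed

lemma ltq_cong:
  assumes "isR s" "isR t" "eqR s t" shows "ltq q s \<longleftrightarrow> ltq q t"
proof -
  have "ltq q t" if s: "isR s" and e: "eqR s t" and q: "ltq q s" for s t
  proof -
    obtain n where n: "\<And>m. n \<le> m \<Longrightarrow> q + iv n < s m" using ltq_late[OF s q] by blast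
    \<comment> \<open>The late index has to absorb both the equality error and the margin of
      \<open>ltq\<close>, each of them \<open>2 * iv (n + k)\<close>.\<close>
    obtain k where k: "iv k < iv n / 4" using iv_small[of "iv n / 4"] by auto
    have "n \<le> n + k" "k \<le> n + k" by simp_all
    then have "q + iv n < s (n + k)" "iv (n + k) \<le> iv k" using n iv_antimono by blast+
    moreover have "s (n + k) \<le> t (n + k) + 2 * iv (n + k)" using e by (simp add: eqR_def)
    ultimately have "q + 2 * iv (n + k) < t (n + k)" using k by linarith
    then show ?thesis by (auto simp: ltq_def)
  qed
  then show ?thesis using assms eqR_sym by blast
qed

lemma ltq_less: "isR s \<Longrightarrow> ltq q s \<Longrightarrow> \<not> ltq r s \<Longrightarrow> q < r"
proof -
  assume s: "isR s" and q: "ltq q s" and r: "\<not> ltq r s"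
  obtain n where n: "\<And>m. n \<le> m \<Longrightarrow> q + iv n < s m" using ltq_late[OF s q] by blast
  obtain k where k: "iv k < iv n / 4" using iv_small[of "iv n / 4"] by auto
  have "n \<le> n + k" "k \<le> n + k" by simp_all
  then have "q + iv n < s (n + k)" "iv (n + k) \<le> iv k" using n iv_antimono by blast+
  moreover have "s (n + k) \<le> r + 2 * iv (n + k)" using r by (simp add: ltq_def not_less)
  ultimately show "q < r" using k iv_pos[of n] by linarith
qed

text \<open>A rational in the cut is below every rational outside it, so
  \<open>q n < r m < q m + iv m\<close> for all \<open>n\<close> and \<open>m\<close>. The rate of
  convergence thus holds whatever elements of the cut were picked, as is necessary for values found
  by an unspecific search.\<close>

lemma cut_sequence:
  assumes s: "isR s" and q: "\<And>n. ltq (q n) s" and r: "\<And>n. \<not> ltq (r n) s" and qr: "\<And>n. r n < q n + iv n"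
  shows "isR q" "eqR q s"
proof -
  have "q n < q m + iv m" for n m using ltq_less[OF s q r, of n m] qr[of m] by linarith
  then show q': "isR q" unfolding isR_def using iv_le by (meson add_left_mono less_le_trans)
  have "leR q s"
  proof (rule leR_criterion[OF q' s, of 1])
    fix k
    obtain n where n: "\<And>m. n \<le> m \<Longrightarrow> q k + iv n < s m" using ltq_late[OF s q] by blast
    have "q k + iv n < s (n + k)" by (rule n) simp
    then have "q k < s (n + k)" using iv_pos[of n] by linarith
    moreover have "s (n + k) < s k + iv k" using isR_close[OF s, of k "n + k"] by simp
    ultimately show "\<exists>m\<ge>k. q m \<le> s m + 1 * iv k" by (intro exI[of _ k]) simp
  qed
  moreover have "leR s q"
  proof (rule leR_criterion[OF s q', of 3])
    fix k
    have "s k \<le> r k + 2 * iv k" using r[of k] by (simp add: ltq_def not_less)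
    then show "\<exists>m\<ge>k. s m \<le> q m + 3 * iv k" using qr[of k] by (intro exI[of _ k]) simp
  qed
  ultimately show "eqR q s" by (simp add: eqR_leR)
qed

lemma cut_bounds:
  assumes s: "isR s" shows "\<exists>q r. ltq q s \<and> \<not> ltq r s \<and> r < q + iv n"
proof -
  \<comment> \<open>Three places further the error is an eighth of \<open>iv n\<close>. The bounds
    lie \<open>3 * iv ?m\<close> below the term, to leave the margin of \<open>ltq\<close>, and
    \<open>iv ?m\<close> above it; they are half of \<open>iv n\<close> apart.\<close>
  let ?m = "n + 1 + 1 + 1"
  have m: "iv ?m = iv n / 8" unfolding iv_Suc by simp
  have "ltq (s ?m - 3 * iv ?m) s" using iv_pos[of ?m] by (auto simp: ltq_def intro!: exI[of _ ?m])
  moreover have "\<not> ltq (s ?m + iv ?m) s"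
  proof -
    have "s k \<le> s ?m + iv ?m + 2 * iv k" for k
    proof (cases "k \<le> ?m")
      case True
      then show ?thesis using isR_close[OF s True] iv_pos[of ?m] iv_pos[of k] by linarith
    next
      case False
      then have "?m \<le> k" by simp
      then show ?thesis using isR_close[OF s, of ?m k] iv_pos[of k] by linarith
    qed
    then show ?thesis by (simp add: ltq_def not_less)
  qed
  moreover have "s ?m + iv ?m < s ?m - 3 * iv ?m + iv n" using m iv_pos[of n] by linarith
  ultimately show ?thesis by blast
qed

end

lemma WF_cocode: "WF [] (cocode i X)"
  by (simp add: cocode_def cocode0_def cocode1_def is_subset_def is_fun_def nonemptyb_def elem_def
      countableb_def strongly_countableb_def inj_on_set_def surj_on_set_def enumerableb_def)

context countermodel
begin

subsection \<open>Retracts\<close>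

definition funM :: "space \<Rightarrow> tm set \<Rightarrow> bool" where
  "funM X F \<longleftrightarrow> (\<forall>x\<in>dm T1. \<forall>y\<in>dm T1. ptM X x \<and> ptM X y \<and> eqM X x y \<longrightarrow> ap2 F x = ap2 F y)"
definition elM :: "space \<Rightarrow> tm set \<Rightarrow> tm set \<Rightarrow> bool" where
  "elM X x A \<longleftrightarrow> ptM X x \<and> ap2 A x = one"
definition subM :: "space \<Rightarrow> tm set \<Rightarrow> bool" where
  "subM X A \<longleftrightarrow> funM X A \<and> (\<forall>x\<in>dm T1. ptM X x \<longrightarrow> ap2 A x = zr \<or> ap2 A x = one)"
definition injM :: "space \<Rightarrow> tm set \<Rightarrow> tm set \<Rightarrow> bool" where
  "injM X Y A \<longleftrightarrow> (\<forall>x\<in>dm T1. \<forall>y\<in>dm T1. elM X x A \<and> elM X y A \<longrightarrow> ap2 Y x = ap2 Y y \<longrightarrow> eqM X x y)"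
definition surjM :: "space \<Rightarrow> tm set \<Rightarrow> tm set \<Rightarrow> bool" where
  "surjM X Y A \<longleftrightarrow> (\<forall>n\<in>dm N. \<exists>x\<in>dm T1. elM X x A \<and> ap2 Y x = n)"
definition enumM :: "space \<Rightarrow> tm set \<Rightarrow> bool" where
  "enumM X A \<longleftrightarrow> (\<exists>s\<in>dm (N \<rightarrow>\<^sub>t T1). (\<forall>n\<in>dm N. ptM X (ap2 s n)) \<and>
     (\<forall>x\<in>dm T1. ptM X x \<longrightarrow> (elM X x A \<longleftrightarrow> (\<exists>n\<in>dm N. eqM X x (ap2 s n)))))"
text \<open>The two principles are merged with \<open>i\<close> as a switch, so that transfer along
  a retract is proved once for both.\<close>

definition cocodeM :: "nat \<Rightarrow> space \<Rightarrow> bool" where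
  "cocodeM i X \<longleftrightarrow> (\<forall>A\<in>dm T2. subM X A \<longrightarrow> (i = 0 \<longrightarrow> (\<exists>x\<in>dm T1. elM X x A)) \<longrightarrow>
     (\<exists>Y\<in>dm T2. funM X Y \<and> injM X Y A \<and> (i \<noteq> 0 \<longrightarrow> surjM X Y A)) \<longrightarrow> enumM X A)"

lemma SAT_elem:
  "V e x \<in> dm T1 \<Longrightarrow> stab (length e) x \<Longrightarrow> SAT e (elem X x A) \<longleftrightarrow> elM X (V e x) (V e A)"
  by (simp add: elem_def elM_def SAT_pt)

lemma SAT_is_fun: "stab (length e) F \<Longrightarrow> SAT e (is_fun X F) \<longleftrightarrow> funM X (V e F)"
  by (simp add: is_fun_def funM_def SAT_pt SAT_pt_eq)

lemma SAT_is_subset: "stab (length e) A \<Longrightarrow> SAT e (is_subset X A) \<longleftrightarrow> subM X (V e A)"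
  by (simp add: is_subset_def subM_def SAT_pt SAT_is_fun)

lemma SAT_inj_on_set:
  "stab (length e) A \<Longrightarrow> stab (length e) Y \<Longrightarrow> SAT e (inj_on_set X Y A) \<longleftrightarrow> injM X (V e Y) (V e A)"
  by (simp add: inj_on_set_def injM_def SAT_elem SAT_pt_eq)

lemma SAT_surj_on_set:
  "stab (length e) A \<Longrightarrow> stab (length e) Y \<Longrightarrow> SAT e (surj_on_set X Y A) \<longleftrightarrow> surjM X (V e Y) (V e A)"
  by (simp add: surj_on_set_def surjM_def SAT_elem)

lemma SAT_enumerable: "stab (length e) A \<Longrightarrow> SAT e (enumerableb X A) \<longleftrightarrow> enumM X (V e A)"
proof -
  assume st: "stab (length e) A"
  have ap: "s \<in> dm (N \<rightarrow>\<^sub>t T1) \<Longrightarrow> n \<in> dm N \<Longrightarrow> ap2 s n \<in> dm T1" for s n by (rule app_dom)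
  show ?thesis
    unfolding enumerableb_def enumM_def SAT_simps
    by (rule bex_cong[OF refl]) (simp add: st SAT_pt SAT_pt_eq SAT_elem ap)
qed

lemma SAT_cocode: "SAT [] (cocode i X) \<longleftrightarrow> cocodeM i X"
  by (cases "i = 0") (simp_all add: cocode_def cocode0_def cocode1_def cocodeM_def nonemptyb_def countableb_def
      strongly_countableb_def SAT_is_subset SAT_is_fun SAT_inj_on_set SAT_surj_on_set SAT_enumerable
      SAT_elem imp_conjL)

text \<open>Up to the equalities of the spaces, \<open>h\<close> and \<open>g\<close> are mutually
  inverse between \<open>A\<close> and the transferred set, so \<open>Y\<close> composed with
  \<open>g\<close> is injective there, and onto the numbers if \<open>Y\<close> is. Respect for
  equality is asked of \<open>g\<close> only at points that it sends into \<open>X\<close>, since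
  its values elsewhere may be arbitrary.\<close>

lemma retract_cocode:
  assumes h: "h \<in> dm (T1 \<rightarrow>\<^sub>t T1)" and g: "g \<in> dm (T1 \<rightarrow>\<^sub>t T1)"
    and hg: "\<And>x. x \<in> dm T1 \<Longrightarrow> ptM X x \<Longrightarrow>
      ptM Z (ap2 h x) \<and> ptM X (ap2 g (ap2 h x)) \<and> eqM X (ap2 g (ap2 h x)) x"
    and h_cong: "\<And>x y. x \<in> dm T1 \<Longrightarrow> y \<in> dm T1 \<Longrightarrow> ptM X x \<Longrightarrow> ptM X y \<Longrightarrow> eqM X x y \<Longrightarrow>
      eqM Z (ap2 h x) (ap2 h y)"
    and g_cong: "\<And>x y. x \<in> dm T1 \<Longrightarrow> y \<in> dm T1 \<Longrightarrow> ptM Z x \<Longrightarrow> ptM Z y \<Longrightarrow> eqM Z x y \<Longrightarrow>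
      ptM X (ap2 g x) \<Longrightarrow> ptM X (ap2 g y) \<and> eqM X (ap2 g x) (ap2 g y)"
    and Z: "cocodeM i Z"
  shows "cocodeM i X"
  unfolding cocodeM_def
proof (intro ballI impI)
  fix A
  assume A: "A \<in> dm T2" and sub: "subM X A" and ne: "i = 0 \<longrightarrow> (\<exists>x\<in>dm T1. elM X x A)"
    and "\<exists>Y\<in>dm T2. funM X Y \<and> injM X Y A \<and> (i \<noteq> 0 \<longrightarrow> surjM X Y A)"
  then obtain Y where Y: "Y \<in> dm T2" "funM X Y" "injM X Y A" "i \<noteq> 0 \<longrightarrow> surjM X Y A" by blast
  have hd: "ap2 h x \<in> dm T1" and gd: "ap2 g x \<in> dm T1" if "x \<in> dm T1" for x
    using app_dom[OF h that] app_dom[OF g that] by auto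
  \<comment> \<open>The formula is negated because comprehension returns 0 for truth whereas
    membership is the value 1. The clause with \<open>h\<close> keeps a single class of
    \<open>z\<close> for each element of \<open>A\<close>; otherwise several classes could share a
    value of \<open>g\<close>, and injectivity would fail.\<close>
  let ?\<phi> = "\<^bold>\<not> (pt X (lvl 2 \<cdot> lvl 3) \<^bold>\<and> pt_eq Z (lvl 1 \<cdot> (lvl 2 \<cdot> lvl 3)) (lvl 3) \<^bold>\<and> lvl 0 \<cdot> (lvl 2 \<cdot> lvl 3) \<doteq> num 1)"
  have \<phi>: "AR (Suc (length [T1 \<rightarrow>\<^sub>t T1, T1 \<rightarrow>\<^sub>t T1, T2])) ?\<phi>" "WF [T1, T1 \<rightarrow>\<^sub>t T1, T1 \<rightarrow>\<^sub>t T1, T2] ?\<phi>"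
    "envs [g, h, A] [T1 \<rightarrow>\<^sub>t T1, T1 \<rightarrow>\<^sub>t T1, T2]" using h g A by simp_all
  obtain B where B: "B \<in> dm T2"
    and B1: "\<And>z. z \<in> dm T1 \<Longrightarrow> ap2 B z = (if SAT [z, g, h, A] ?\<phi> then zr else one)"
    using comprehension[OF \<phi>] by blast
  have BS: "SAT [z, g, h, A] ?\<phi> \<longleftrightarrow>
      \<not> (elM X (ap2 g z) A \<and> eqM Z (ap2 h (ap2 g z)) z)" if "z \<in> dm T1" for z
    using that hd gd by (auto simp: SAT_pt SAT_pt_eq elM_def)
  have B2: "ap2 B z = (if elM X (ap2 g z) A \<and> eqM Z (ap2 h (ap2 g z)) z then one else zr)" if "z \<in> dm T1" for z
    unfolding B1[OF that] BS[OF that] by simp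
  have elB: "elM Z z B \<longleftrightarrow> ptM Z z \<and> elM X (ap2 g z) A \<and> eqM Z (ap2 h (ap2 g z)) z" if "z \<in> dm T1" for z
    using B2[OF that] by (auto simp: elM_def[of Z])
  have el_cong: "elM X y A" if "elM X x A" "x \<in> dm T1" "y \<in> dm T1" "ptM X y" "eqM X x y" for x y
    using that sub unfolding elM_def subM_def funM_def by metis
  have hB: "elM Z (ap2 h x) B" "eqM X x (ap2 g (ap2 h x))" if x: "x \<in> dm T1" "elM X x A" for x
  proof -
    have px: "ptM X x" using x by (simp add: elM_def)
    note r = hg[OF x(1) px]
    show "eqM X x (ap2 g (ap2 h x))" using r eqM_sym by blast
    then have "elM X (ap2 g (ap2 h x)) A" using el_cong[OF x(2) x(1) gd[OF hd[OF x(1)]]] r by blast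
    moreover have "eqM Z (ap2 h (ap2 g (ap2 h x))) (ap2 h x)"
      using h_cong[OF gd[OF hd[OF x(1)]] x(1)] r px by blast
    ultimately show "elM Z (ap2 h x) B" using elB[OF hd[OF x(1)]] r by blast
  qed
  have B_cong: "elM Z z' B" if z: "z \<in> dm T1" "z' \<in> dm T1" "ptM Z z'" "eqM Z z z'" "elM Z z B" for z z'
  proof -
    have e: "ptM Z z" "elM X (ap2 g z) A" "eqM Z (ap2 h (ap2 g z)) z" using z elB by auto
    have g': "ptM X (ap2 g z')" "eqM X (ap2 g z) (ap2 g z')"
      using g_cong[OF z(1,2) e(1) z(3,4)] e(2) by (auto simp: elM_def)
    then have "elM X (ap2 g z') A" using el_cong e gd z by blast
    moreover have pz: "ptM X (ap2 g z)" using e(2) by (simp add: elM_def)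
    have "eqM Z (ap2 h (ap2 g z')) (ap2 h (ap2 g z))"
      using h_cong[OF gd[OF z(2)] gd[OF z(1)] g'(1) pz] g'(2) eqM_sym by blast
    then have "eqM Z (ap2 h (ap2 g z')) z'"
      using hg[OF gd[OF z(1)] pz] hg[OF gd[OF z(2)] g'(1)] e z eqM_trans by meson
    ultimately show ?thesis using elB z by blast
  qed
  have "subM Z B"
    unfolding subM_def funM_def
  proof (intro conjI ballI impI)
    fix z z' assume z: "z \<in> dm T1" "z' \<in> dm T1" "ptM Z z \<and> ptM Z z' \<and> eqM Z z z'"
    then have "elM Z z B \<longleftrightarrow> elM Z z' B" using B_cong eqM_sym by blast
    then show "ap2 B z = ap2 B z'"
      unfolding B2[OF z(1)] B2[OF z(2)] using elB[OF z(1)] elB[OF z(2)] z(3) by simp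
  qed (use B2 in auto)
  moreover have "i = 0 \<longrightarrow> (\<exists>z\<in>dm T1. elM Z z B)" using ne hB hd by blast
  moreover have "\<exists>Y'\<in>dm T2. funM Z Y' \<and> injM Z Y' B \<and> (i \<noteq> 0 \<longrightarrow> surjM Z Y' B)"
  proof -
    txt \<open>Off \<open>B\<close> the composition of \<open>Y\<close> and \<open>g\<close> need not respect the equality of \<open>Z\<close>.\<close>
    obtain c where c: "c \<in> dm (N \<rightarrow>\<^sub>t N \<rightarrow>\<^sub>t T1)"
      "\<And>x y. x \<in> dm N \<Longrightarrow> y \<in> dm N \<Longrightarrow> ap2 (ap2 (ap2 c x) y) zr = x"
      "\<And>x y n. x \<in> dm N \<Longrightarrow> y \<in> dm N \<Longrightarrow> n \<in> dm N \<Longrightarrow> ap2 (ap2 (ap2 c x) y) (ap2 succ n) = y"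
      using cond_fun by blast
    let ?s = "lvl 3 \<cdot> num 0 \<cdot> (lvl 0 \<cdot> (lvl 1 \<cdot> lvl 4)) \<cdot> (lvl 2 \<cdot> lvl 4)"
    have Y'h: "HT [T1, N \<rightarrow>\<^sub>t N \<rightarrow>\<^sub>t T1, T2, T1 \<rightarrow>\<^sub>t T1, T2] ?s N"
      "envs [c, B, g, Y] [N \<rightarrow>\<^sub>t N \<rightarrow>\<^sub>t T1, T2, T1 \<rightarrow>\<^sub>t T1, T2]" using c(1) B g Y(1) by simp_all
    obtain Y' where Y': "Y' \<in> dm T2" "\<And>z. z \<in> dm T1 \<Longrightarrow> ap2 Y' z = V [z, c, B, g, Y] ?s"
      using lam[OF Y'h] by blast
    have Yd: "ap2 Y (ap2 g z) \<in> dm N" if "z \<in> dm T1" for z using app_dom[OF Y(1) gd[OF that]] .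
    have Y'2: "ap2 Y' z = (if ap2 B z = one then ap2 Y (ap2 g z) else zr)" if "z \<in> dm T1" for z
      using Y'(2)[OF that] c(2)[OF cn_dom(4) Yd[OF that]] c(3)[OF cn_dom(4) Yd[OF that] cn_dom(4)] B2[OF that]
      by auto
    have Y'3: "ap2 Y' z = ap2 Y (ap2 g z)" if "z \<in> dm T1" "elM Z z B" for z
      using Y'2[OF that(1)] that(2) by (simp add: elM_def)
    have "funM Z Y'"
      unfolding funM_def
    proof (intro ballI impI)
      fix z z' assume z: "z \<in> dm T1" "z' \<in> dm T1" "ptM Z z \<and> ptM Z z' \<and> eqM Z z z'"
      show "ap2 Y' z = ap2 Y' z'"
      proof (cases "elM Z z B")
        case True
        then have p: "ptM X (ap2 g z)" using elB[OF z(1)] by (simp add: elM_def)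
        have "ap2 Y (ap2 g z) = ap2 Y (ap2 g z')"
          using Y(2) g_cong[OF z(1,2)] z(3) p gd[OF z(1)] gd[OF z(2)] unfolding funM_def by blast
        moreover have "elM Z z' B" using B_cong z True by blast
        ultimately show ?thesis using Y'3 z True by simp
      next
        case False
        then have "\<not> elM Z z' B" using B_cong z eqM_sym by blast
        then show ?thesis using False Y'2 z by (simp add: elM_def)
      qed
    qed
    moreover have "injM Z Y' B"
      unfolding injM_def
    proof (intro ballI impI)
      fix z z' assume z: "z \<in> dm T1" "z' \<in> dm T1" "elM Z z B \<and> elM Z z' B" "ap2 Y' z = ap2 Y' z'"
      have e: "ptM Z z" "elM X (ap2 g z) A" "eqM Z (ap2 h (ap2 g z)) z"
        and e': "ptM Z z'" "elM X (ap2 g z') A" "eqM Z (ap2 h (ap2 g z')) z'"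
        using elB z by auto
      have "ap2 Y (ap2 g z) = ap2 Y (ap2 g z')" using Y'3 z by simp
      then have gg: "eqM X (ap2 g z) (ap2 g z')" using Y(3) e(2) e'(2) gd z unfolding injM_def by blast
      have p: "ptM X (ap2 g z)" "ptM X (ap2 g z')" using e e' by (auto simp: elM_def)
      have hh: "ptM Z (ap2 h (ap2 g z))" "ptM Z (ap2 h (ap2 g z'))" using hg gd z p by blast+
      have "eqM Z (ap2 h (ap2 g z)) (ap2 h (ap2 g z'))" using h_cong gd z p gg by blast
      then have "eqM Z (ap2 h (ap2 g z)) z'" using eqM_trans[OF hh e'(1)] e'(3) by blast
      then show "eqM Z z z'" using eqM_trans[OF e(1) hh(1) e'(1)] eqM_sym e(3) by blast
    qed
    moreover have "i \<noteq> 0 \<longrightarrow> surjM Z Y' B"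
    proof
      assume "i \<noteq> 0"
      then have Ys: "surjM X Y A" using Y by blast
      show "surjM Z Y' B"
        unfolding surjM_def
      proof
        fix n assume "n \<in> dm N"
        then obtain x where x: "x \<in> dm T1" "elM X x A" "ap2 Y x = n" using Ys unfolding surjM_def by blast
        have px: "ptM X x" using x by (simp add: elM_def)
        have "ap2 Y (ap2 g (ap2 h x)) = ap2 Y x"
          using Y(2) hg[OF x(1) px] gd[OF hd[OF x(1)]] x(1) px unfolding funM_def by blast
        then show "\<exists>z\<in>dm T1. elM Z z B \<and> ap2 Y' z = n"
          using hB(1)[OF x(1,2)] Y'3[OF hd[OF x(1)]] hd[OF x(1)] x(3) by auto
      qed
    qed
    ultimately show ?thesis using Y'(1) by blast
  qed
  ultimately have "enumM Z B" using Z B unfolding cocodeM_def by blast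
  then obtain s where s: "s \<in> dm (N \<rightarrow>\<^sub>t T1)" "\<And>n. n \<in> dm N \<Longrightarrow> ptM Z (ap2 s n)"
    "\<And>z. z \<in> dm T1 \<Longrightarrow> ptM Z z \<Longrightarrow> elM Z z B \<longleftrightarrow> (\<exists>n\<in>dm N. eqM Z z (ap2 s n))"
    unfolding enumM_def by blast
  have sd: "ap2 s n \<in> dm T1" if "n \<in> dm N" for n using app_dom[OF s(1) that] .
  have "HT [N, T1 \<rightarrow>\<^sub>t T1, N \<rightarrow>\<^sub>t T1] (lvl 1 \<cdot> (lvl 0 \<cdot> lvl 2)) T1" by simp
  then obtain s' where s': "s' \<in> dm (N \<rightarrow>\<^sub>t T1)"
    "\<And>n. n \<in> dm N \<Longrightarrow> ap2 s' n = V [n, g, s] (lvl 1 \<cdot> (lvl 0 \<cdot> lvl 2))"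
    using s(1) g by (elim lam[of _ _ _ _ "[g, s]"]) auto
  have s'2: "ap2 s' n = ap2 g (ap2 s n)" if "n \<in> dm N" for n using s'(2)[OF that] by simp
  have sB: "elM Z (ap2 s n) B" if "n \<in> dm N" for n
    using s(3)[OF sd[OF that] s(2)[OF that]] that eqM_refl by blast
  then have gA: "elM X (ap2 g (ap2 s n)) A" if "n \<in> dm N" for n using elB sd that by blast
  show "enumM X A"
    unfolding enumM_def
  proof (intro bexI[of _ s'] conjI ballI impI s'(1))
    show "ptM X (ap2 s' n)" if "n \<in> dm N" for n using gA[OF that] s'2[OF that] by (simp add: elM_def)
    fix x assume x: "x \<in> dm T1" "ptM X x"
    show "elM X x A \<longleftrightarrow> (\<exists>n\<in>dm N. eqM X x (ap2 s' n))"
    proof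
      assume xA: "elM X x A"
      note b = hB[OF x(1) xA]
      have pz: "ptM Z (ap2 h x)" using b(1) by (simp add: elM_def)
      obtain n where n: "n \<in> dm N" "eqM Z (ap2 h x) (ap2 s n)"
        using s(3)[OF hd[OF x(1)] pz] b(1) by blast
      have "ptM X (ap2 g (ap2 h x))" using hg[OF x] by blast
      then have "ptM X (ap2 g (ap2 s n))" "eqM X (ap2 g (ap2 h x)) (ap2 g (ap2 s n))"
        using g_cong[OF hd[OF x(1)] sd[OF n(1)] pz s(2)[OF n(1)] n(2)] by auto
      then have "eqM X x (ap2 s' n)" using b(2) hg[OF x] x eqM_trans s'2[OF n(1)] by metis
      then show "\<exists>n\<in>dm N. eqM X x (ap2 s' n)" using n by blast
    next
      assume "\<exists>n\<in>dm N. eqM X x (ap2 s' n)"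
      then obtain n where n: "n \<in> dm N" "eqM X x (ap2 g (ap2 s n))" using s'2 by auto
      then show "elM X x A" using el_cong[OF gA[OF n(1)] gd[OF sd[OF n(1)]] x] eqM_sym by blast
    qed
  qed
qed

section \<open>The three concrete retracts\<close>

lemma Rep_fn2: "f \<in> dm (T1 \<rightarrow>\<^sub>t T1) \<Longrightarrow> x \<in> dm T1 \<Longrightarrow> ap2 (ap2 f x) (Rep_nn n) = Rep_nn (fn (ap2 f x) n)"
  using Rep_fn app_dom by blast

lemma Rep_eq_iff: "Rep_nn n = zr \<longleftrightarrow> n = 0" "Rep_nn n = one \<longleftrightarrow> n = 1"
  by (metis Rep_zr Rep_nn_inject, metis Rep_one Rep_nn_inject)

text \<open>A real outside the interval is not sent to a point of it, which the proviso in the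
  congruence condition on \<open>g\<close> permits. What has to be checked is that a real equal to
  one in the interval lies in it too.\<close>

lemma cocode_Reals_Unit_Interval:
  assumes "cocodeM i Reals" shows "cocodeM i Unit_Interval"
proof -
  have "HT [T1] (lvl 0) T1" "envs [] []" by simp_all
  then obtain h where h: "h \<in> dm (T1 \<rightarrow>\<^sub>t T1)" "\<And>x. x \<in> dm T1 \<Longrightarrow> ap2 h x = V [x] (lvl 0)"
    using lam by blast
  have h2: "ap2 h x = x" if "x \<in> dm T1" for x using h(2)[OF that] by simp
  show ?thesis
  proof (rule retract_cocode[OF h(1) h(1) _ _ _ assms])
    fix x y
    assume xy: "x \<in> dm T1" "y \<in> dm T1" "ptM Reals x" "ptM Reals y" "eqM Reals x y" "ptM Unit_Interval (ap2 h x)"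
    then have "leR (\<lambda>_. 0) (vr y)" "leR (vr y) (\<lambda>_. 1)"
      using leR_trans[OF isR_const, of "vr x" "vr y"] leR_trans[of "vr y" "vr x" "\<lambda>_. 1"] isR_const
      by (auto simp: eqR_leR h2)
    then show "ptM Unit_Interval (ap2 h y) \<and> eqM Unit_Interval (ap2 h x) (ap2 h y)"
      using xy by (simp add: h2)
  qed (auto simp: h2 eqR_refl)
qed

text \<open>Bit \<open>q\<close> of \<open>h x\<close> tells whether the rational with code
  \<open>q\<close> is below \<open>x\<close>, so equal reals have identical images. For each
  \<open>n\<close>, \<open>g\<close> searches a code in the cut such that some rational outside the
  cut is less than \<open>iv n\<close> above it; \<open>cut_bounds\<close> provides one on the cut
  of a real, and \<open>cut_sequence\<close> shows that any choice represents that real.\<close>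

lemma cocode_Cantor_Reals:
  assumes "cocodeM i Cantor" shows "cocodeM i Reals"
proof -
  let ?\<phi> = "\<^bold>\<forall>\<^sub>0n. rat_le_err (lvl 0 \<cdot> n) (lvl 1) n"
  have \<phi>: "AR (Suc (Suc (length []))) ?\<phi>" "WF [N, T1] ?\<phi>" "envs [] []" by simp_all
  obtain h where h: "h \<in> dm (T1 \<rightarrow>\<^sub>t T1)"
    "\<And>x q. x \<in> dm T1 \<Longrightarrow> q \<in> dm N \<Longrightarrow> ap2 (ap2 h x) q = (if SAT [q, x] ?\<phi> then zr else one)"
    using comprehension2[OF \<phi>] by blast
  have hd: "ap2 h x \<in> dm T1" if "x \<in> dm T1" for x using app_dom[OF h(1) that] .
  have hv: "fn (ap2 h x) q = (if ltq (vq q) (vr x) then 1 else 0)" if x: "x \<in> dm T1" for x q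
  proof -
    have "SAT [Rep_nn q, x] ?\<phi> \<longleftrightarrow> \<not> ltq (vq q) (vr x)"
      using x by (simp add: SAT_rat_le_err Rep_simps Rep_fn ltq_def vr_def not_less)
    then have "Rep_nn (fn (ap2 h x) q) = (if ltq (vq q) (vr x) then one else zr)"
      using h(2)[OF x, of "Rep_nn q"] Rep_fn[OF hd[OF x]] by simp
    then show ?thesis by (auto simp: Rep_eq_iff split: if_splits)
  qed
  let ?\<psi> = "lvl 0 \<cdot> lvl 2 \<doteq> num 1 \<^bold>\<and> (\<^bold>\<exists>\<^sub>0r. lvl 0 \<cdot> r \<doteq> num 0 \<^bold>\<and> rat_less_err r (lvl 2) (lvl 1))"
  have \<psi>: "AR (Suc (Suc (Suc (length [])))) ?\<psi>" "WF [N, N, T1] ?\<psi>" "envs [] []" by simp_all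
  obtain g where g: "g \<in> dm (T1 \<rightarrow>\<^sub>t T1)"
    "\<And>c n p. c \<in> dm T1 \<Longrightarrow> n \<in> dm N \<Longrightarrow> p \<in> dm N \<Longrightarrow> SAT [p, n, c] ?\<psi> \<Longrightarrow> SAT [ap2 (ap2 g c) n, n, c] ?\<psi>"
    using search[OF \<psi>] by blast
  have S\<psi>: "SAT [Rep_nn p, Rep_nn n, c] ?\<psi> \<longleftrightarrow> fn c p = 1 \<and> (\<exists>r. fn c r = 0 \<and> vq r < vq p + iv n)"
    if "c \<in> dm T1" for c n p
    using that by (simp add: SAT_rat_less_err Rep_simps Rep_fn Rep_eq_iff del: num.simps)
  have gh: "isR (vr (ap2 g (ap2 h x)))" "eqR (vr (ap2 g (ap2 h x))) (vr x)"
    if x: "x \<in> dm T1" "isR (vr x)" for x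
  proof -
    have "\<exists>r. ltq (vr (ap2 g (ap2 h x)) n) (vr x) \<and> \<not> ltq r (vr x) \<and> r < vr (ap2 g (ap2 h x)) n + iv n" for n
    proof -
      obtain q r where "ltq q (vr x)" "\<not> ltq r (vr x)" "r < q + iv n" using cut_bounds[OF x(2)] by blast
      moreover obtain q' r' where "vq q' = q" "vq r' = r" using vq_surj by blast
      ultimately have "SAT [Rep_nn q', Rep_nn n, ap2 h x] ?\<psi>"
        unfolding S\<psi>[OF hd[OF x(1)]] hv[OF x(1)] by auto
      then have "SAT [Rep_nn (fn (ap2 g (ap2 h x)) n), Rep_nn n, ap2 h x] ?\<psi>"
        using g(2)[OF hd[OF x(1)] Rep_dom Rep_dom] Rep_fn2[OF g(1) hd[OF x(1)]] by simp
      then show ?thesis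
        unfolding S\<psi>[OF hd[OF x(1)]] hv[OF x(1)] vr_def by (auto split: if_splits)
    qed
    then obtain r where "\<And>n. ltq (vr (ap2 g (ap2 h x)) n) (vr x)" "\<And>n. \<not> ltq (r n) (vr x)"
      "\<And>n. r n < vr (ap2 g (ap2 h x)) n + iv n" by metis
    then show "isR (vr (ap2 g (ap2 h x)))" "eqR (vr (ap2 g (ap2 h x))) (vr x)"
      using cut_sequence[OF x(2)] by blast+
  qed
  show ?thesis
  proof (rule retract_cocode[OF h(1) g(1) _ _ _ assms])
    fix x assume x: "x \<in> dm T1" "ptM Reals x"
    then show "ptM Cantor (ap2 h x) \<and> ptM Reals (ap2 g (ap2 h x)) \<and> eqM Reals (ap2 g (ap2 h x)) x"
      using gh by (simp add: hv)
  next
    fix x y assume "x \<in> dm T1" "y \<in> dm T1" "ptM Reals x" "ptM Reals y" "eqM Reals x y"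
    then show "eqM Cantor (ap2 h x) (ap2 h y)"
      using ltq_cong[of "vr x" "vr y"] fn_ext[OF hd hd, of x y] by (simp add: hv)
  qed (auto simp: eqR_refl)
qed

text \<open>The digits of \<open>c\<close> are read in base 4; \<open>f n\<close> is the integer formed by the first \<open>n\<close> of them.\<close>

lemma base4_bounds:
  assumes f: "f \<in> dm T1" and c: "\<And>n. fn c n = 0 \<or> fn c n = 1"
    and f0: "fn f 0 = 0" and fS: "\<And>n. fn f (n + 1) = 4 * fn f n + fn c n"
  shows "p2 i * p2 i * fn f n \<le> fn f (n + i) \<and> 3 * fn f (n + i) + 1 \<le> p2 i * p2 i * (3 * fn f n + 1)"
proof (rule nn_induct[where \<Gamma> = "[N, T1]" and e = "[Rep_nn n, f]" and n = i
      and P = "\<lambda>i. p2 i * p2 i * fn f n \<le> fn f (n + i) \<and> 3 * fn f (n + i) + 1 \<le> p2 i * p2 i * (3 * fn f n + 1)"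
      and \<phi> = "pow2 (lvl 2) \<^bold>* pow2 (lvl 2) \<^bold>* (lvl 0 \<cdot> lvl 1) \<^bold>\<le> lvl 0 \<cdot> (lvl 1 \<^bold>+ lvl 2) \<^bold>\<and>
        num 3 \<^bold>* (lvl 0 \<cdot> (lvl 1 \<^bold>+ lvl 2)) \<^bold>+ num 1 \<^bold>\<le> pow2 (lvl 2) \<^bold>* pow2 (lvl 2) \<^bold>* (num 3 \<^bold>* (lvl 0 \<cdot> lvl 1) \<^bold>+ num 1)"])
  fix i
  assume IH: "p2 i * p2 i * fn f n \<le> fn f (n + i) \<and> 3 * fn f (n + i) + 1 \<le> p2 i * p2 i * (3 * fn f n + 1)"
  \<comment> \<open>\<open>E\<close> is 4 to the power \<open>i\<close>, written with powers of 2.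
    The second bound is the integral form of a geometric series: even if all digits after the first
    \<open>n\<close> are 1, they add at most a third of a unit of the last of these places.\<close>
  define E where "E = p2 i * p2 i"
  have "4 * (E * fn f n) \<le> 4 * fn f (n + i) + fn c (n + i)"
    using IH by (intro add_increasing2 mult_left_mono) (simp_all add: E_def)
  moreover have "3 * (4 * fn f (n + i) + fn c (n + i)) + 1 \<le> 4 * (E * (3 * fn f n + 1))"
  proof -
    have "fn c (n + i) \<le> 1" using c[of "n + i"] by auto
    then have "3 * (4 * fn f (n + i) + fn c (n + i)) + 1 \<le> 3 * (4 * fn f (n + i) + 1) + 1"
      by (intro add_mono mult_left_mono) simp_all
    also have "\<dots> = 4 * (3 * fn f (n + i) + 1)" by (simp add: distrib_left add.assoc)
    also have "\<dots> \<le> 4 * (E * (3 * fn f n + 1))"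
      using IH by (intro mult_left_mono) (simp_all add: E_def)
    finally show ?thesis .
  qed
  moreover have "p2 (i + 1) * p2 (i + 1) = 4 * E" unfolding p2_Suc E_def by (simp add: ac_simps)
  ultimately show "p2 (i + 1) * p2 (i + 1) * fn f n \<le> fn f (n + (i + 1)) \<and>
      3 * fn f (n + (i + 1)) + 1 \<le> p2 (i + 1) * p2 (i + 1) * (3 * fn f n + 1)"
    by (simp add: fS add.assoc[symmetric] mult.assoc)
qed (use f in \<open>simp_all add: SAT_le Rep_simps Rep_fn del: num.simps\<close>)

text \<open>The terms are the truncations of the expansion, and \<open>iv n * iv n\<close> is 4 to
  the power \<open>-n\<close>. They increase, and later digits add at most a third of this weight,
  hence less than half of it. That is below \<open>iv n\<close>, which makes \<open>u\<close> a
  real; at \<open>n = 0\<close> it bounds all terms by 1/2.\<close>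

lemma base4_real:
  assumes f: "f \<in> dm T1" and c: "\<And>n. fn c n = 0 \<or> fn c n = 1"
    and f0: "fn f 0 = 0" and fS: "\<And>n. fn f (n + 1) = 4 * fn f n + fn c n"
    and u: "\<And>n. u n = qn (fn f n) * (iv n * iv n)"
  shows "n \<le> m \<Longrightarrow> u n \<le> u m"
    and "u m < u n + iv n * iv n / 2"
    and "isR u" and "leR (\<lambda>_. 0) u" and "leR u (\<lambda>_. 1)"
proof -
  have step: "u n \<le> u (n + i) \<and> u (n + i) < u n + iv n * iv n / 2" for n i
  proof -
    have b: "qn (p2 i) * qn (p2 i) * qn (fn f n) \<le> qn (fn f (n + i))"
        "3 * qn (fn f (n + i)) + 1 \<le> qn (p2 i) * qn (p2 i) * (3 * qn (fn f n) + 1)"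
      using base4_bounds[OF f c f0 fS, of i n] by (metis qn_le qn_hom qn_numeral)+
    have iv: "iv i * qn (p2 i) = 1" using qn_p2_pos[of i] by (simp add: iv_def)
    define w where "w = iv n * iv n * (iv i * iv i)"
    have w: "0 < w" by (simp add: w_def)
    have w2: "qn (p2 i) * qn (p2 i) * w = iv n * iv n"
      using qn_p2_pos[of i] by (simp add: w_def iv_def)
    have um: "u (n + i) = qn (fn f (n + i)) * w" by (simp add: u iv_add w_def ac_simps)
    have "qn (p2 i) * qn (p2 i) * qn (fn f n) * w \<le> qn (fn f (n + i)) * w"
      using b(1) w by (intro mult_right_mono) auto
    moreover have "qn (p2 i) * qn (p2 i) * qn (fn f n) * w = u n"
      unfolding u w2[symmetric] by (simp only: ac_simps)
    moreover have "(3 * qn (fn f (n + i)) + 1) * w \<le> qn (p2 i) * qn (p2 i) * (3 * qn (fn f n) + 1) * w"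
      using b(2) w by (intro mult_right_mono) auto
    moreover have "qn (p2 i) * qn (p2 i) * (3 * qn (fn f n) + 1) * w = 3 * u n + iv n * iv n"
    proof -
      have "qn (p2 i) * qn (p2 i) * (3 * qn (fn f n) + 1) * w = (3 * qn (fn f n) + 1) * (qn (p2 i) * qn (p2 i) * w)"
        by (simp only: ac_simps)
      then show ?thesis unfolding w2 by (simp add: u algebra_simps)
    qed
    moreover have "0 < iv n * iv n" by simp
    ultimately show ?thesis using w unfolding um by (simp add: distrib_right)
  qed
  show mono: "u n \<le> u m" if "n \<le> m" for n m using step that by (auto simp: less_eq_nn_def)
  show up: "u m < u n + iv n * iv n / 2" for n m
  proof (cases "n \<le> m")
    case True
    then show ?thesis using step by (auto simp: less_eq_nn_def)
  next
    case False
    then have "u m \<le> u n" using mono by simp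
    moreover have "0 < iv n * iv n" by simp
    ultimately show ?thesis by linarith
  qed
  have "iv n * iv n / 2 < iv n" for n
    using iv_le_1[of n] iv_pos[of n] mult_left_le[of "iv n" "iv n"] by linarith
  then have "u m < u n + iv n" for n m using up[of m n] by (meson add_less_cancel_left less_trans)
  then show "isR u" using step unfolding isR_def by (meson add_increasing2 iv_pos le_less_trans less_add_same_cancel1)
  have "0 \<le> u n" for n by (simp add: u)
  then show "leR (\<lambda>_. 0) u" by (simp add: leR_def less_imp_le add_nonneg_nonneg)
  have "u n \<le> 1 + 2 * iv n" for n
  proof -
    have "u n < 1 / 2" using up[of n 0] by (simp add: u f0)
    then show ?thesis using iv_pos[of n] by linarith
  qed
  then show "leR u (\<lambda>_. 1)" by (simp add: leR_def)
qed

lemma ratP_code: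
  assumes "0 < b" obtains q d where "ratP q a 0 d" "d + 1 = b" "vq q = qn a / qn b"
proof -
  have "b \<noteq> 0" using assms by simp
  then obtain d where d: "d + 1 = b" using nn_pred[of b] by auto
  obtain q where "pairP q (2 * a) d" using pairP_ex_code by blast
  then have "ratP q a 0 d" by (simp add: ratP_def)
  moreover have "qn b = qn d + 1" unfolding d[symmetric] by simp
  ultimately show thesis using d vq_eq that by simp
qed

lemma p2_pos: "0 < p2 n * p2 n"
  using p2_gt[of n] le_less_trans[OF nn_nonneg p2_gt] by simp

text \<open>In units of \<open>iv n * iv n\<close>, an expansion has as integer part the number
  \<open>t\<close> formed by its first \<open>n\<close> digits; the rest is at most 1/12 if digit
  \<open>n\<close> is 0, and between 1/4 and 1/3 if it is 1. The thresholds \<open>t + 1/8\<close>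
  and \<open>t + 1/2\<close> separate these cases with room to spare. Since \<open>t\<close> is
  quantified and only comparisons with rationals occur, the condition depends on the real
  alone.\<close>

definition digit :: "(nn \<Rightarrow> qq) \<Rightarrow> nn \<Rightarrow> bool" where
  "digit u n \<longleftrightarrow> (\<exists>t. ltq ((8 * qn t + 1) / 8 * (iv n * iv n)) u \<and> \<not> ltq ((2 * qn t + 1) / 2 * (iv n * iv n)) u)"

text \<open>The thresholds force \<open>t < fn f n + 1\<close> and \<open>fn f n < t + 1\<close>, so
  \<open>t\<close> is the integer of the first \<open>n\<close> digits. If digit \<open>n\<close>
  were 0, the tail bound at place \<open>n + 1\<close>, half of a quarter unit, would keep all terms
  below the threshold at 1/8.\<close>

lemma digit_base4:
  assumes f: "f \<in> dm T1" and c: "\<And>n. fn c n = 0 \<or> fn c n = 1"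
    and f0: "fn f 0 = 0" and fS: "\<And>n. fn f (n + 1) = 4 * fn f n + fn c n"
    and u: "\<And>n. u n = qn (fn f n) * (iv n * iv n)"
  shows "digit u n \<longleftrightarrow> fn c n = 1"
proof -
  note mono = base4_real(1)[OF f c f0 fS u] and up = base4_real(2)[OF f c f0 fS u]
  \<comment> \<open>For an increasing sequence the margin of \<open>ltq\<close> comes for free: a
    term above \<open>q\<close> keeps its excess at later indices, where the margin has become
    smaller.\<close>
  have less: "ltq q u \<longleftrightarrow> (\<exists>k. q < u k)" for q
  proof
    assume "ltq q u"
    then obtain k where "q + 2 * iv k < u k" by (auto simp: ltq_def)
    then show "\<exists>k. q < u k" using iv_pos[of k] by (intro exI[of _ k]) linarith
  next
    assume "\<exists>k. q < u k"
    then obtain k where k: "q < u k" by blast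
    then obtain j where j: "iv j < (u k - q) / 2" using iv_small[of "(u k - q) / 2"] by auto
    have "2 * iv j < u k - q" using j by (simp add: less_divide_eq mult.commute)
    moreover have "u k \<le> u (k + j)" "iv (k + j) \<le> iv j" using mono[of k "k + j"] iv_antimono[of j "k + j"] by simp_all
    ultimately show "ltq q u" unfolding ltq_def by (intro exI[of _ "k + j"]) linarith
  qed
  let ?S = "qn (fn f n)" and ?w = "iv n * iv n"
  have w: "0 < ?w" by simp
  have u1: "u (n + 1) = (4 * ?S + qn (fn c n)) * (?w / 4)" by (simp add: u iv_Suc fS)
  have up1: "u k < (4 * ?S + qn (fn c n)) * (?w / 4) + ?w / 8" for k
    using up[of k "n + 1"] unfolding u1 by (simp add: iv_Suc)
  show ?thesis
  proof
    assume "digit u n"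
    then obtain t k where t: "(8 * qn t + 1) / 8 * ?w < u k" "\<And>k. u k \<le> (2 * qn t + 1) / 2 * ?w"
      by (auto simp: digit_def less not_less)
    have "(8 * qn t + 1) / 8 * ?w < (2 * ?S + 1) / 2 * ?w"
      using t(1) up[of k n] by (simp add: u field_simps)
    then have "(8 * qn t + 1) / 8 < (2 * ?S + 1) / 2" using w mult_less_cancel_right_pos by blast
    then have "qn t < qn (fn f n + 1)" by simp
    then have tS: "t \<le> fn f n" unfolding qn_less using nn_discrete[of t "fn f n + 1"] by simp
    have "?S * ?w \<le> (2 * qn t + 1) / 2 * ?w" using t(2)[of n] by (simp add: u)
    then have "?S \<le> (2 * qn t + 1) / 2" using w mult_le_cancel_right_pos by blast
    then have "qn (fn f n) < qn (t + 1)" by simp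
    then have "fn f n \<le> t" unfolding qn_less using nn_discrete[of "fn f n" "t + 1"] by simp
    then have "t = fn f n" using tS by simp
    then have "(8 * ?S + 1) / 8 * ?w < (4 * ?S + qn (fn c n)) * (?w / 4) + ?w / 8"
      using less_trans[OF t(1) up1[of k]] by simp
    then have "fn c n \<noteq> 0" by (auto simp: field_simps)
    then show "fn c n = 1" using c by blast
  next
    assume c1: "fn c n = 1"
    have "(8 * ?S + 1) / 8 * ?w < u (n + 1)" unfolding u1 c1 using w by (simp add: field_simps)
    moreover have "u k \<le> (2 * ?S + 1) / 2 * ?w" for k
      using up[of k n] by (simp add: u field_simps less_imp_le)
    ultimately show "digit u n" unfolding digit_def less not_ex not_less by blast
  qed
qed

text \<open>\<open>h\<close> lists codes of fractions whose numerators are the integers of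
  \<open>base4_bounds\<close> and whose denominators are the powers of 4. As \<open>digit\<close> is
  invariant under equality of reals, \<open>g\<close> sends equal points of the interval to the same
  bit sequence, whether or not they arise from \<open>h\<close>.\<close>

lemma cocode_Unit_Interval_Cantor:
  assumes "cocodeM i Unit_Interval" shows "cocodeM i Cantor"
proof -
  \<comment> \<open>The step function, sending \<open>s\<close> to \<open>4 * s + c n\<close>, takes
    \<open>c\<close> as an argument so that the recursion is uniform in the bit sequence.\<close>
  have st: "HT [N, N, T1] (num 4 \<^bold>* lvl 2 \<^bold>+ lvl 0 \<cdot> lvl 1) N" "envs [] []" by simp_all
  obtain st where st: "st \<in> dm (T1 \<rightarrow>\<^sub>t N \<rightarrow>\<^sub>t T1)" "\<And>c n s. c \<in> dm T1 \<Longrightarrow> n \<in> dm N \<Longrightarrow> s \<in> dm N \<Longrightarrow>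
      ap2 (ap2 (ap2 st c) n) s = V [s, n, c] (num 4 \<^bold>* lvl 2 \<^bold>+ lvl 0 \<cdot> lvl 1)"
    using lam3[OF st] by blast
  have S: "HT [T1, T1 \<rightarrow>\<^sub>t N \<rightarrow>\<^sub>t T1] (cn Rec \<cdot> (lvl 0 \<cdot> lvl 1) \<cdot> num 0) T1" "envs [st] [T1 \<rightarrow>\<^sub>t N \<rightarrow>\<^sub>t T1]"
    using st(1) by simp_all
  obtain S where S: "S \<in> dm (T1 \<rightarrow>\<^sub>t T1)"
      "\<And>c. c \<in> dm T1 \<Longrightarrow> ap2 S c = V [c, st] (cn Rec \<cdot> (lvl 0 \<cdot> lvl 1) \<cdot> num 0)"
    using lam[OF S] by blast
  have Sd: "ap2 S c \<in> dm T1" if "c \<in> dm T1" for c using app_dom[OF S(1) that] .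
  have S_rec: "fn (ap2 S c) 0 = 0" "fn (ap2 S c) (n + 1) = 4 * fn (ap2 S c) n + fn c n" if c: "c \<in> dm T1" for c n
  proof -
    have sc: "ap2 st c \<in> dm (N \<rightarrow>\<^sub>t T1)" using app_dom[OF st(1) c] .
    have Sc: "ap2 S c = ap2 (ap2 rc (ap2 st c)) zr" using S(2)[OF c] by simp
    have "Rep_nn (fn (ap2 S c) 0) = zr"
      unfolding Rep_fn[OF Sd[OF c], symmetric] unfolding Rep_zr Sc using rc_zr[OF sc cn_dom(4)] .
    then show "fn (ap2 S c) 0 = 0" by (simp add: Rep_eq_iff)
    have "Rep_nn (fn (ap2 S c) (n + 1)) = ap2 (ap2 (ap2 st c) (Rep_nn n)) (Rep_nn (fn (ap2 S c) n))"
      unfolding Rep_fn[OF Sd[OF c], symmetric] Rep_succ[symmetric] unfolding Sc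
      using rc_succ[OF sc cn_dom(4) Rep_dom] .
    also have "\<dots> = Rep_nn (4 * fn (ap2 S c) n + fn c n)"
      using st(2)[OF c Rep_dom Rep_dom] c by (simp add: Rep_simps Rep_fn del: num.simps)
    finally show "fn (ap2 S c) (n + 1) = 4 * fn (ap2 S c) n + fn c n" by (simp add: Rep_nn_inject)
  qed
  \<comment> \<open>Pairing is given by a relation and not by a term, so a code of the fraction has
    to be found by search; \<open>d\<close> is its denominator minus one.\<close>
  let ?\<phi> = "\<^bold>\<exists>\<^sub>0d. cn Succ \<cdot> d \<doteq> pow2 (lvl 2) \<^bold>* pow2 (lvl 2) \<^bold>\<and> ratb (lvl 3) (lvl 0 \<cdot> lvl 1 \<cdot> lvl 2) (num 0) d"
  have \<phi>: "AR (Suc (Suc (Suc (length [T1 \<rightarrow>\<^sub>t T1])))) ?\<phi>" "WF [N, N, T1, T1 \<rightarrow>\<^sub>t T1] ?\<phi>" "envs [S] [T1 \<rightarrow>\<^sub>t T1]"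
    using S(1) by simp_all
  obtain h where h: "h \<in> dm (T1 \<rightarrow>\<^sub>t T1)"
    "\<And>c n p. c \<in> dm T1 \<Longrightarrow> n \<in> dm N \<Longrightarrow> p \<in> dm N \<Longrightarrow> SAT [p, n, c, S] ?\<phi> \<Longrightarrow> SAT [ap2 (ap2 h c) n, n, c, S] ?\<phi>"
    using search[OF \<phi>] by blast
  have hd: "ap2 h c \<in> dm T1" if "c \<in> dm T1" for c using app_dom[OF h(1) that] .
  have S\<phi>: "SAT [Rep_nn p, Rep_nn n, c, S] ?\<phi> \<longleftrightarrow> (\<exists>d. d + 1 = p2 n * p2 n \<and> ratP p (fn (ap2 S c) n) 0 d)"
    if "c \<in> dm T1" for c n p
    using that by (simp add: SAT_ratb[where m' = 0] Rep_simps Rep_fn2[OF S(1)] del: num.simps)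
  have hv: "vr (ap2 h c) n = qn (fn (ap2 S c) n) * (iv n * iv n)" if c: "c \<in> dm T1" for c n
  proof -
    obtain q d where "ratP q (fn (ap2 S c) n) 0 d" "d + 1 = p2 n * p2 n" using ratP_code[OF p2_pos] by blast
    then have "SAT [Rep_nn q, Rep_nn n, c, S] ?\<phi>" unfolding S\<phi>[OF c] by blast
    then have "SAT [Rep_nn (fn (ap2 h c) n), Rep_nn n, c, S] ?\<phi>"
      using h(2)[OF c Rep_dom Rep_dom] Rep_fn2[OF h(1) c] by simp
    then obtain d' where d': "d' + 1 = p2 n * p2 n" "ratP (fn (ap2 h c) n) (fn (ap2 S c) n) 0 d'"
      unfolding S\<phi>[OF c] by blast
    have "qn d' + 1 = qn (p2 n) * qn (p2 n)" using arg_cong[OF d'(1), of qn] by simp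
    then show ?thesis by (simp add: vr_def vq_eq[OF d'(2)] iv_def)
  qed
  \<comment> \<open>\<open>q\<close> and \<open>r\<close> are codes of the two thresholds of
    \<open>digit\<close>, with denominators 8 and 2 times the power of 4. The negation makes 1 the
    value where the digit condition holds.\<close>
  let ?\<psi> = "\<^bold>\<not> (\<^bold>\<exists>\<^sub>0t. \<^bold>\<exists>\<^sub>0q. \<^bold>\<exists>\<^sub>0r. \<^bold>\<exists>\<^sub>0d. \<^bold>\<exists>\<^sub>0d'.
      (cn Succ \<cdot> d \<doteq> num 8 \<^bold>* (pow2 (lvl 1) \<^bold>* pow2 (lvl 1)) \<^bold>\<and> ratb q (num 8 \<^bold>* t \<^bold>+ num 1) (num 0) d) \<^bold>\<and>
      (cn Succ \<cdot> d' \<doteq> num 2 \<^bold>* (pow2 (lvl 1) \<^bold>* pow2 (lvl 1)) \<^bold>\<and> ratb r (num 2 \<^bold>* t \<^bold>+ num 1) (num 0) d') \<^bold>\<and>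
      (\<^bold>\<exists>\<^sub>0k. \<^bold>\<not> rat_le_err (lvl 0 \<cdot> k) q k) \<^bold>\<and> (\<^bold>\<forall>\<^sub>0k. rat_le_err (lvl 0 \<cdot> k) r k))"
  have \<psi>: "AR (Suc (Suc (length []))) ?\<psi>" "WF [N, T1] ?\<psi>" "envs [] []" by (simp_all del: num.simps)
  obtain g where g: "g \<in> dm (T1 \<rightarrow>\<^sub>t T1)"
    "\<And>y n. y \<in> dm T1 \<Longrightarrow> n \<in> dm N \<Longrightarrow> ap2 (ap2 g y) n = (if SAT [n, y] ?\<psi> then zr else one)"
    using comprehension2[OF \<psi>] by blast
  have gd: "ap2 g y \<in> dm T1" if "y \<in> dm T1" for y using app_dom[OF g(1) that] .
  have S\<psi>: "SAT [Rep_nn n, y] ?\<psi> \<longleftrightarrow> \<not> digit (vr y) n" if y: "y \<in> dm T1" for y n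
  proof -
    let ?R = "\<exists>t q r d d'. (d + 1 = 8 * (p2 n * p2 n) \<and> ratP q (8 * t + 1) 0 d) \<and>
        (d' + 1 = 2 * (p2 n * p2 n) \<and> ratP r (2 * t + 1) 0 d') \<and> ltq (vq q) (vr y) \<and> \<not> ltq (vq r) (vr y)"
    have "SAT [Rep_nn n, y] ?\<psi> \<longleftrightarrow> \<not> ?R"
      using y by (simp add: SAT_ratb[where m' = 0] SAT_rat_le_err Rep_simps Rep_fn ltq_def not_less vr_def not_le del: num.simps)
    also have "\<dots> \<longleftrightarrow> \<not> digit (vr y) n"
    proof -
      have v: "vq q = (8 * qn t + 1) / 8 * (iv n * iv n)"
        if "d + 1 = 8 * (p2 n * p2 n)" "ratP q (8 * t + 1) 0 d" for q d t
      proof -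
        have "qn d + 1 = 8 * (qn (p2 n) * qn (p2 n))" using arg_cong[OF that(1), of qn] by simp
        then show ?thesis by (simp add: vq_eq[OF that(2)] iv_def)
      qed
      have v': "vq q = (2 * qn t + 1) / 2 * (iv n * iv n)"
        if "d + 1 = 2 * (p2 n * p2 n)" "ratP q (2 * t + 1) 0 d" for q d t
      proof -
        have "qn d + 1 = 2 * (qn (p2 n) * qn (p2 n))" using arg_cong[OF that(1), of qn] by simp
        then show ?thesis by (simp add: vq_eq[OF that(2)] iv_def)
      qed
      have ex: "\<exists>q d. d + 1 = 8 * (p2 n * p2 n) \<and> ratP q (8 * t + 1) 0 d" for t
        using ratP_code[of "8 * (p2 n * p2 n)" "8 * t + 1"] p2_pos[of n] by (metis mult_pos_pos zero_less_numeral)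
      have ex': "\<exists>q d. d + 1 = 2 * (p2 n * p2 n) \<and> ratP q (2 * t + 1) 0 d" for t
        using ratP_code[of "2 * (p2 n * p2 n)" "2 * t + 1"] p2_pos[of n] by (metis mult_pos_pos zero_less_numeral)
      show ?thesis
      proof
        assume *: "\<not> ?R"
        show "\<not> digit (vr y) n"
        proof
          assume "digit (vr y) n"
          then obtain t where t: "ltq ((8 * qn t + 1) / 8 * (iv n * iv n)) (vr y)"
            "\<not> ltq ((2 * qn t + 1) / 2 * (iv n * iv n)) (vr y)" by (auto simp: digit_def)
          obtain q d where q: "d + 1 = 8 * (p2 n * p2 n)" "ratP q (8 * t + 1) 0 d" using ex by blast
          obtain r d' where r: "d' + 1 = 2 * (p2 n * p2 n)" "ratP r (2 * t + 1) 0 d'" using ex' by blast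
          show False using * q r t unfolding v[OF q, symmetric] v'[OF r, symmetric] by blast
        qed
      next
        assume "\<not> digit (vr y) n"
        then show "\<not> ?R"
          unfolding digit_def by (metis v v')
      qed
    qed
    finally show ?thesis .
  qed
  have gv: "fn (ap2 g y) n = (if digit (vr y) n then 1 else 0)" if y: "y \<in> dm T1" for y n
  proof -
    have "Rep_nn (fn (ap2 g y) n) = (if digit (vr y) n then one else zr)"
      using g(2)[OF y Rep_dom] S\<psi>[OF y] Rep_fn[OF gd[OF y]] by simp
    then show ?thesis by (auto simp: Rep_eq_iff split: if_splits)
  qed
  have gh: "ap2 g (ap2 h c) = c" if c: "c \<in> dm T1" "ptM Cantor c" for c
  proof (rule fn_ext[OF gd[OF hd[OF c(1)]] c(1)])
    fix n
    have "digit (vr (ap2 h c)) n \<longleftrightarrow> fn c n = 1"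
      using c(2) by (intro digit_base4[OF Sd[OF c(1)]] S_rec[OF c(1)] hv[OF c(1)]) simp
    then show "fn (ap2 g (ap2 h c)) n = fn c n"
      using c(2) gv[OF hd[OF c(1)]] by auto
  qed
  show ?thesis
  proof (rule retract_cocode[OF h(1) g(1) _ _ _ assms])
    fix c assume c: "c \<in> dm T1" "ptM Cantor c"
    then have d: "fn c n = 0 \<or> fn c n = 1" for n by simp
    note r = base4_real(3-5)[OF Sd[OF c(1)] d S_rec[OF c(1)] hv[OF c(1)]]
    then show "ptM Unit_Interval (ap2 h c) \<and> ptM Cantor (ap2 g (ap2 h c)) \<and> eqM Cantor (ap2 g (ap2 h c)) c"
      using c gh by simp
  next
    fix x y
    assume xy: "x \<in> dm T1" "y \<in> dm T1" "ptM Unit_Interval x" "ptM Unit_Interval y" "eqM Unit_Interval x y"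
    then have "digit (vr x) n \<longleftrightarrow> digit (vr y) n" for n
      using ltq_cong[of "vr x" "vr y"] by (simp add: digit_def)
    then have "ap2 g x = ap2 g y"
      by (intro fn_ext gd xy) (simp add: gv[OF xy(1)] gv[OF xy(2)])
    then show "ptM Cantor (ap2 g y) \<and> eqM Cantor (ap2 g x) (ap2 g y)" by (simp add: gv[OF xy(2)])
  qed (auto simp: eqR_refl)
qed

text \<open>The three implications close a cycle through the spaces, so the equivalences are true in
  the model, and truth there is membership in \<open>X0\<close>.\<close>

lemma claim_X0: "claim i \<in> X0"
proof -
  have "WF [] (\<lambda>d. claim i)"
    using WF_cocode by (simp add: claim_def WF_def conjb_def iffb_def fm_defs)
  then have "claim i \<in> X0 \<longleftrightarrow> sat [] (claim i)"
    using henkin_set.Q_sat_closed[OF hX0, of "claim i"] by (simp add: WF_def)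
  also have "\<dots> \<longleftrightarrow> SAT [] ((cocode i Unit_Interval \<^bold>\<longleftrightarrow> cocode i Reals) \<^bold>\<and> (cocode i Reals \<^bold>\<longleftrightarrow> cocode i Cantor))"
    by (simp add: SAT_def claim_def)
  also have "\<dots>"
    using cocode_Reals_Unit_Interval cocode_Cantor_Reals cocode_Unit_Interval_Cantor
    by (auto simp: SAT_cocode)
  finally show ?thesis .
qed

end

theorem theorem2:
  fixes i :: nat
  assumes "i \<in> {0, 1}"
  shows "ACA0w \<turnstile> ((cocode i Unit_Interval \<^bold>\<longleftrightarrow> cocode i Reals) \<^bold>\<and>
                  (cocode i Reals \<^bold>\<longleftrightarrow> cocode i Cantor)) 0"
proof (rule ccontr)
  assume nd: "\<not> ?thesis"
  have w: "wff [] (claim i)"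
    using WF_cocode by (simp add: claim_def WF_def conjb_def iffb_def fm_defs)
  have fin: "finite (sparams ACA0w)"
    using params_ACA0w by (simp add: sparams_def)
  obtain X where "henkin X" "\<And>\<psi>. \<psi> \<in> ACA0w \<Longrightarrow> wff [] \<psi> \<Longrightarrow> \<psi> \<in> X" "claim i \<notin> X"
    using henkin_completeness[OF w fin] nd unfolding claim_def by blast
  \<comment> \<open>The choice behind \<open>X0\<close> may deliver a countermodel for another
    index; this does no harm, as \<open>claim_X0\<close> holds for every \<open>i\<close>.\<close>
  then have "\<exists>X. henkin_set X \<and> (\<exists>i. claim i \<notin> X)" by (auto simp: henkin_set_def)
  then have "henkin_set X0 \<and> (\<exists>i. claim i \<notin> X0)" unfolding X0_def by (rule someI_ex)
  then show False using countermodel.claim_X0 by (auto simp: countermodel_def)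
qed

end
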